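(* Let $f$ be a $C^{1+bv}$ (orientation-preserving) circle diffeomorphism of irrational rotation number $\rho(f)$. If $\phi:\mathrm{S}^1\to\mathbb{R}$ is an absolutely continuous function, then, in the $C^0$ (uniform) topology, $$\lim_{n\to\infty}\left[\phi+\phi\circ f+\cdots+\phi\circ f^{q_n-1}-q_n\int_{\mathrm{S}^1}\phi\,d\mu\right]=0,$$ where $(q_n)$ is the sequence of denominators of the rational approximations of $\rho(f)$ and $\mu$ is the unique $f$-invariant probability measure.
   Context: $\mathrm{S}^1=\mathbb{R}/\mathbb{Z}$. A $C^{1+bv}$ diffeomorphism is a $C^1$ diffeomorphism $f$ such that $\log(Df)$ has finite total variation. The rational approximations of $\rho(f)$ are the convergents $p_n/q_n$ of its continued fraction expansion. *)

theory Defs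
  imports "HOL-Probability.Probability"
begin

section \<open>The circle as the quotient of the reals by the integers\<close>

quotient_type circle = real / "\<lambda>x y :: real. x - y \<in> \<int>"
  morphisms rep_circle to_circle
proof (rule equivpI)
  show "reflp (\<lambda>x y :: real. x - y \<in> \<int>)"
    by (simp add: reflp_def)
  show "symp (\<lambda>x y :: real. x - y \<in> \<int>)"
    by (metis (no_types, lifting) Ints_minus minus_diff_eq sympI)
  show "transp (\<lambda>x y :: real. x - y \<in> \<int>)"
    by (rule transpI) (metis Ints_add diff_add_cancel add_diff_eq)
qed

lemma to_circle_eq_iff: "to_circle x = to_circle y \<longleftrightarrow> x - y \<in> \<int>"
  by (rule circle.abs_eq_iff)

lemma to_circle_rep [simp]: "to_circle (rep_circle p) = p"
  using Quotient3_circle by (rule Quotient3_abs_rep)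

instantiation circle :: topological_space
begin

definition open_circle :: "circle set \<Rightarrow> bool" where
  "open_circle U \<longleftrightarrow> open (to_circle -` U)"

instance
  by standard (auto simp: open_circle_def vimage_Union)

end

lemma continuous_on_to_circle: "continuous_on A to_circle"
proof -
  have "continuous_on UNIV to_circle"
    by (simp add: continuous_on_open_vimage open_circle_def)
  then show ?thesis
    by (rule continuous_on_subset) simp
qed


section \<open>Bounded variation and absolute continuity\<close>

definition bounded_variation_on :: "(real \<Rightarrow> real) \<Rightarrow> real set \<Rightarrow> bool" where
  "bounded_variation_on g S \<longleftrightarrow>
     (\<exists>B. \<forall>d. d division_of \<Union>d \<and> \<Union>d \<subseteq> S \<longrightarrow>
        (\<Sum>I\<in>d. \<bar>g (Sup I) - g (Inf I)\<bar>) \<le> B)"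

definition absolutely_continuous_on :: "(real \<Rightarrow> real) \<Rightarrow> real set \<Rightarrow> bool" where
  "absolutely_continuous_on g S \<longleftrightarrow>
     (\<forall>\<epsilon>>0. \<exists>\<delta>>0. \<forall>d. d division_of \<Union>d \<and> \<Union>d \<subseteq> S \<and> (\<Sum>I\<in>d. Sup I - Inf I) < \<delta> \<longrightarrow>
        (\<Sum>I\<in>d. \<bar>g (Sup I) - g (Inf I)\<bar>) < \<epsilon>)"

text \<open>A function on the circle is tested on a closed fundamental domain; both endpoints are
  included, so that the variation across the base point is seen.\<close>

definition circle_bounded_variation :: "(circle \<Rightarrow> real) \<Rightarrow> bool" where
  "circle_bounded_variation \<psi> \<longleftrightarrow> bounded_variation_on (\<lambda>x. \<psi> (to_circle x)) {0..1}"

definition circle_absolutely_continuous :: "(circle \<Rightarrow> real) \<Rightarrow> bool" where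
  "circle_absolutely_continuous \<phi> \<longleftrightarrow> absolutely_continuous_on (\<lambda>x. \<phi> (to_circle x)) {0..1}"


section \<open>Circle diffeomorphisms\<close>

definition circle_lift :: "(real \<Rightarrow> real) \<Rightarrow> (circle \<Rightarrow> circle) \<Rightarrow> bool" where
  "circle_lift F f \<longleftrightarrow> continuous_on UNIV F \<and> (\<forall>x. to_circle (F x) = f (to_circle x))"

definition C1_circle_map :: "(circle \<Rightarrow> circle) \<Rightarrow> bool" where
  "C1_circle_map f \<longleftrightarrow> (\<exists>F. circle_lift F f \<and> F C1_differentiable_on UNIV)"

definition C1_circle_diffeo :: "(circle \<Rightarrow> circle) \<Rightarrow> bool" where
  "C1_circle_diffeo f \<longleftrightarrow> bij f \<and> C1_circle_map f \<and> C1_circle_map (inv f)"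

definition orientation_preserving :: "(circle \<Rightarrow> circle) \<Rightarrow> bool" where
  "orientation_preserving f \<longleftrightarrow> (\<exists>F. circle_lift F f \<and> strict_mono F)"

text \<open>The choices of a lift and of a representative are immaterial: see
  \<open>circle_deriv_eq\<close> and \<open>rotation_number_eq\<close> below.\<close>

definition circle_deriv :: "(circle \<Rightarrow> circle) \<Rightarrow> circle \<Rightarrow> real" where
  "circle_deriv f p = deriv (SOME F. circle_lift F f) (rep_circle p)"

definition C1bv_circle_diffeo :: "(circle \<Rightarrow> circle) \<Rightarrow> bool" where
  "C1bv_circle_diffeo f \<longleftrightarrow>
     C1_circle_diffeo f \<and> circle_bounded_variation (\<lambda>p. ln (circle_deriv f p))"

text \<open>The rotation number, an element of \<open>\<real>/\<int>\<close>, is represented by a real number in \<open>[0,1)\<close>.\<close>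

definition rotation_number :: "(circle \<Rightarrow> circle) \<Rightarrow> real" where
  "rotation_number f = frac (lim (\<lambda>n. ((SOME F. circle_lift F f) ^^ n) 0 / real n))"

lemma continuous_Ints_constant:
  fixes h :: "real \<Rightarrow> real"
  assumes "continuous_on UNIV h" "\<And>x. h x \<in> \<int>"
  obtains m :: int where "\<And>x. h x = of_int m"
proof -
  have "h constant_on UNIV"
  proof (rule continuous_discrete_range_constant)
    show "\<exists>e>0. \<forall>y. y \<in> UNIV \<and> h y \<noteq> h x \<longrightarrow> e \<le> norm (h y - h x)" for x
    proof (intro exI[of _ 1] conjI allI impI)
      fix y assume *: "y \<in> UNIV \<and> h y \<noteq> h x"
      have "h y - h x \<in> \<int>" using assms(2) by (rule Ints_diff[OF assms(2)])
      then show "1 \<le> norm (h y - h x)"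
        using * by (simp add: Ints_nonzero_abs_ge1)
    qed simp
  qed (use assms in auto)
  then obtain c where c: "\<And>x. h x = c" by (auto simp: constant_on_def)
  obtain m :: int where "c = of_int m" using assms(2)[of 0] c by (auto elim: Ints_cases)
  with c that show thesis by blast
qed

lemma circle_lift_unique:
  assumes "circle_lift F f" "circle_lift G f"
  obtains m :: int where "\<And>x. G x = F x + of_int m"
proof -
  have "continuous_on UNIV (\<lambda>x. G x - F x)"
    using assms by (auto simp: circle_lift_def intro!: continuous_intros)
  moreover have "G x - F x \<in> \<int>" for x
    using assms by (simp add: circle_lift_def flip: to_circle_eq_iff)
  ultimately obtain m :: int where m: "\<And>x. G x - F x = of_int m"
    using continuous_Ints_constant[of "\<lambda>x. G x - F x"] by blast
  show thesis
    by (rule that[of m]) (use m in \<open>simp add: algebra_simps\<close>)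
qed

lemma circle_lift_some: "circle_lift F f \<Longrightarrow> circle_lift (SOME G. circle_lift G f) f"
  by (rule someI[of "\<lambda>G. circle_lift G f"])

lemma circle_deriv_eq:
  assumes F: "circle_lift F f" and D: "F differentiable_on UNIV"
  shows "circle_deriv f (to_circle x) = deriv F x"
proof -
  define G where "G = (SOME F. circle_lift F f)"
  define y where "y = rep_circle (to_circle x)"
  have G: "circle_lift G f" unfolding G_def using F by (rule circle_lift_some)
  have "to_circle y = to_circle x" by (simp add: y_def)
  then have "y - x \<in> \<int>" by (simp add: to_circle_eq_iff)
  then obtain k :: int where k: "y = x + of_int k"
    by (auto elim!: Ints_cases simp: algebra_simps)
  have shift: "to_circle (t + of_int k) = to_circle t" for t
    by (simp add: to_circle_eq_iff)
  have "circle_lift (\<lambda>t. G (t + of_int k)) f"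
    using G shift unfolding circle_lift_def
    by (auto intro!: continuous_intros elim: continuous_on_compose2)
  then obtain m :: int where "\<And>t. G (t + of_int k) = F t + of_int m"
    using circle_lift_unique[OF F] by blast
  then have m: "G = (\<lambda>s. F (s - of_int k) + of_int m)"
    by (metis diff_add_cancel)
  have "(F has_field_derivative deriv F x) (at x)"
    using D by (metis DERIV_imp_deriv differentiable_on_eq_differentiable_at iso_tuple_UNIV_I
        open_UNIV real_differentiable_def)
  then have "(G has_field_derivative deriv F x) (at y)"
    unfolding m k by (auto intro!: derivative_eq_intros DERIV_chain2[where f = F])
  then show ?thesis
    unfolding circle_deriv_def G_def[symmetric] y_def[symmetric] by (rule DERIV_imp_deriv)
qed

lemma rotation_number_eq:
  assumes F: "circle_lift F f" and deg: "\<And>x. F (x + 1) = F x + 1"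
    and lim: "(\<lambda>n. (F ^^ n) 0 / real n) \<longlonglongrightarrow> \<tau>"
  shows "rotation_number f = frac \<tau>"
proof -
  define G where "G = (SOME F. circle_lift F f)"
  have "circle_lift G f" unfolding G_def using F by (rule circle_lift_some)
  then obtain m :: int where m: "\<And>x. G x = F x + of_int m"
    using circle_lift_unique[OF F] by blast
  have nat: "F (x + real k) = F x + real k" for x k
  proof (induction k)
    case (Suc k)
    then show ?case using deg[of "x + real k"] by (simp add: add_ac)
  qed simp
  have int: "F (x + of_int k) = F x + of_int k" for x k
  proof (cases k rule: int_cases2)
    case (nonpos n)
    then show ?thesis using nat[of "x - real n" n] by simp
  qed (simp add: nat)
  have pow: "(G ^^ n) 0 = (F ^^ n) 0 + real n * of_int m" for n
  proof (induction n)
    case (Suc n)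
    then show ?case
      using int[of "(F ^^ n) 0" "int n * m"] by (simp add: m algebra_simps)
  qed simp
  have "(\<lambda>n. (F ^^ n) 0 / real n + of_int m) \<longlonglongrightarrow> \<tau> + of_int m"
    using lim by (intro tendsto_intros)
  moreover have "\<forall>\<^sub>F n in sequentially. (F ^^ n) 0 / real n + of_int m = (G ^^ n) 0 / real n"
    using eventually_gt_at_top[of 0] by eventually_elim (simp add: pow field_simps)
  ultimately have "(\<lambda>n. (G ^^ n) 0 / real n) \<longlonglongrightarrow> \<tau> + of_int m"
    by (rule Lim_transform_eventually)
  then have "lim (\<lambda>n. (G ^^ n) 0 / real n) = \<tau> + of_int m"
    by (rule limI)
  then show ?thesis
    unfolding rotation_number_def G_def[symmetric] by (simp add: frac_def)
qed


section \<open>Continued fractions\<close>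

primrec complete_quotient :: "real \<Rightarrow> nat \<Rightarrow> real" where
  "complete_quotient \<alpha> 0 = \<alpha>"
| "complete_quotient \<alpha> (Suc n) = 1 / frac (complete_quotient \<alpha> n)"

definition partial_quotient :: "real \<Rightarrow> nat \<Rightarrow> int" where
  "partial_quotient \<alpha> n = \<lfloor>complete_quotient \<alpha> n\<rfloor>"

text \<open>The convergent \<open>p\<^sub>n / q\<^sub>n\<close> in lowest terms is the finite continued fraction
  \<open>[a\<^sub>0; a\<^sub>1, \<dots>, a\<^sub>n]\<close>, whose denominator satisfies \<open>q\<^sub>0 = 1\<close>, \<open>q\<^sub>1 = a\<^sub>1\<close> and
  \<open>q\<^sub>n = a\<^sub>n q\<^sub>n\<^sub>-\<^sub>1 + q\<^sub>n\<^sub>-\<^sub>2\<close>. The conversion to natural numbers is harmless, since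
  \<open>a\<^sub>n \<ge> 1\<close> for \<open>n \<ge> 1\<close> when \<open>\<alpha>\<close> is irrational.\<close>

fun convergent_denom :: "real \<Rightarrow> nat \<Rightarrow> nat" where
  "convergent_denom \<alpha> 0 = 1"
| "convergent_denom \<alpha> (Suc 0) = nat (partial_quotient \<alpha> 1)"
| "convergent_denom \<alpha> (Suc (Suc n)) =
     nat (partial_quotient \<alpha> (Suc (Suc n))) * convergent_denom \<alpha> (Suc n) + convergent_denom \<alpha> n"


section \<open>Invariant measures\<close>

definition invariant_prob_measure :: "(circle \<Rightarrow> circle) \<Rightarrow> circle measure \<Rightarrow> bool" where
  "invariant_prob_measure f \<mu> \<longleftrightarrow>
     prob_space \<mu> \<and> sets \<mu> = sets borel \<and> distr \<mu> borel f = \<mu>"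

end

theory Submission
  imports Defs
begin

text \<open>Everything is lifted to \<open>\<real>\<close>. Let \<open>F\<close> be a lift of \<open>f\<close>, \<open>S\<^sub>k\<close> its Birkhoff sums and call a
  function negligible if the oscillation of its sums \<open>S\<close> over \<open>q\<^sub>n\<close> steps tends to \<open>0\<close>; integrating
  over the second point shows that the claim is that \<open>\<phi>\<close> is negligible.

  By the order of the orbits (that of a rotation), the iterates \<open>j < q\<^sub>n\<^sub>+\<^sub>1\<close> of a return interval
  \<open>[x, F\<^sup>q x - p]\<close> with \<open>q = q\<^sub>n\<close>, \<open>p = p\<^sub>n\<close> are disjoint modulo 1, and those with \<open>j < q\<^sub>n + q\<^sub>n\<^sub>+\<^sub>1\<close>
  cover. Hence the oscillation of the sums is at most three times the variation (Denjoy--Koksma); applied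
  to \<open>ln F'\<close> this gives \<open>F\<^sup>q - p \<rightarrow> id\<close> uniformly (Denjoy), so that coboundaries are negligible.

  It remains to change \<open>\<phi>\<close> by negligible functions so that its variation drops by a fixed factor, and
  to iterate. By absolute continuity \<open>\<phi>\<close> is close in variation to a piecewise linear function, whose
  derivative is a combination of indicators of intervals \<open>I\<close>, which can be cut into return intervals.
  Up to coboundaries the indicator of a return interval may be pushed around by the dynamics, and by
  bounded distortion a suitable average of its translates is bounded below by a fixed proportion
  of Lebesgue measure. The derivative has mean \<open>0\<close>, so these Lebesgue parts cancel.\<close>

section \<open>Variation of periodic functions\<close>

text \<open>Denjoy--Koksma alone bounds oscillations by a multiple of the variation and gives no
  decay; it becomes useful only for a remainder of small variation. The iteration works because the
  factor \<open>1 - spread\<close> gained in each round, with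
  \<open>spread = exp (- 2 * V) / 4\<close>, depends on \<open>F\<close> but neither on the function
  nor on the grid. In it \<open>exp (- 2 * V)\<close> is a distortion constant, one factor 1/2
  arises because the levels of a covering tower have total length at most 2, and the other because
  return intervals may fill only half of an arc. The index from which a coboundary is small is not
  uniform, but for a given \<epsilon> only finitely many coboundaries are used.

  No derivative of the test function is formed: increments over the grids \<open>j / K\<close>
  replace it, and densities are represented by their monotone Lipschitz primitives. Return intervals
  occur for even indices only, where they lie to the right of their base point; an odd index is
  reached from the even one before it.\<close>

lemma shift_int:
  fixes g :: "real \<Rightarrow> real"
  assumes "\<And>x. g (x + 1) = g x + c"
  shows "g (x + of_int k) = g x + of_int k * c"
proof -
  have nat: "g (x + real n) = g x + real n * c" for x n
  proof (induction n)
    case (Suc n)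
    then show ?case using assms[of "x + real n"] by (simp add: algebra_simps)
  qed simp
  show ?thesis
  proof (cases k rule: int_cases2)
    case (nonpos n)
    then show ?thesis using nat[of "x - real n" n] by simp
  qed (simp add: nat)
qed

text \<open>\<open>B\<close> bounds the variation over a period; \<open>W\<close> plays the role of the variation function.\<close>

definition variation_le :: "(real \<Rightarrow> real) \<Rightarrow> real \<Rightarrow> bool" where
  "variation_le \<psi> B \<longleftrightarrow>
     (\<exists>W. (\<forall>x. W (x + 1) = W x + B) \<and> (\<forall>x y. x \<le> y \<longrightarrow> \<bar>\<psi> y - \<psi> x\<bar> \<le> W y - W x))"

lemma variation_leI:
  assumes "\<And>x. W (x + 1) = W x + B" "\<And>x y. x \<le> y \<Longrightarrow> \<bar>\<psi> y - \<psi> x\<bar> \<le> W y - W x"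
  shows "variation_le \<psi> B"
  using assms unfolding variation_le_def by blast

lemma variation_le_add:
  assumes "variation_le \<phi> A" "variation_le \<psi> B"
  shows "variation_le (\<lambda>x. \<phi> x + \<psi> x) (A + B)"
proof -
  obtain V where V: "\<And>x. V (x + 1) = V x + A" "\<And>x y. x \<le> y \<Longrightarrow> \<bar>\<phi> y - \<phi> x\<bar> \<le> V y - V x"
    using assms(1) unfolding variation_le_def by blast
  obtain W where W: "\<And>x. W (x + 1) = W x + B" "\<And>x y. x \<le> y \<Longrightarrow> \<bar>\<psi> y - \<psi> x\<bar> \<le> W y - W x"
    using assms(2) unfolding variation_le_def by blast
  show ?thesis
  proof (rule variation_leI[where W = "\<lambda>x. V x + W x"])
    show "\<bar>\<phi> y + \<psi> y - (\<phi> x + \<psi> x)\<bar> \<le> V y + W y - (V x + W x)" if "x \<le> y" for x y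
      using V(2)[OF that] W(2)[OF that] by linarith
  qed (simp add: V(1) W(1))
qed

lemma variation_le_mono:
  assumes "variation_le \<psi> A" "A \<le> B"
  shows "variation_le \<psi> B"
proof -
  have "variation_le (\<lambda>x. 0) (B - A)"
  proof (rule variation_leI[where W = "\<lambda>x. (B - A) * x"])
    show "\<bar>0 - 0\<bar> \<le> (B - A) * y - (B - A) * x" if "x \<le> y" for x y
      using mult_left_mono[OF that, of "B - A"] assms(2) by simp
  qed (simp add: algebra_simps)
  from variation_le_add[OF assms(1) this] show ?thesis by simp
qed

lemma variation_le_nonneg:
  assumes "variation_le \<psi> B"
  shows "0 \<le> B"
proof -
  obtain W where W: "\<And>x. W (x + 1) = W x + B" "\<And>x y. x \<le> y \<Longrightarrow> \<bar>\<psi> y - \<psi> x\<bar> \<le> W y - W x"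
    using assms unfolding variation_le_def by blast
  show ?thesis using W(1)[of 0] W(2)[of 0 1] by simp
qed

text \<open>Ranking by midpoints puts a rightmost interval last, even if some intervals are single
  points. The others end before it begins, so the induction hypothesis applies with its left end in
  place of \<open>C\<close>.\<close>

lemma sum_disjoint_intervals_le:
  fixes W a b :: "_ \<Rightarrow> real"
  assumes "finite S" and W: "\<And>x y. x \<le> y \<Longrightarrow> W x \<le> W y"
    and "\<And>i. i \<in> S \<Longrightarrow> A \<le> a i \<and> a i \<le> b i \<and> b i \<le> C"
    and "\<And>i j. i \<in> S \<Longrightarrow> j \<in> S \<Longrightarrow> i \<noteq> j \<Longrightarrow> b i \<le> a j \<or> b j \<le> a i"
    and "A \<le> C"
  shows "(\<Sum>i\<in>S. W (b i) - W (a i)) \<le> W C - W A"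
  using assms(1,3-5)
proof (induction arbitrary: C rule: finite_ranking_induct[where f = "\<lambda>i. a i + b i"])
  case empty
  then show ?case using W by simp
next
  case (insert i S)
  show ?case
  proof (cases "i \<in> S")
    case True
    then show ?thesis using insert by (simp add: insert_absorb)
  next
    case False
    have le: "b j \<le> a i" if "j \<in> S" for j
      using insert.prems(2)[of i j] insert.prems(1)[of i] insert.prems(1)[of j]
        insert.hyps(2)[OF that] that False by fastforce
    have "(\<Sum>i\<in>S. W (b i) - W (a i)) \<le> W (a i) - W A"
      by (rule insert.IH) (use insert.prems le in auto)
    moreover have "W (b i) \<le> W C" using insert.prems(1)[of i] W by auto
    ultimately show ?thesis using False insert.hyps(1) by simp
  qed
qed

text \<open>Outside \<open>[0,1]\<close> the dominating function counts full periods.\<close>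

lemma variation_leI_unit_interval:
  assumes per: "\<And>x. \<psi> (x + 1) = \<psi> x"
    and V: "\<And>x y. 0 \<le> x \<Longrightarrow> x \<le> y \<Longrightarrow> y \<le> 1 \<Longrightarrow> \<bar>\<psi> y - \<psi> x\<bar> \<le> V y - V x"
    and "0 \<le> V 0" "V 1 \<le> B"
  shows "variation_le \<psi> B"
proof (rule variation_leI[where W = "\<lambda>x. of_int \<lfloor>x\<rfloor> * B + V (frac x)"])
  have peri: "\<psi> (x + of_int k) = \<psi> x" for x k
    using shift_int[of \<psi> 0] per by simp
  have psi: "\<psi> x = \<psi> (frac x)" for x
    using peri[of "frac x" "\<lfloor>x\<rfloor>"] by (simp add: frac_def)
  fix x y :: real
  show "of_int \<lfloor>x + 1\<rfloor> * B + V (frac (x + 1)) = of_int \<lfloor>x\<rfloor> * B + V (frac x) + B"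
    by (simp add: frac_def algebra_simps)
  assume "x \<le> y"
  have fr: "0 \<le> frac x" "frac x \<le> 1" "0 \<le> frac y" "frac y \<le> 1"
    by (auto simp: frac_lt_1 less_imp_le)
  have "\<bar>\<psi> (frac y) - \<psi> (frac x)\<bar> \<le> of_int (\<lfloor>y\<rfloor> - \<lfloor>x\<rfloor>) * B + V (frac y) - V (frac x)"
  proof (cases "\<lfloor>x\<rfloor> = \<lfloor>y\<rfloor>")
    case True
    then have "frac x \<le> frac y" using \<open>x \<le> y\<close> by (simp add: frac_def)
    then show ?thesis using V[of "frac x" "frac y"] fr True by simp
  next
    case False
    then have "\<lfloor>x\<rfloor> + 1 \<le> \<lfloor>y\<rfloor>" using floor_mono[OF \<open>x \<le> y\<close>] by linarith
    then have "1 \<le> real_of_int (\<lfloor>y\<rfloor> - \<lfloor>x\<rfloor>)" by linarith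
    moreover have "0 \<le> B" using V[of 0 1] assms(3,4) by simp
    ultimately have "B \<le> of_int (\<lfloor>y\<rfloor> - \<lfloor>x\<rfloor>) * B" by (simp add: mult_le_cancel_right1)
    moreover have "\<bar>\<psi> 1 - \<psi> (frac x)\<bar> \<le> V 1 - V (frac x)" using V[of "frac x" 1] fr by simp
    moreover have "\<bar>\<psi> (frac y) - \<psi> 0\<bar> \<le> V (frac y) - V 0" using V[of 0 "frac y"] fr by simp
    ultimately show ?thesis using per[of 0] assms(3,4) by simp
  qed
  then show "\<bar>\<psi> y - \<psi> x\<bar> \<le> of_int \<lfloor>y\<rfloor> * B + V (frac y) - (of_int \<lfloor>x\<rfloor> * B + V (frac x))"
    by (simp add: psi[of x] psi[of y] algebra_simps)
qed

text \<open>The dominating function is the variation over \<open>{0..x}\<close>, a supremum over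
  divisions. It dominates increments because any division inside \<open>{0..x}\<close> can be
  enlarged by the interval \<open>{x..y}\<close>.\<close>

lemma variation_leI_division:
  assumes per: "\<And>x. \<psi> (x + 1) = \<psi> x"
    and B: "\<And>d. d division_of \<Union>d \<Longrightarrow> \<Union>d \<subseteq> {0..1} \<Longrightarrow> (\<Sum>I\<in>d. \<bar>\<psi> (Sup I) - \<psi> (Inf I)\<bar>) \<le> B"
  shows "variation_le \<psi> B"
proof -
  define D where "D x = {d. d division_of \<Union>d \<and> \<Union>d \<subseteq> {0..x::real}}" for x
  define v where "v d = (\<Sum>I\<in>d. \<bar>\<psi> (Sup I) - \<psi> (Inf I)\<bar>)" for d
  define V where "V x = (SUP d\<in>D x. v d)" for x
  have emp: "{} \<in> D x" for x by (auto simp: D_def)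
  have bdd: "bdd_above (v ` D x)" if "x \<le> 1" for x
  proof (rule bdd_aboveI[where M = B])
    fix r assume "r \<in> v ` D x"
    then obtain d where d: "d \<in> D x" "r = v d" by blast
    moreover have "{0..x} \<subseteq> {0..1}" using that by simp
    ultimately show "r \<le> B" unfolding d(2) v_def by (intro B) (auto simp: D_def)
  qed
  have V0: "0 \<le> V x" if "x \<le> 1" for x
  proof -
    have "v {} \<le> V x" unfolding V_def by (rule cSUP_upper[OF emp bdd[OF that]])
    then show ?thesis by (simp add: v_def)
  qed
  show ?thesis
  proof (rule variation_leI_unit_interval[where V = V])
    show "\<psi> (x + 1) = \<psi> x" for x by (rule per)
    show "V 1 \<le> B" unfolding V_def
    proof (rule cSUP_least)
      show "v d \<le> B" if "d \<in> D 1" for d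
        unfolding v_def using that by (intro B) (simp_all add: D_def)
    qed (use emp in blast)
    fix x y :: real assume xy: "0 \<le> x" "x \<le> y" "y \<le> 1"
    show "\<bar>\<psi> y - \<psi> x\<bar> \<le> V y - V x"
    proof (cases "x = y")
      case False
      with xy have "x < y" by simp
      have "v d + \<bar>\<psi> y - \<psi> x\<bar> \<le> V y" if d: "d \<in> D x" for d
      proof -
        have fin: "finite d" using d by (auto simp: D_def division_of_def)
        have sub: "I \<subseteq> {0..x}" if "I \<in> d" for I using d that by (auto simp: D_def)
        have nin: "{x..y} \<notin> d" using sub[of "{x..y}"] \<open>x < y\<close> by auto
        have int: "interior {x..y} \<inter> interior I = {}" if "I \<in> d" for I
        proof -
          have "interior I \<subseteq> {0<..<x}" using interior_mono[OF sub[OF that]] by simp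
          then show ?thesis by auto
        qed
        have "insert {x..y} d division_of \<Union>(insert {x..y} d)"
        proof (rule division_ofI)
          show "finite (insert {x..y} d)" using fin by simp
          fix K assume K: "K \<in> insert {x..y} d"
          then show "K \<subseteq> \<Union>(insert {x..y} d)" by auto
          show "K \<noteq> {}" using K \<open>x < y\<close> d by (auto simp: D_def)
          show "\<exists>a b. K = cbox a b"
          proof (cases "K = {x..y}")
            case True
            then show ?thesis by (metis cbox_interval)
          next
            case False
            then show ?thesis using K d by (auto simp: D_def division_of_def)
          qed
          fix L assume L: "L \<in> insert {x..y} d" "K \<noteq> L"
          show "interior K \<inter> interior L = {}"
          proof (cases "K = {x..y} \<or> L = {x..y}")
            case True
            then show ?thesis using K L int by (metis Int_commute insertE)
          next
            case False
            then show ?thesis using K L d by (auto simp: D_def)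
          qed
        qed simp
        moreover have "\<Union>(insert {x..y} d) \<subseteq> {0..y}" using sub xy by fastforce
        ultimately have "insert {x..y} d \<in> D y" by (simp add: D_def)
        then have "v (insert {x..y} d) \<le> V y"
          unfolding V_def by (rule cSUP_upper[OF _ bdd[OF xy(3)]])
        then show ?thesis using nin fin \<open>x < y\<close> by (simp add: v_def)
      qed
      then have "V x \<le> V y - \<bar>\<psi> y - \<psi> x\<bar>"
        unfolding V_def[of x] by (intro cSUP_least) (use emp in \<open>auto simp: algebra_simps\<close>)
      then show ?thesis by simp
    qed simp
  qed (simp add: V0)
qed

section \<open>Variation and monotonicity tested locally or on grids\<close>

definition grid_increment :: "nat \<Rightarrow> (real \<Rightarrow> real) \<Rightarrow> nat \<Rightarrow> real" where
  "grid_increment K \<psi> j = \<psi> (real (Suc j) / real K) - \<psi> (real j / real K)"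

text \<open>Endpoints of a division are rounded down to the grid of mesh \<open>1 / (K * R)\<close>,
  where the grid sum bounds the increments; then \<open>R\<close> tends to infinity and continuity
  gives the claim. Only refinements of one grid enter, since only these are controlled by the
  piecewise linear approximation.\<close>

lemma variation_leI_grid:
  assumes per: "\<And>x. \<psi> (x + 1) = \<psi> x" and cont: "continuous_on UNIV \<psi>"
    and "0 < K" and B: "\<And>R. 0 < R \<Longrightarrow> (\<Sum>j<K * R. \<bar>grid_increment (K * R) \<psi> j\<bar>) \<le> B"
  shows "variation_le \<psi> B"
proof (rule variation_leI_division)
  show "\<psi> (x + 1) = \<psi> x" for x by (rule per)
next
  fix d :: "real set set" assume d: "d division_of \<Union>d" "\<Union>d \<subseteq> {0..1}"
  define r where "r R x = of_int \<lfloor>real (K * R) * x\<rfloor> / real (K * R)" for R x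
  \<comment> \<open>Degenerate intervals contribute nothing and are dropped: disjointness of
    interiors says nothing about their position.\<close>
  define e where "e = {I \<in> d. Inf I < Sup I}"
  have fin: "finite d" using d by auto
  have I: "\<exists>a b. I = {a..b} \<and> a \<le> b \<and> 0 \<le> a \<and> b \<le> 1" if "I \<in> d" for I
  proof -
    obtain a b where ab: "I = {a..b}" "I \<noteq> {}" using d(1) \<open>I \<in> d\<close> by (metis division_ofD(3,4) cbox_interval)
    moreover have "I \<subseteq> {0..1}" using d that by auto
    ultimately show ?thesis by (intro exI[of _ a] exI[of _ b]) auto
  qed
  have bounds: "0 \<le> Inf I \<and> Inf I \<le> Sup I \<and> Sup I \<le> 1" if "I \<in> d" for I
    using I[OF that] by auto
  have e_d: "I \<in> d" if "I \<in> e" for I using that by (simp add: e_def)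
  have fin_e: "finite e" using fin by (simp add: e_def)
  have disj: "Sup I \<le> Inf J \<or> Sup J \<le> Inf I" if IJ: "I \<in> e" "J \<in> e" "I \<noteq> J" for I J
  proof -
    obtain a b where ab: "I = {a..b}" "a < b" using I[of I] IJ by (auto simp: e_def)
    obtain a' b' where ab': "J = {a'..b'}" "a' < b'" using I[of J] IJ by (auto simp: e_def)
    have "interior I \<inter> interior J = {}" using d(1) IJ by (auto simp: e_def)
    then have "{a<..<b} \<inter> {a'<..<b'} = {}" by (simp add: ab ab')
    then have "min b b' \<le> max a a'"
      using dense[of "max a a'" "min b b'"] by force
    then show ?thesis using ab ab' by (auto simp: min_def max_def split: if_splits)
  qed
  have le: "(\<Sum>I\<in>e. \<bar>\<psi> (r R (Sup I)) - \<psi> (r R (Inf I))\<bar>) \<le> B" if "0 < R" for R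
  proof -
    \<comment> \<open>The sum of the absolute increments up to the rounded point, a monotone
      function of the point itself, so that disjointness is needed only before rounding.\<close>
    define W where "W x = (\<Sum>j<nat \<lfloor>real (K * R) * x\<rfloor>. \<bar>grid_increment (K * R) \<psi> j\<bar>)" for x
    have mono: "W x \<le> W y" if "x \<le> y" for x y
      unfolding W_def using that
      by (intro sum_mono2) (auto intro!: nat_mono floor_mono mult_left_mono)
    have W: "\<bar>\<psi> (r R y) - \<psi> (r R x)\<bar> \<le> W y - W x" if "0 \<le> x" "x \<le> y" for x y
    proof -
      define m n where "m = nat \<lfloor>real (K * R) * x\<rfloor>" and "n = nat \<lfloor>real (K * R) * y\<rfloor>"
      have mn: "m \<le> n" unfolding m_def n_def using that
        by (intro nat_mono floor_mono mult_left_mono) auto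
      have r: "r R x = real m / real (K * R)" "r R y = real n / real (K * R)"
        using that by (auto simp: r_def m_def n_def)
      have "\<psi> (r R y) - \<psi> (r R x) = (\<Sum>j=m..<n. grid_increment (K * R) \<psi> j)"
        unfolding r grid_increment_def
        by (rule sum_Suc_diff'[OF mn, of "\<lambda>i. \<psi> (real i / real (K * R))", symmetric])
      also have "\<bar>\<dots>\<bar> \<le> (\<Sum>j=m..<n. \<bar>grid_increment (K * R) \<psi> j\<bar>)" by (rule sum_abs)
      also have "\<dots> = W y - W x"
        unfolding W_def m_def[symmetric] n_def[symmetric]
        using sum_diff_nat_ivl[OF le0 mn, of "\<lambda>j. \<bar>grid_increment (K * R) \<psi> j\<bar>"]
        by (simp add: atLeast0LessThan)
      finally show ?thesis .
    qed
    have "(\<Sum>I\<in>e. \<bar>\<psi> (r R (Sup I)) - \<psi> (r R (Inf I))\<bar>) \<le> (\<Sum>I\<in>e. W (Sup I) - W (Inf I))"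
      by (intro sum_mono W) (simp_all add: bounds e_d)
    also have "\<dots> \<le> W 1 - W 0"
      by (rule sum_disjoint_intervals_le[OF fin_e mono])
        (simp_all add: bounds e_d disj)
    also have "\<dots> \<le> B" using B[OF that] by (simp add: W_def flip: of_nat_mult)
    finally show ?thesis .
  qed
  have r_lim: "(\<lambda>R. r R x) \<longlonglongrightarrow> x" for x
  proof -
    have "\<forall>\<^sub>F R in sequentially. norm (r R x - x) \<le> inverse (real R)"
      using eventually_gt_at_top[of 0]
    proof eventually_elim
      case (elim R)
      define t where "t = real (K * R)"
      have t: "real R \<le> t" "0 < t" using elim \<open>0 < K\<close> by (auto simp: t_def)
      have "r R x - x = (of_int \<lfloor>t * x\<rfloor> - t * x) / t"
        using t by (simp add: r_def[of R x, folded t_def] diff_divide_distrib)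
      moreover have "\<bar>of_int \<lfloor>t * x\<rfloor> - t * x\<bar> \<le> 1" by linarith
      ultimately have "\<bar>r R x - x\<bar> \<le> 1 / t" using t by (simp add: divide_right_mono)
      also have "\<dots> \<le> inverse (real R)" using t elim by (simp add: field_simps)
      finally show ?case by simp
    qed
    then have "(\<lambda>R. r R x - x) \<longlonglongrightarrow> 0"
      by (rule Lim_null_comparison) (rule LIMSEQ_inverse_real_of_nat[THEN LIMSEQ_imp_Suc])
    then show ?thesis by (simp add: LIM_zero_iff)
  qed
  have lim: "(\<lambda>R. \<psi> (r R x)) \<longlonglongrightarrow> \<psi> x" for x
  proof (rule isCont_tendsto_compose[OF _ r_lim])
    show "isCont \<psi> x" using cont by (simp add: continuous_on_eq_continuous_at)
  qed
  have "(\<lambda>R. \<Sum>I\<in>e. \<bar>\<psi> (r R (Sup I)) - \<psi> (r R (Inf I))\<bar>)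
      \<longlonglongrightarrow> (\<Sum>I\<in>e. \<bar>\<psi> (Sup I) - \<psi> (Inf I)\<bar>)"
    by (rule tendsto_sum, rule tendsto_rabs, rule tendsto_diff; rule lim)
  then have "(\<Sum>I\<in>e. \<bar>\<psi> (Sup I) - \<psi> (Inf I)\<bar>) \<le> B"
  proof (rule tendsto_upperbound)
    show "\<forall>\<^sub>F R in sequentially. (\<Sum>I\<in>e. \<bar>\<psi> (r R (Sup I)) - \<psi> (r R (Inf I))\<bar>) \<le> B"
      using eventually_gt_at_top[of 0] by (rule eventually_mono) (rule le)
  qed simp
  moreover have "(\<Sum>I\<in>d. \<bar>\<psi> (Sup I) - \<psi> (Inf I)\<bar>) = (\<Sum>I\<in>e. \<bar>\<psi> (Sup I) - \<psi> (Inf I)\<bar>)"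
  proof (rule sum.mono_neutral_right[OF fin])
    show "\<forall>I\<in>d - e. \<bar>\<psi> (Sup I) - \<psi> (Inf I)\<bar> = 0"
    proof
      fix I assume "I \<in> d - e"
      then have "Inf I = Sup I" using bounds[of I] by (auto simp: e_def)
      then show "\<bar>\<psi> (Sup I) - \<psi> (Inf I)\<bar> = 0" by simp
    qed
  qed (auto simp: e_def)
  ultimately show "(\<Sum>I\<in>d. \<bar>\<psi> (Sup I) - \<psi> (Inf I)\<bar>) \<le> B" by simp
qed

text \<open>The supremum of the points \<open>t\<close> of \<open>{x..y}\<close> with
  \<open>g x \<le> g t\<close> is one of them by continuity, and \<open>loc\<close> would move it
  further up if it were below \<open>y\<close>.\<close>

lemma locally_increasing_imp_increasing:
  fixes g :: "real \<Rightarrow> real"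
  assumes cont: "continuous_on UNIV g"
    and loc: "\<And>t. \<exists>s>t. \<forall>r\<in>{t..<s}. g t \<le> g r"
    and "x \<le> y"
  shows "g x \<le> g y"
proof (rule ccontr)
  assume "\<not> g x \<le> g y"
  define S where "S = {t \<in> {x..y}. g x \<le> g t}"
  have "closed S"
  proof -
    have "closed {t. g x \<le> g t}" using cont by (intro closed_Collect_le continuous_intros)
    then have "closed ({x..y} \<inter> {t. g x \<le> g t})" by (intro closed_Int) auto
    moreover have "S = {x..y} \<inter> {t. g x \<le> g t}" by (auto simp: S_def)
    ultimately show ?thesis by simp
  qed
  have ne: "S \<noteq> {}" and bdd: "bdd_above S" using \<open>x \<le> y\<close> by (auto simp: S_def)
  then have "Sup S \<in> S" using \<open>closed S\<close> by (intro closed_contains_Sup)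
  obtain s where s: "s > Sup S" "\<forall>r\<in>{Sup S..<s}. g (Sup S) \<le> g r" using loc by blast
  have "Sup S < y" using \<open>Sup S \<in> S\<close> \<open>\<not> g x \<le> g y\<close> by (auto simp: S_def order.strict_iff_order)
  define r where "r = min y ((Sup S + s) / 2)"
  have "r > Sup S" "r < s" "r \<le> y" using s \<open>Sup S < y\<close> by (auto simp: r_def min_def)
  moreover have "g (Sup S) \<le> g r" using s calculation by auto
  ultimately have "r \<in> S" using \<open>Sup S \<in> S\<close> by (auto simp: S_def)
  then show False using cSup_upper[OF _ bdd] \<open>r > Sup S\<close> by fastforce
qed

section \<open>Convergents\<close>

fun convergent_num :: "real \<Rightarrow> nat \<Rightarrow> int" where
  "convergent_num \<alpha> 0 = \<lfloor>\<alpha>\<rfloor>"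
| "convergent_num \<alpha> (Suc 0) = partial_quotient \<alpha> 1 * \<lfloor>\<alpha>\<rfloor> + 1"
| "convergent_num \<alpha> (Suc (Suc n)) =
     partial_quotient \<alpha> (Suc (Suc n)) * convergent_num \<alpha> (Suc n) + convergent_num \<alpha> n"

text \<open>The displacement of the n-th return of the rotation by \<alpha>. Its alternating sign
  decides on which side a return lies, its decreasing size how returns are nested.\<close>

definition convergent_error :: "real \<Rightarrow> nat \<Rightarrow> real" where
  "convergent_error \<alpha> n = real (convergent_denom \<alpha> n) * \<alpha> - of_int (convergent_num \<alpha> n)"

context
  fixes \<alpha> :: real
  assumes irrational: "\<alpha> \<notin> \<rat>"
begin

lemma complete_quotient_irrational: "complete_quotient \<alpha> n \<notin> \<rat>"
proof (induction n)
  case (Suc n)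
  have "complete_quotient \<alpha> n \<in> \<rat>" if "1 / frac (complete_quotient \<alpha> n) \<in> \<rat>"
  proof -
    have "frac (complete_quotient \<alpha> n) \<in> \<rat>" using Rats_inverse[OF that] by simp
    then have "frac (complete_quotient \<alpha> n) + of_int \<lfloor>complete_quotient \<alpha> n\<rfloor> \<in> \<rat>"
      by (intro Rats_add) auto
    moreover have "frac (complete_quotient \<alpha> n) + of_int \<lfloor>complete_quotient \<alpha> n\<rfloor> = complete_quotient \<alpha> n"
      by (simp add: frac_def)
    ultimately show ?thesis by metis
  qed
  with Suc show ?case by auto
qed (simp add: irrational)

lemma frac_complete_quotient:
  "0 < frac (complete_quotient \<alpha> n)" "frac (complete_quotient \<alpha> n) < 1"
  using complete_quotient_irrational[of n] Rats_of_int
  by (auto simp: frac_lt_1 frac_gt_0_iff elim!: Ints_cases)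

lemma partial_quotient_ge_1: "1 \<le> partial_quotient \<alpha> (Suc n)"
  using frac_complete_quotient[of n] by (simp add: partial_quotient_def le_floor_iff)

lemma convergent_denom_Suc_Suc:
  "int (convergent_denom \<alpha> (Suc (Suc n))) =
     partial_quotient \<alpha> (Suc (Suc n)) * int (convergent_denom \<alpha> (Suc n)) + int (convergent_denom \<alpha> n)"
  using partial_quotient_ge_1[of "Suc n"] by simp


lemma convergent_denom_pos: "0 < convergent_denom \<alpha> n"
proof (induction n rule: less_induct)
  case (less n)
  consider "n = 0" | "n = 1" | m where "n = Suc (Suc m)" by (metis One_nat_def not0_implies_Suc)
  then show ?case
    by cases (use less partial_quotient_ge_1[of 0] in auto)
qed

text \<open>The index starts at 1 because \<open>convergent_denom \<alpha> 0\<close> and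
  \<open>convergent_denom \<alpha> 1\<close> agree when the first partial quotient is 1.\<close>

lemma convergent_denom_less_Suc: "convergent_denom \<alpha> (Suc n) < convergent_denom \<alpha> (Suc (Suc n))"
proof -
  have "1 * int (convergent_denom \<alpha> (Suc n)) \<le> partial_quotient \<alpha> (Suc (Suc n)) * int (convergent_denom \<alpha> (Suc n))"
    using partial_quotient_ge_1[of "Suc n"] by (intro mult_right_mono) auto
  then show ?thesis using convergent_denom_Suc_Suc[of n] convergent_denom_pos[of n] by linarith
qed

lemma convergent_denom_le_Suc: "convergent_denom \<alpha> n \<le> convergent_denom \<alpha> (Suc n)"
proof (cases n)
  case 0
  then show ?thesis using convergent_denom_pos[of 1] by simp
next
  case (Suc m)
  then show ?thesis using convergent_denom_less_Suc[of m] by simp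
qed

text \<open>Divided by its middle term, the three-term recursion of the errors becomes the step
  \<open>frac (1 / t)\<close> of the Gauss map. Hence the fractional parts of the complete quotients
  are, up to sign, the ratios of consecutive errors.\<close>

lemma convergent_error_Suc:
  "convergent_error \<alpha> (Suc n) = - frac (complete_quotient \<alpha> (Suc n)) * convergent_error \<alpha> n"
proof (induction n)
  case 0
  define a where "a = real_of_int (partial_quotient \<alpha> 1)"
  have "real (convergent_denom \<alpha> (Suc 0)) = a"
    using partial_quotient_ge_1[of 0] by (simp add: a_def)
  then have "convergent_error \<alpha> (Suc 0) = a * \<alpha> - (a * of_int \<lfloor>\<alpha>\<rfloor> + 1)"
    unfolding convergent_error_def by (simp only:) (simp add: a_def)
  also have "\<dots> = a * frac \<alpha> - 1" by (simp add: frac_def algebra_simps)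
  also have "\<dots> = - (1 / frac \<alpha> - a) * frac \<alpha>"
    using frac_complete_quotient(1)[of 0] by (simp add: left_diff_distrib)
  also have "1 / frac \<alpha> - a = frac (complete_quotient \<alpha> (Suc 0))"
    by (simp add: frac_def a_def partial_quotient_def)
  also have "frac \<alpha> = convergent_error \<alpha> 0"
    by (simp add: convergent_error_def frac_def)
  finally show ?case .
next
  case (Suc n)
  define t where "t = frac (complete_quotient \<alpha> (Suc n))"
  have t: "0 < t" unfolding t_def by (rule frac_complete_quotient)
  have "real (convergent_denom \<alpha> (Suc (Suc n))) =
     of_int (partial_quotient \<alpha> (Suc (Suc n))) * real (convergent_denom \<alpha> (Suc n)) + real (convergent_denom \<alpha> n)"
    using partial_quotient_ge_1[of "Suc n"] by simp
  then have "convergent_error \<alpha> (Suc (Suc n)) =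
      of_int (partial_quotient \<alpha> (Suc (Suc n))) * convergent_error \<alpha> (Suc n) + convergent_error \<alpha> n"
    by (simp add: convergent_error_def algebra_simps)
  also have "convergent_error \<alpha> n = - (1 / t) * convergent_error \<alpha> (Suc n)"
    using t by (simp add: Suc[folded t_def])
  also have "1 / t = of_int (partial_quotient \<alpha> (Suc (Suc n))) + frac (complete_quotient \<alpha> (Suc (Suc n)))"
    by (simp add: partial_quotient_def t_def frac_def)
  finally show ?case by (simp add: algebra_simps)
qed

lemma convergent_error_sign: "0 < (-1) ^ n * convergent_error \<alpha> n"
proof (induction n)
  case 0
  then show ?case using frac_complete_quotient[of 0] by (simp add: convergent_error_def frac_def)
next
  case (Suc n)
  have "0 < frac (complete_quotient \<alpha> (Suc n)) * ((-1) ^ n * convergent_error \<alpha> n)"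
    by (intro mult_pos_pos frac_complete_quotient(1) Suc)
  then show ?case by (simp add: convergent_error_Suc algebra_simps)
qed

lemma convergent_error_less: "\<bar>convergent_error \<alpha> (Suc n)\<bar> < \<bar>convergent_error \<alpha> n\<bar>"
proof -
  have "convergent_error \<alpha> n \<noteq> 0" using convergent_error_sign[of n] by auto
  then show ?thesis
    using frac_complete_quotient[of "Suc n"] by (simp add: convergent_error_Suc abs_mult)
qed

lemma convergent_error_less_1: "\<bar>convergent_error \<alpha> n\<bar> < 1"
proof (induction n)
  case 0
  then show ?case by (simp add: convergent_error_def) linarith
next
  case (Suc n)
  then show ?case using convergent_error_less[of n] by simp
qed

lemma convergent_determinant:
  "int (convergent_denom \<alpha> n) * convergent_num \<alpha> (Suc n)
     - int (convergent_denom \<alpha> (Suc n)) * convergent_num \<alpha> n = (-1) ^ n"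
proof (induction n)
  case 0
  then show ?case using partial_quotient_ge_1[of 0] by simp
next
  case (Suc n)
  then show ?case
    by (simp add: convergent_denom_Suc_Suc algebra_simps del: convergent_denom.simps)
qed

text \<open>Since consecutive convergents form a basis of \<open>\<int>\<^sup>2\<close>, \<open>(j, p)\<close> is an integer combination
  of them. Both coefficients can only be nonzero with opposite signs when \<open>0 < j < q\<^sub>n\<^sub>+\<^sub>1\<close>, and then
  the two errors, which also have opposite signs, add up without cancellation.\<close>

lemma best_approximation:
  assumes "0 < j" "j < convergent_denom \<alpha> (Suc n)"
  shows "\<bar>convergent_error \<alpha> n\<bar> \<le> \<bar>real j * \<alpha> + of_int p\<bar>"
proof -
  define q q' P P' where "q = int (convergent_denom \<alpha> n)" and "q' = int (convergent_denom \<alpha> (Suc n))"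
    and "P = convergent_num \<alpha> n" and "P' = convergent_num \<alpha> (Suc n)"
  define e where "e = (-1 :: int) ^ n"
  \<comment> \<open>Cramer's rule for \<open>j = u * q + v * q'\<close> and
    \<open>- p = u * P + v * P'\<close>; the determinant \<open>e\<close> is its own
    inverse.\<close>
  define u v where "u = e * (int j * P' + p * q')" and "v = - e * (int j * P + p * q)"
  have det: "q * P' - q' * P = e" and ee: "e * e = 1"
    using convergent_determinant[of n] by (simp_all add: q_def q'_def P_def P'_def e_def flip: power_mult_distrib)
  have q: "q > 0" "q' > 0" using convergent_denom_pos by (simp_all add: q_def q'_def)
  have j: "int j = u * q + v * q'"
  proof -
    have "u * q + v * q' = e * (int j * (q * P' - q' * P))" by (simp add: u_def v_def algebra_simps)
    also have "\<dots> = (e * e) * int j" unfolding det by simp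
    finally show ?thesis using ee by simp
  qed
  have p: "- p = u * P + v * P'"
  proof -
    have "u * P + v * P' = - (e * (p * (q * P' - q' * P)))" by (simp add: u_def v_def algebra_simps)
    also have "\<dots> = - ((e * e) * p)" unfolding det by simp
    finally show ?thesis using ee by simp
  qed
  define d d' where "d = convergent_error \<alpha> n" and "d' = convergent_error \<alpha> (Suc n)"
  have val: "real j * \<alpha> + of_int p = of_int u * d + of_int v * d'"
  proof -
    have "real j = of_int u * of_int q + of_int v * of_int q'" using arg_cong[OF j, of real_of_int] by simp
    moreover have "real_of_int p = - (of_int u * of_int P + of_int v * of_int P')"
      using arg_cong[OF p, of real_of_int] by simp
    ultimately show ?thesis
      by (simp add: d_def d'_def convergent_error_def q_def q'_def P_def P'_def algebra_simps)
  qed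
  have j_bounds: "0 < u * q + v * q'" "u * q + v * q' < q'" using assms j by (auto simp: q'_def)
  have u0: "u \<noteq> 0"
  proof
    assume "u = 0"
    then show False using j_bounds q
      by (simp add: zero_less_mult_iff mult_less_cancel_right1)
  qed
  have dd: "d * d' < 0"
    using convergent_error_sign[of n] convergent_error_sign[of "Suc n"]
    by (cases "even n") (auto simp: d_def d'_def mult_less_0_iff)
  have uv: "u * v \<le> 0"
  proof (rule ccontr)
    assume "\<not> u * v \<le> 0"
    then consider "0 < u" "0 < v" | "u < 0" "v < 0" by (auto simp: not_le zero_less_mult_iff)
    then show False
    proof cases
      case 1
      then have "0 < u * q" "1 * q' \<le> v * q'" using q by (auto intro: mult_right_mono)
      then show False using j_bounds by linarith
    next
      case 2
      then have "u * q < 0" "v * q' < 0" using q by (auto simp: mult_less_0_iff)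
      then show False using j_bounds by linarith
    qed
  qed
  have "0 \<le> of_int (u * v) * (d * d')" using uv dd by (intro mult_nonpos_nonpos) linarith+
  then have "0 \<le> (of_int u * d) * (of_int v * d')" by (simp add: mult_ac)
  moreover have "\<bar>a\<bar> \<le> \<bar>a + b\<bar>" if "0 \<le> a * b" for a b :: real
    using that by (auto simp: zero_le_mult_iff)
  ultimately have "\<bar>of_int u * d\<bar> \<le> \<bar>of_int u * d + of_int v * d'\<bar>" by blast
  moreover have "1 * \<bar>d\<bar> \<le> \<bar>of_int u * d\<bar>"
    unfolding abs_mult using u0 by (intro mult_right_mono) auto
  ultimately show ?thesis by (simp add: val d_def)
qed

end

section \<open>Lifts of circle diffeomorphisms\<close>

lemma sum_lessThan_add:
  fixes f :: "nat \<Rightarrow> real"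
  shows "(\<Sum>j<m + n. f j) = (\<Sum>j<m. f j) + (\<Sum>j<n. f (m + j))"
  by (induction n) (auto simp: add.assoc)

locale degree_one_lift =
  fixes F :: "real \<Rightarrow> real"
  assumes lift_plus_1: "F (x + 1) = F x + 1"
    and lift_less: "x < y \<Longrightarrow> F x < F y"
begin

lemma iter_less: "x < y \<Longrightarrow> (F ^^ n) x < (F ^^ n) y"
  by (induction n) (auto intro: lift_less)

lemma iter_le: "x \<le> y \<Longrightarrow> (F ^^ n) x \<le> (F ^^ n) y"
  using iter_less[of x y n] by (cases "x = y") auto

lemma lift_plus_int: "F (x + of_int k) = F x + of_int k"
  using shift_int[of F 1] lift_plus_1 by simp

lemma iter_plus_int: "(F ^^ n) (x + of_int k) = (F ^^ n) x + of_int k"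
  by (induction n) (auto simp: lift_plus_int)

lemma iter_add: "(F ^^ (m + n)) x = (F ^^ m) ((F ^^ n) x)"
  by (simp add: funpow_add)

section \<open>Existence of the translation number\<close>

lemma iter_bound_le:
  assumes "(F ^^ k) y \<le> y + of_int b"
  shows "(F ^^ (k * m)) y \<le> y + real m * of_int b"
proof (induction m)
  case (Suc m)
  have "(F ^^ (k * Suc m)) y = (F ^^ k) ((F ^^ (k * m)) y)" by (simp flip: iter_add)
  also have "\<dots> \<le> (F ^^ k) (y + of_int (int m * b))" using Suc by (intro iter_le) simp
  also have "\<dots> = (F ^^ k) y + of_int (int m * b)" by (rule iter_plus_int)
  finally show ?case using assms by (simp add: algebra_simps)
qed simp

lemma iter_bound_ge:
  assumes "y + of_int b \<le> (F ^^ k) y"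
  shows "y + real m * of_int b \<le> (F ^^ (k * m)) y"
proof (induction m)
  case (Suc m)
  have "(F ^^ k) (y + of_int (int m * b)) \<le> (F ^^ k) ((F ^^ (k * m)) y)" using Suc by (intro iter_le) simp
  also have "\<dots> = (F ^^ (k * Suc m)) y" by (simp flip: iter_add)
  finally have "(F ^^ k) y + of_int (int m * b) \<le> (F ^^ (k * Suc m)) y" by (simp only: iter_plus_int)
  then show ?case using assms by (simp add: algebra_simps)
qed simp

text \<open>If \<open>F ^^ n\<close> moves 0 by an amount between \<open>k\<close> and
  \<open>k + 1\<close>, then \<open>m\<close> such moves amount to something between
  \<open>m * k\<close> and \<open>m * (k + 1)\<close>. So the averages at \<open>n\<close> and
  \<open>n * m\<close> differ by at most \<open>1 / n\<close>, and comparing the averages at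
  \<open>m\<close> and at \<open>n\<close> with the one at \<open>m * n\<close> gives a Cauchy
  sequence.\<close>

lemma rotation_convergent: "convergent (\<lambda>n. (F ^^ n) 0 / real n)"
proof -
  define a where "a n = (F ^^ n) 0 / real n" for n
  have mult: "\<bar>a (n * m) - a n\<bar> \<le> 1 / real n" if "0 < n" "0 < m" for n m
  proof -
    define k where "k = \<lfloor>(F ^^ n) 0\<rfloor>"
    have k: "0 + of_int k \<le> (F ^^ n) 0" "(F ^^ n) 0 \<le> 0 + of_int (k + 1)" unfolding k_def by linarith+
    have "real m * of_int k \<le> (F ^^ (n * m)) 0" "(F ^^ (n * m)) 0 \<le> real m * of_int (k + 1)"
      using iter_bound_ge[OF k(1), of m] iter_bound_le[OF k(2), of m] by simp_all
    then have "real m * of_int k / real (n * m) \<le> a (n * m)" "a (n * m) \<le> real m * of_int (k + 1) / real (n * m)"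
      unfolding a_def by (simp_all only: divide_right_mono of_nat_0_le_iff)
    then have "of_int k / real n \<le> a (n * m)" "a (n * m) \<le> of_int (k + 1) / real n"
      using that by simp_all
    moreover have "of_int k / real n \<le> a n" "a n \<le> of_int (k + 1) / real n"
      unfolding a_def using k by (simp_all add: divide_right_mono)
    ultimately show ?thesis by (simp add: add_divide_distrib abs_le_iff)
  qed
  have "Cauchy a"
  proof (rule metric_CauchyI)
    fix e :: real assume "0 < e"
    then obtain N :: nat where N: "2 / e < real N" using reals_Archimedean2 by blast
    moreover have "0 < 2 / e" using \<open>0 < e\<close> by simp
    ultimately have N0: "0 < real N" by linarith
    show "\<exists>N. \<forall>m\<ge>N. \<forall>n\<ge>N. dist (a m) (a n) < e"
    proof (intro exI[of _ N] allI impI)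
      fix m n assume mn: "N \<le> m" "N \<le> n"
      have "\<bar>a m - a n\<bar> \<le> 1 / real m + 1 / real n"
        using mult[of m n] mult[of n m] mn N0 by (simp add: mult.commute[of n m] abs_le_iff)
      also have "\<dots> \<le> 1 / real N + 1 / real N"
        using mn N0 by (intro add_mono divide_left_mono) auto
      also have "\<dots> < e" using N N0 \<open>0 < e\<close> by (simp add: field_simps)
      finally show "dist (a m) (a n) < e" by (simp add: dist_real_def)
    qed
  qed
  then have "convergent a" by (rule Cauchy_convergent)
  then show ?thesis by (simp add: a_def[abs_def])
qed

end

text \<open>The translation number of the lift is \<alpha> itself and not merely \<alpha> modulo 1,
  so that the numerators of the convergents of \<alpha> are the integers by which returns are
  corrected.\<close>

locale circle_diffeo_lift = degree_one_lift F for F :: "real \<Rightarrow> real" +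
  fixes F' :: "real \<Rightarrow> real" and \<alpha> V :: real
  assumes lift_deriv: "(F has_real_derivative F' x) (at x)"
    and deriv_pos: "0 < F' x"
    and log_deriv_variation: "variation_le (\<lambda>x. ln (F' x)) V"
    and rotation: "(\<lambda>n. (F ^^ n) 0 / real n) \<longlonglongrightarrow> \<alpha>"
    and irrational: "\<alpha> \<notin> \<rat>"
begin

abbreviation q :: "nat \<Rightarrow> nat" where "q \<equiv> convergent_denom \<alpha>"

lemma iter_cont: "continuous_on UNIV (F ^^ n)"
proof (induction n)
  case (Suc n)
  have "continuous_on UNIV F"
    using lift_deriv by (intro DERIV_continuous_on) (auto intro: DERIV_subset)
  then show ?case using Suc by (auto intro: continuous_on_compose2 simp: o_def)
qed (simp add: id_def)

lemma iter_surj: "\<exists>x. (F ^^ n) x = y"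
proof -
  define k where "k = \<lfloor>y - (F ^^ n) 0\<rfloor>"
  have "(F ^^ n) (of_int k) \<le> y" "y \<le> (F ^^ n) (of_int (k + 1))"
    using iter_plus_int[of n 0 k] iter_plus_int[of n 0 "k + 1"] unfolding k_def by simp_all linarith+
  then show ?thesis
    using IVT'[of "F ^^ n" "of_int k" y "of_int (k + 1)"] continuous_on_subset[OF iter_cont] by auto
qed

section \<open>The order of the orbits\<close>

lemma rotation_at: "(\<lambda>n. (F ^^ n) y / real n) \<longlonglongrightarrow> \<alpha>"
proof -
  define c where "c = \<lceil>\<bar>y\<bar>\<rceil>"
  have c: "- of_int c \<le> y" "y \<le> of_int c" unfolding c_def by linarith+
  have bd: "norm ((F ^^ n) y - (F ^^ n) 0) \<le> of_int c" for n
    using iter_le[OF c(1), of n] iter_le[OF c(2), of n] iter_plus_int[of n 0 c] iter_plus_int[of n 0 "- c"]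
    by simp
  have "(\<lambda>n. of_int c * inverse (real n)) \<longlonglongrightarrow> of_int c * 0"
    by (intro tendsto_intros lim_inverse_n)
  then have "(\<lambda>n. of_int c * inverse (real n)) \<longlonglongrightarrow> 0" by simp
  moreover have "\<forall>\<^sub>F n in sequentially. norm ((F ^^ n) y / real n - (F ^^ n) 0 / real n) \<le> of_int c * inverse (real n)"
  proof (rule always_eventually, rule allI)
    fix n
    have "(F ^^ n) y / real n - (F ^^ n) 0 / real n = ((F ^^ n) y - (F ^^ n) 0) * inverse (real n)"
      by (simp add: divide_inverse left_diff_distrib)
    then show "norm ((F ^^ n) y / real n - (F ^^ n) 0 / real n) \<le> of_int c * inverse (real n)"
      using mult_right_mono[OF bd[of n], of "inverse (real n)"] by (simp add: abs_mult)
  qed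
  ultimately have "(\<lambda>n. (F ^^ n) y / real n - (F ^^ n) 0 / real n) \<longlonglongrightarrow> 0"
    by (rule Lim_null_comparison[rotated])
  from tendsto_add[OF this rotation] show ?thesis by simp
qed

lemma rotation_subseq:
  assumes "0 < k"
  shows "(\<lambda>m. ((F ^^ (k * Suc m)) y - y) / real (Suc m)) \<longlonglongrightarrow> real k * \<alpha>"
proof -
  have "(\<lambda>m. (F ^^ (k * m)) y / real (k * m)) \<longlonglongrightarrow> \<alpha>"
    using LIMSEQ_subseq_LIMSEQ[OF rotation_at[of y], of "\<lambda>m. k * m"] assms
    by (simp add: strict_mono_def o_def)
  from LIMSEQ_Suc[OF this]
  have "(\<lambda>m. real k * ((F ^^ (k * Suc m)) y / real (k * Suc m)) - y * inverse (real (Suc m)))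
      \<longlonglongrightarrow> real k * \<alpha> - y * 0"
    by (intro tendsto_intros LIMSEQ_inverse_real_of_nat)
  moreover have "real k * (c / real (k * Suc m)) - y * inverse (real (Suc m)) = (c - y) / real (Suc m)" for c m
    using assms by (simp add: divide_inverse left_diff_distrib del: of_nat_Suc mult_Suc_right)
  ultimately show ?thesis by simp
qed

lemma rotation_le:
  assumes "(F ^^ k) y \<le> y + of_int b"
  shows "real k * \<alpha> \<le> of_int b"
proof (cases "k = 0")
  case False
  have "((F ^^ (k * Suc m)) y - y) / real (Suc m) \<le> of_int b" for m
    using iter_bound_le[OF assms, of "Suc m"] by (simp add: divide_le_eq mult.commute)
  then show ?thesis using LIMSEQ_le_const2[OF rotation_subseq[of k y]] False by blast
qed (use assms in simp)

lemma rotation_ge: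
  assumes "y + of_int b \<le> (F ^^ k) y"
  shows "of_int b \<le> real k * \<alpha>"
proof (cases "k = 0")
  case False
  have "of_int b \<le> ((F ^^ (k * Suc m)) y - y) / real (Suc m)" for m
    using iter_bound_ge[OF assms, of "Suc m"] by (simp add: le_divide_eq mult.commute)
  then show ?thesis using LIMSEQ_le_const[OF rotation_subseq[of k y]] False by blast
qed (use assms in simp)

text \<open>After the common iterate is split off, a single iterate is compared with an integer
  translation. The wrong order at one point would persist along its orbit and give the wrong
  inequality for the translation number, by \<open>rotation_le\<close> or
  \<open>rotation_ge\<close>.\<close>

lemma orbit_less:
  assumes "real a * \<alpha> + of_int b < real a' * \<alpha> + of_int b'"
  shows "(F ^^ a) x + of_int b < (F ^^ a') x + of_int b'"
proof (cases "a \<le> a'")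
  case True
  then obtain k where k: "a' = k + a" by (metis le_add_diff_inverse2)
  then have "\<not> real k * \<alpha> \<le> of_int (b - b')" using assms by (simp add: algebra_simps)
  then have "\<not> (F ^^ k) ((F ^^ a) x) \<le> (F ^^ a) x + of_int (b - b')" using rotation_le by blast
  then show ?thesis by (simp add: k iter_add)
next
  case False
  then obtain k where k: "a = k + a'" by (metis le_add_diff_inverse2 nat_le_linear)
  then have "\<not> of_int (b' - b) \<le> real k * \<alpha>" using assms by (simp add: algebra_simps)
  then have "\<not> (F ^^ a') x + of_int (b' - b) \<le> (F ^^ k) ((F ^^ a') x)" using rotation_ge by blast
  then show ?thesis by (simp add: k iter_add)
qed

lemma orbit_le:
  assumes "real a * \<alpha> + of_int b \<le> real a' * \<alpha> + of_int b'"
  shows "(F ^^ a) x + of_int b \<le> (F ^^ a') x + of_int b'"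
proof (cases "real a * \<alpha> + of_int b = real a' * \<alpha> + of_int b'")
  case True
  then have eq: "(real a - real a') * \<alpha> = of_int (b' - b)" by (simp add: algebra_simps)
  have "a = a'"
  proof (rule ccontr)
    assume "a \<noteq> a'"
    then have "\<alpha> = of_int (b' - b) / of_int (int a - int a')" using eq by (simp add: field_simps)
    then have "\<alpha> \<in> \<rat>" by (metis Rats_divide Rats_of_int)
    then show False using irrational by simp
  qed
  then show ?thesis using eq by simp
next
  case False
  then show ?thesis using orbit_less[of a b a' b' x] assms by simp
qed

subsection \<open>First return maps\<close>

text \<open>A lift of the closest return of order \<open>n\<close>, corrected by an integer so as to
  be near the identity. It commutes with \<open>F\<close> and with integer translations.\<close>

definition ret :: "nat \<Rightarrow> real \<Rightarrow> real" where
  "ret n x = (F ^^ q n) x - of_int (convergent_num \<alpha> n)"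

lemma iter_q: "(F ^^ q n) x = ret n x + of_int (convergent_num \<alpha> n)"
  by (simp add: ret_def)

lemma ret_le: "x \<le> y \<Longrightarrow> ret n x \<le> ret n y"
  by (simp add: ret_def iter_le)

lemma ret_plus_int: "ret n (x + of_int k) = ret n x + of_int k"
  by (simp add: ret_def iter_plus_int)

lemma iter_ret: "(F ^^ j) (ret n x) = ret n ((F ^^ j) x)"
proof -
  have "(F ^^ j) ((F ^^ q n) x + of_int (- convergent_num \<alpha> n)) = (F ^^ (j + q n)) x + of_int (- convergent_num \<alpha> n)"
    by (simp only: iter_plus_int iter_add)
  also have "j + q n = q n + j" by simp
  finally show ?thesis by (simp add: ret_def iter_add)
qed

lemma ret_even: "even n \<Longrightarrow> x < ret n x"
  using orbit_less[of 0 0 "q n" "- convergent_num \<alpha> n" x] convergent_error_sign[OF irrational, of n]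
  by (simp add: ret_def convergent_error_def)

lemma ret_odd: "odd n \<Longrightarrow> ret n x < x"
  using orbit_less[of "q n" "- convergent_num \<alpha> n" 0 0 x] convergent_error_sign[OF irrational, of n]
  by (simp add: ret_def convergent_error_def)

text \<open>Since the errors decrease in size, a step down by \<open>ret (Suc n)\<close> is more
  than undone by the step up by \<open>ret n\<close>.\<close>

lemma ret_ret:
  assumes "even n"
  shows "x < ret n (ret (Suc n) x)"
proof -
  have "0 < convergent_error \<alpha> n + convergent_error \<alpha> (Suc n)"
    using assms convergent_error_sign[OF irrational, of n] convergent_error_less[OF irrational, of n]
    by auto
  then have "(F ^^ 0) x + of_int 0 < (F ^^ (q n + q (Suc n))) x + of_int (- convergent_num \<alpha> n - convergent_num \<alpha> (Suc n))"
    by (intro orbit_less) (simp add: convergent_error_def algebra_simps del: convergent_denom.simps convergent_num.simps)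
  also have "\<dots> = ret n (ret (Suc n) x)"
    using iter_plus_int[of "q n" "(F ^^ q (Suc n)) x" "- convergent_num \<alpha> (Suc n)"]
    by (simp add: ret_def iter_add del: convergent_denom.simps convergent_num.simps)
  finally show ?thesis by simp
qed

lemma ret_le_plus_1: "ret n x \<le> x + 1"
  using orbit_le[of "q n" "- convergent_num \<alpha> n" 0 1 x] convergent_error_less_1[OF irrational, of n]
  by (simp add: ret_def convergent_error_def abs_less_iff)

text \<open>By best approximation, fewer than \<open>q (Suc n)\<close> steps of the rotation never
  bring a point closer to its start, modulo 1, than the length of a return interval. The order of
  the orbits transfers this to \<open>F\<close>.\<close>

lemma ret_disjoint:
  assumes "even n" "0 < j" "j < q (Suc n)"
  shows "ret n x \<le> (F ^^ j) x + of_int p \<or> ret n ((F ^^ j) x) + of_int p \<le> x"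
proof -
  have "convergent_error \<alpha> n \<le> \<bar>real j * \<alpha> + of_int p\<bar>"
    using best_approximation[OF irrational assms(2,3), of p] by simp
  then consider "convergent_error \<alpha> n \<le> real j * \<alpha> + of_int p"
    | "convergent_error \<alpha> n + real j * \<alpha> + of_int p \<le> 0"
    by linarith
  then show ?thesis
  proof cases
    case 1
    then show ?thesis
      using orbit_le[of "q n" "- convergent_num \<alpha> n" j p x] by (simp add: ret_def convergent_error_def)
  next
    case 2
    then have "(F ^^ (q n + j)) x + of_int (p - convergent_num \<alpha> n) \<le> (F ^^ 0) x + of_int 0"
      by (intro orbit_le) (simp add: convergent_error_def algebra_simps)
    then show ?thesis by (simp add: ret_def iter_add)
  qed
qed

text \<open>Integer translations bring the left ends into \<open>[x, x + 1)\<close>. By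
  \<open>ret_disjoint\<close> the translated intervals do not overlap, and none leaves
  \<open>[x, x + 1]\<close>, over which \<open>W\<close> grows by \<open>B\<close>.\<close>

lemma sum_iterates_le:
  assumes "even n" and xy: "x \<le> y" "y \<le> ret n x"
    and W: "\<And>x y. x \<le> y \<Longrightarrow> W x \<le> W y" and per: "\<And>x. W (x + 1) = W x + (B :: real)"
  shows "(\<Sum>j<q (Suc n). W ((F ^^ j) y) - W ((F ^^ j) x)) \<le> B"
proof -
  have int: "W (z + of_int k) = W z + of_int k * B" for z k
    using per by (rule shift_int)
  define p where "p j = - \<lfloor>(F ^^ j) x - x\<rfloor>" for j
  define a b where "a j = (F ^^ j) x + of_int (p j)" and "b j = (F ^^ j) y + of_int (p j)" for j
  have a: "x \<le> a j" "a j < x + 1" for j unfolding a_def p_def by simp_all linarith+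
  have ab: "a j \<le> b j" "b j \<le> ret n (a j)" for j
  proof -
    show "a j \<le> b j" using iter_le[OF xy(1), of j] by (simp add: a_def b_def)
    show "b j \<le> ret n (a j)"
      using iter_le[OF xy(2), of j] by (simp add: a_def b_def ret_plus_int iter_ret)
  qed
  have "b j \<le> x + 1" if "j < q (Suc n)" for j
  proof (cases "j = 0")
    case True
    then show ?thesis using xy(2) ret_le_plus_1[of n x] by (simp add: b_def p_def)
  next
    case False
    \<comment> \<open>The interval is moved down by one more unit. As \<open>a j - 1 < x\<close>,
      only the second alternative can hold, and it bounds the right end.\<close>
    then have "ret n x \<le> a j - 1 \<or> ret n (a j) - 1 \<le> x"
      using ret_disjoint[OF assms(1) _ that, of x "p j - 1"]
      by (auto simp: a_def ret_plus_int)
    then show ?thesis using a(2)[of j] ret_even[OF assms(1), of x] ab(2)[of j] by linarith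
  qed
  note bound = this
  have disj: "b i \<le> a j \<or> b j \<le> a i" if ij: "i < j" "j < q (Suc n)" for i j
  proof -
    have j: "(F ^^ j) x = (F ^^ (j - i)) ((F ^^ i) x)" using ij(1) by (simp flip: iter_add)
    have "ret n ((F ^^ i) x) \<le> (F ^^ j) x + of_int (p j - p i) \<or>
        ret n ((F ^^ j) x) + of_int (p j - p i) \<le> (F ^^ i) x"
      unfolding j using ij by (intro ret_disjoint[OF assms(1)]) auto
    then have "ret n (a i) \<le> a j \<or> ret n (a j) \<le> a i"
      by (auto simp: a_def ret_plus_int)
    then show ?thesis using ab(2)[of i] ab(2)[of j] by linarith
  qed
  have "(\<Sum>j\<in>{..<q (Suc n)}. W (b j) - W (a j)) \<le> W (x + 1) - W x"
  proof (rule sum_disjoint_intervals_le[where W = W])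
    fix i j assume "i \<in> {..<q (Suc n)}" "j \<in> {..<q (Suc n)}" "i \<noteq> j"
    then show "b i \<le> a j \<or> b j \<le> a i" using disj[of i j] disj[of j i] by (cases i j rule: linorder_cases) auto
  qed (use W a ab bound in auto)
  then show ?thesis by (simp add: a_def b_def int per)
qed

text \<open>Intended for the covering towers, whose \<open>q n + q (Suc n)\<close> levels are at
  most \<open>2 * q (Suc n)\<close>: the second half of the range is the first half for an interval
  moved by \<open>F ^^ q (Suc n)\<close>.\<close>

lemma sum_iterates_le_twice:
  assumes "even n" and xy: "x \<le> y" "y \<le> ret n x"
    and W: "\<And>x y. x \<le> y \<Longrightarrow> W x \<le> W y" and per: "\<And>x. W (x + 1) = W x + (B :: real)"
  shows "(\<Sum>j<2 * q (Suc n). W ((F ^^ j) y) - W ((F ^^ j) x)) \<le> 2 * B"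
proof -
  define N where "N = q (Suc n)"
  have "(\<Sum>j<2 * N. W ((F ^^ j) y) - W ((F ^^ j) x)) =
      (\<Sum>j<N. W ((F ^^ j) y) - W ((F ^^ j) x)) +
      (\<Sum>j<N. W ((F ^^ j) ((F ^^ N) y)) - W ((F ^^ j) ((F ^^ N) x)))"
    unfolding mult_2 sum_lessThan_add by (simp add: iter_add add.commute[of N])
  also have "(\<Sum>j<N. W ((F ^^ j) ((F ^^ N) y)) - W ((F ^^ j) ((F ^^ N) x))) \<le> B"
    unfolding N_def
  proof (intro sum_iterates_le[OF assms(1)] W per)
    show "(F ^^ q (Suc n)) y \<le> ret n ((F ^^ q (Suc n)) x)"
      using iter_le[OF xy(2)] by (simp only: iter_ret)
  qed (use iter_le[OF xy(1)] in auto)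
  also have "(\<Sum>j<N. W ((F ^^ j) y) - W ((F ^^ j) x)) \<le> B"
    unfolding N_def by (intro sum_iterates_le assms)
  finally show ?thesis by (simp add: N_def)
qed

text \<open>The largest point of \<open>{F\<^sup>j x + p | j < q\<^sub>n + q\<^sub>n\<^sub>+\<^sub>1}\<close> below \<open>y\<close> is moved upwards inside this set by
  \<open>ret n\<close> or by the inverse of \<open>ret (Suc n)\<close>, and by at most as much as by \<open>ret n\<close>.\<close>

lemma iterates_cover:
  assumes "even n"
  obtains j p where "j < q n + q (Suc n)" "(F ^^ j) x + of_int p \<le> y" "y < ret n ((F ^^ j) x) + of_int p"
proof -
  define M where "M = q n + q (Suc n)"
  define p where "p j = \<lfloor>y - (F ^^ j) x\<rfloor>" for j
  define a where "a j = (F ^^ j) x + of_int (p j)" for j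
  have ay: "a j \<le> y" for j unfolding a_def p_def by linarith
  have top: "(F ^^ j) x + of_int k \<le> a j" if "(F ^^ j) x + of_int k \<le> y" for j k
  proof -
    have "k \<le> p j" using that by (simp add: p_def le_floor_iff)
    then show ?thesis by (simp add: a_def)
  qed
  have "M > 0" using convergent_denom_pos[OF irrational, of n] by (simp add: M_def)
  then obtain j where j: "j < M" "\<And>i. i < M \<Longrightarrow> a i \<le> a j"
  proof -
    have ne: "finite (a ` {..<M})" "a ` {..<M} \<noteq> {}" using \<open>M > 0\<close> by auto
    from Max_in[OF this] obtain j where "j < M" "a j = Max (a ` {..<M})" by auto
    then show thesis using that[of j] Max_ge[OF ne(1)] by simp
  qed
  have "y < ret n (a j)"
  proof (cases "j < q (Suc n)")
    case True
    show ?thesis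
    proof (rule ccontr)
      assume "\<not> y < ret n (a j)"
      moreover have r: "ret n (a j) = (F ^^ (q n + j)) x + of_int (p j - convergent_num \<alpha> n)"
        by (simp add: a_def ret_def iter_add iter_plus_int)
      ultimately have "ret n (a j) \<le> a (q n + j)" by (simp only: r not_less top)
      also have "\<dots> \<le> a j" using True by (intro j) (simp add: M_def)
      finally show False using ret_even[OF assms, of "a j"] by simp
    qed
  next
    case False
    define i where "i = j - q (Suc n)"
    have ij: "j = q (Suc n) + i" using False by (simp add: i_def)
    define z where "z = (F ^^ i) x + of_int (p j + convergent_num \<alpha> (Suc n))"
    have "(F ^^ q (Suc n)) z = (F ^^ j) x + of_int (p j + convergent_num \<alpha> (Suc n))"
      by (simp only: z_def ij iter_add iter_plus_int)
    then have z: "ret (Suc n) z = a j"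
      by (simp add: a_def ret_def del: convergent_denom.simps convergent_num.simps)
    have "y < z"
    proof (rule ccontr)
      assume "\<not> y < z"
      then have "z \<le> a i" unfolding z_def not_less by (rule top)
      also have "\<dots> \<le> a j" using j(1) by (intro j) (simp add: ij)
      finally show False using ret_odd[of "Suc n" z] assms by (simp add: z)
    qed
    also have "z < ret n (ret (Suc n) z)" by (rule ret_ret[OF assms])
    finally show ?thesis by (simp add: z)
  qed
  then show thesis using that[of j "p j"] j(1) ay[of j] by (simp add: M_def a_def ret_plus_int)
qed

subsection \<open>Birkhoff sums and Denjoy estimates\<close>

definition birkhoff :: "nat \<Rightarrow> (real \<Rightarrow> real) \<Rightarrow> real \<Rightarrow> real" where
  "birkhoff k \<psi> x = (\<Sum>j<k. \<psi> ((F ^^ j) x))"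

lemma birkhoff_plus_int:
  assumes "\<And>x. \<psi> (x + 1) = \<psi> x"
  shows "birkhoff k \<psi> (x + of_int p) = birkhoff k \<psi> x"
  using shift_int[of \<psi> 0] assms by (simp add: birkhoff_def iter_plus_int)

lemma birkhoff_diff_le:
  assumes \<psi>: "variation_le \<psi> B" and "even n" "x \<le> y" "y \<le> ret n x"
  shows "k \<le> q (Suc n) \<Longrightarrow> \<bar>birkhoff k \<psi> y - birkhoff k \<psi> x\<bar> \<le> B"
    and "k \<le> 2 * q (Suc n) \<Longrightarrow> \<bar>birkhoff k \<psi> y - birkhoff k \<psi> x\<bar> \<le> 2 * B"
proof -
  obtain W where W: "\<And>x. W (x + 1) = W x + B" "\<And>x y. x \<le> y \<Longrightarrow> \<bar>\<psi> y - \<psi> x\<bar> \<le> W y - W x"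
    using \<psi> unfolding variation_le_def by blast
  have mono: "W x \<le> W y" if "x \<le> y" for x y using W(2)[OF that] by simp
  have le: "\<bar>birkhoff k \<psi> y - birkhoff k \<psi> x\<bar> \<le> (\<Sum>j<M. W ((F ^^ j) y) - W ((F ^^ j) x))" if "k \<le> M" for M
  proof -
    have "\<bar>birkhoff k \<psi> y - birkhoff k \<psi> x\<bar> \<le> (\<Sum>j<k. \<bar>\<psi> ((F ^^ j) y) - \<psi> ((F ^^ j) x)\<bar>)"
      unfolding birkhoff_def sum_subtractf[symmetric] by (rule sum_abs)
    also have "\<dots> \<le> (\<Sum>j<k. W ((F ^^ j) y) - W ((F ^^ j) x))"
      using assms(3) by (intro sum_mono W iter_le)
    also have "\<dots> \<le> (\<Sum>j<M. W ((F ^^ j) y) - W ((F ^^ j) x))"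
      using that assms(3) by (intro sum_mono2) (auto intro: mono iter_le)
    finally show ?thesis .
  qed
  have "(\<Sum>j<q (Suc n). W ((F ^^ j) y) - W ((F ^^ j) x)) \<le> B"
    by (rule sum_iterates_le) (use assms mono W in auto)
  then show "k \<le> q (Suc n) \<Longrightarrow> \<bar>birkhoff k \<psi> y - birkhoff k \<psi> x\<bar> \<le> B"
    using le by fastforce
  have "(\<Sum>j<2 * q (Suc n). W ((F ^^ j) y) - W ((F ^^ j) x)) \<le> 2 * B"
    by (rule sum_iterates_le_twice) (use assms mono W in auto)
  then show "k \<le> 2 * q (Suc n) \<Longrightarrow> \<bar>birkhoff k \<psi> y - birkhoff k \<psi> x\<bar> \<le> 2 * B"
    using le by fastforce
qed

text \<open>Two ways of splitting the sum over \<open>k + i\<close> steps. The identity exchanges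
  the number of summands with the number of steps between the two points: for \<open>k = q n\<close>
  the points on the right are, modulo 1, a single return apart.\<close>

lemma birkhoff_iter_diff:
  "birkhoff k \<psi> ((F ^^ i) x) - birkhoff k \<psi> x = birkhoff i \<psi> ((F ^^ k) x) - birkhoff i \<psi> x"
proof -
  have "(F ^^ (k + j)) x = (F ^^ j) ((F ^^ k) x)" for k j by (metis iter_add add.commute)
  then have add: "birkhoff (k + i) \<psi> x = birkhoff k \<psi> x + birkhoff i \<psi> ((F ^^ k) x)" for k i
    by (simp add: birkhoff_def sum_lessThan_add)
  from add[of k i] add[of i k] show ?thesis by (simp add: add.commute)
qed

text \<open>A Denjoy--Koksma inequality with a non-optimal constant: comparison of \<open>y\<close> with the iterate
  of \<open>x\<close> whose return interval contains it, and then of this iterate with \<open>x\<close>.\<close>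

lemma denjoy_koksma_even:
  assumes \<psi>: "variation_le \<psi> B" and per: "\<And>x. \<psi> (x + 1) = \<psi> x" and n: "even n"
    and k: "k = n \<or> k = Suc n"
  shows "\<bar>birkhoff (q k) \<psi> x - birkhoff (q k) \<psi> y\<bar> \<le> 3 * B"
proof -
  obtain i p where i: "i < q n + q (Suc n)" and p: "(F ^^ i) x + of_int p \<le> y"
    "y < ret n ((F ^^ i) x) + of_int p"
    using iterates_cover[OF n] by blast
  have qk: "q k \<le> q (Suc n)" using k convergent_denom_le_Suc[OF irrational, of n] by auto
  have i2: "i \<le> 2 * q (Suc n)" using i convergent_denom_le_Suc[OF irrational, of n] by simp
  have "\<bar>birkhoff (q k) \<psi> y - birkhoff (q k) \<psi> ((F ^^ i) x + of_int p)\<bar> \<le> B"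
    using p qk by (intro birkhoff_diff_le(1)[OF \<psi> n]) (auto simp: ret_plus_int)
  then have 1: "\<bar>birkhoff (q k) \<psi> y - birkhoff (q k) \<psi> ((F ^^ i) x)\<bar> \<le> B"
    by (simp add: birkhoff_plus_int per)
  have "birkhoff (q k) \<psi> ((F ^^ i) x) - birkhoff (q k) \<psi> x = birkhoff i \<psi> (ret k x) - birkhoff i \<psi> x"
    by (simp only: birkhoff_iter_diff iter_q) (simp add: birkhoff_plus_int per)
  also have "\<bar>\<dots>\<bar> \<le> 2 * B"
    using k
  proof
    assume "k = n"
    then show ?thesis
      using ret_even[OF n, of x] by (intro birkhoff_diff_le(2)[OF \<psi> n _ _ i2]) auto
  next
    assume "k = Suc n"
    \<comment> \<open>An odd return goes down, and \<open>ret_ret\<close> places \<open>x\<close> in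
      the return interval of order \<open>n\<close> that starts at \<open>ret k x\<close>.\<close>
    then have "\<bar>birkhoff i \<psi> x - birkhoff i \<psi> (ret k x)\<bar> \<le> 2 * B"
      using ret_odd[of "Suc n" x] ret_ret[OF n, of x] n
      by (intro birkhoff_diff_le(2)[OF \<psi> n _ _ i2]) auto
    then show ?thesis by simp
  qed
  finally show ?thesis using 1 by linarith
qed

lemma denjoy_koksma:
  assumes "variation_le \<psi> B" "\<And>x. \<psi> (x + 1) = \<psi> x"
  shows "\<bar>birkhoff (q n) \<psi> x - birkhoff (q n) \<psi> y\<bar> \<le> 3 * B"
proof (cases "even n")
  case True
  then show ?thesis using denjoy_koksma_even assms by blast
next
  case False
  then obtain m where "n = Suc m" "even m" by (cases n) auto
  then show ?thesis using denjoy_koksma_even[of \<psi> B m n] assms by blast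
qed

section \<open>Derivatives of iterates and Denjoy's theorem\<close>

abbreviation log_deriv :: "real \<Rightarrow> real" where "log_deriv x \<equiv> ln (F' x)"

lemma deriv_plus_1: "F' (x + 1) = F' x"
proof -
  have "((\<lambda>t. F (t + 1)) has_real_derivative F' (x + 1)) (at x)"
    using lift_deriv[of "x + 1"] by (simp only: DERIV_shift)
  moreover have "((\<lambda>t. F (t + 1)) has_real_derivative F' x) (at x)"
    unfolding lift_plus_1 using lift_deriv[of x] by (auto intro!: derivative_eq_intros)
  ultimately show ?thesis by (rule DERIV_unique)
qed

lemma iter_deriv: "((F ^^ k) has_real_derivative exp (birkhoff k log_deriv x)) (at x)"
proof (induction k)
  case (Suc k)
  have "((\<lambda>t. F ((F ^^ k) t)) has_real_derivative F' ((F ^^ k) x) * exp (birkhoff k log_deriv x)) (at x)"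
    by (rule DERIV_chain2[OF lift_deriv Suc])
  moreover have "F' ((F ^^ k) x) * exp (birkhoff k log_deriv x) = exp (birkhoff (Suc k) log_deriv x)"
    using deriv_pos[of "(F ^^ k) x"] by (simp add: birkhoff_def exp_add mult.commute)
  ultimately show ?case by (simp add: o_def)
qed (simp add: birkhoff_def id_def)

lemma iter_mvt:
  assumes "x < y"
  obtains z where "x < z" "z < y" "(F ^^ k) y - (F ^^ k) x = (y - x) * exp (birkhoff k log_deriv z)"
  using MVT2[OF assms iter_deriv[of k]] by blast

text \<open>Over a period \<open>F ^^ q n\<close> has mean slope 1, so its derivative equals 1
  somewhere; Denjoy--Koksma for \<open>log_deriv\<close> compares any other point with that
  one.\<close>

lemma birkhoff_q_log_deriv: "\<bar>birkhoff (q n) log_deriv x\<bar> \<le> 3 * V"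
proof -
  obtain z where "(F ^^ q n) 1 - (F ^^ q n) 0 = (1 - 0) * exp (birkhoff (q n) log_deriv z)"
    using iter_mvt[of 0 1 "q n"] by auto
  moreover have "(F ^^ q n) 1 - (F ^^ q n) 0 = 1" using iter_plus_int[of "q n" 0 1] by simp
  ultimately have "birkhoff (q n) log_deriv z = 0" by simp
  then show ?thesis
    using denjoy_koksma[OF log_deriv_variation, of n x z] deriv_plus_1 by simp
qed

text \<open>The iterates of \<open>[x, ret n x]\<close> of orders \<open>q\<^sub>1, \<dots>, q\<^sub>n\<close> are disjoint modulo 1 and comparable in
  length to the interval itself.\<close>

lemma ret_even_close:
  assumes n: "even n"
  shows "(ret n x - x) * real n \<le> exp (3 * V)"
proof -
  have mono: "i < j \<Longrightarrow> 1 \<le> i \<Longrightarrow> q i < q j" for i j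
  proof (induction j)
    case (Suc j)
    have "q j < q (Suc j)" using Suc.prems convergent_denom_less_Suc[OF irrational, of "j - 1"] by simp
    then show ?case using Suc by (cases "i = j") auto
  qed simp
  \<comment> \<open>The range starts at 1 because \<open>q 0\<close> may coincide with
    \<open>q 1\<close>.\<close>
  have inj: "inj_on q {1..n}"
    by (rule inj_onI) (metis atLeastAtMost_iff linorder_neqE_nat mono nat_neq_iff)
  define d where "d = ret n x - x"
  have d: "0 < d" using ret_even[OF n] by (simp add: d_def)
  have long: "exp (- 3 * V) * d \<le> (F ^^ q m) (ret n x) - (F ^^ q m) x" for m
  proof -
    obtain z where "(F ^^ q m) (ret n x) - (F ^^ q m) x = d * exp (birkhoff (q m) log_deriv z)"
      using iter_mvt[OF ret_even[OF n], of x "q m"] unfolding d_def by blast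
    moreover have "- 3 * V \<le> birkhoff (q m) log_deriv z"
      using birkhoff_q_log_deriv[of m z] by (simp add: abs_le_iff)
    ultimately show ?thesis using d by (simp add: mult.commute mult_left_mono)
  qed
  have "real n * (exp (- 3 * V) * d) = (\<Sum>m\<in>{1..n}. exp (- 3 * V) * d)" by simp
  also have "\<dots> \<le> (\<Sum>m\<in>{1..n}. (F ^^ q m) (ret n x) - (F ^^ q m) x)" by (intro sum_mono long)
  also have "\<dots> = (\<Sum>j\<in>q ` {1..n}. (F ^^ j) (ret n x) - (F ^^ j) x)"
    using inj by (simp add: sum.reindex)
  also have "\<dots> \<le> (\<Sum>j<q (Suc n). (F ^^ j) (ret n x) - (F ^^ j) x)"
    using d by (intro sum_mono2) (auto intro!: mono iter_le simp: d_def)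
  also have "\<dots> \<le> 1"
    using sum_iterates_le[OF n, of x "ret n x" "\<lambda>x. x" 1] ret_even[OF n, of x] by simp
  finally have "real n * d * exp (- 3 * V) \<le> 1" by (simp add: mult_ac)
  then show ?thesis by (simp add: d_def exp_minus field_simps)
qed

text \<open>For even \<open>n\<close> a return moves points by at most
  \<open>exp (3 * V) / n\<close>; an odd return is dominated by the even one before it, by
  \<open>ret_ret\<close>.\<close>

lemma ret_close:
  assumes "0 < \<epsilon>"
  shows "\<exists>n0. \<forall>n\<ge>n0. \<forall>x. \<bar>ret n x - x\<bar> \<le> \<epsilon>"
proof -
  obtain m :: nat where m: "exp (3 * V) / \<epsilon> < real m" using reals_Archimedean2 by blast
  have ev: "ret n x - x \<le> \<epsilon>" if "even n" "m \<le> n" for n x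
  proof -
    have "0 < exp (3 * V) / \<epsilon>" using assms by simp
    then have "exp (3 * V) / \<epsilon> < real n" "0 < real n" using m that by linarith+
    then have n: "0 < real n" "exp (3 * V) < \<epsilon> * real n" using assms by (simp_all add: divide_less_eq mult.commute)
    then have "(ret n x - x) * real n \<le> \<epsilon> * real n" using ret_even_close[OF that(1), of x] by linarith
    then show ?thesis using n by simp
  qed
  have "\<bar>ret n x - x\<bar> \<le> \<epsilon>" if "n \<ge> Suc m" for n x
  proof (cases "even n")
    case True
    then show ?thesis using ev[of n x] ret_even[of n x] that by simp
  next
    case False
    then obtain k where k: "n = Suc k" "even k" by (cases n) auto
    have "x < ret k (ret n x)" using ret_ret[OF k(2)] k by simp
    moreover have "ret k (ret n x) - ret n x \<le> \<epsilon>" using ev[of k] k that by simp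
    ultimately show ?thesis using ret_odd[OF False, of x] by simp
  qed
  then show ?thesis by blast
qed

subsection \<open>Functions with asymptotically constant Birkhoff sums\<close>

definition negligible_sums :: "(real \<Rightarrow> real) \<Rightarrow> bool" where
  "negligible_sums h \<longleftrightarrow>
     (\<forall>\<epsilon>>0. \<exists>n0. \<forall>n\<ge>n0. \<forall>x y. \<bar>birkhoff (q n) h x - birkhoff (q n) h y\<bar> \<le> \<epsilon>)"

lemma negligible_sums_add:
  assumes "negligible_sums g" "negligible_sums h"
  shows "negligible_sums (\<lambda>x. g x + h x)"
  unfolding negligible_sums_def
proof (intro allI impI)
  fix \<epsilon> :: real assume "0 < \<epsilon>"
  then have "0 < \<epsilon> / 2" by simp
  then obtain m n where m: "\<And>k x y. m \<le> k \<Longrightarrow> \<bar>birkhoff (q k) g x - birkhoff (q k) g y\<bar> \<le> \<epsilon> / 2"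
    and n: "\<And>k x y. n \<le> k \<Longrightarrow> \<bar>birkhoff (q k) h x - birkhoff (q k) h y\<bar> \<le> \<epsilon> / 2"
    using assms unfolding negligible_sums_def by metis
  have "\<bar>birkhoff (q k) (\<lambda>x. g x + h x) x - birkhoff (q k) (\<lambda>x. g x + h x) y\<bar> \<le> \<epsilon>" if "max m n \<le> k" for k x y
  proof -
    have eq: "birkhoff (q k) (\<lambda>x. g x + h x) x = birkhoff (q k) g x + birkhoff (q k) h x" for x
      by (simp add: birkhoff_def sum.distrib)
    have "\<bar>birkhoff (q k) g x - birkhoff (q k) g y\<bar> \<le> \<epsilon> / 2"
      "\<bar>birkhoff (q k) h x - birkhoff (q k) h y\<bar> \<le> \<epsilon> / 2"
      using m[of k x y] n[of k x y] that by simp_all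
    then show ?thesis unfolding eq by linarith
  qed
  then show "\<exists>n0. \<forall>n\<ge>n0. \<forall>x y. \<bar>birkhoff (q n) (\<lambda>x. g x + h x) x - birkhoff (q n) (\<lambda>x. g x + h x) y\<bar> \<le> \<epsilon>"
    by blast
qed

lemma negligible_sums_mult:
  assumes "negligible_sums h"
  shows "negligible_sums (\<lambda>x. c * h x)"
  unfolding negligible_sums_def
proof (intro allI impI)
  fix \<epsilon> :: real assume "0 < \<epsilon>"
  then have "0 < \<epsilon> / (\<bar>c\<bar> + 1)" by simp
  then obtain m where m: "\<And>k x y. m \<le> k \<Longrightarrow> \<bar>birkhoff (q k) h x - birkhoff (q k) h y\<bar> \<le> \<epsilon> / (\<bar>c\<bar> + 1)"
    using assms unfolding negligible_sums_def by metis
  have "\<bar>birkhoff (q k) (\<lambda>x. c * h x) x - birkhoff (q k) (\<lambda>x. c * h x) y\<bar> \<le> \<epsilon>" if "m \<le> k" for k x y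
  proof -
    have "\<bar>birkhoff (q k) (\<lambda>x. c * h x) x - birkhoff (q k) (\<lambda>x. c * h x) y\<bar>
        = \<bar>c\<bar> * \<bar>birkhoff (q k) h x - birkhoff (q k) h y\<bar>"
      by (simp add: birkhoff_def abs_mult flip: sum_distrib_left right_diff_distrib)
    also have "\<dots> \<le> (\<bar>c\<bar> + 1) * (\<epsilon> / (\<bar>c\<bar> + 1))" using m[OF that] by (intro mult_mono) auto
    finally show ?thesis by simp
  qed
  then show "\<exists>n0. \<forall>n\<ge>n0. \<forall>x y. \<bar>birkhoff (q n) (\<lambda>x. c * h x) x - birkhoff (q n) (\<lambda>x. c * h x) y\<bar> \<le> \<epsilon>"
    by blast
qed

lemma negligible_sums_zero: "negligible_sums (\<lambda>x. 0)"
  unfolding negligible_sums_def by (auto simp: birkhoff_def)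

lemma negligible_sums_sum:
  assumes "finite A" "\<And>i. i \<in> A \<Longrightarrow> negligible_sums (h i)"
  shows "negligible_sums (\<lambda>x. \<Sum>i\<in>A. h i x)"
  using assms by (induction A) (auto intro: negligible_sums_zero negligible_sums_add)

text \<open>If \<open>K\<close> has degree \<open>c\<close>, the Birkhoff sum over \<open>q\<^sub>n\<close> steps is close to the constant \<open>k c p\<^sub>n\<close>.\<close>

lemma negligible_sums_coboundary:
  assumes lip: "\<And>x y. \<bar>K y - K x\<bar> \<le> \<bar>y - x\<bar>" and deg: "\<And>x p. K (x + of_int p) = K x + of_int p * c"
  shows "negligible_sums (\<lambda>x. K ((F ^^ k) x) - K x)"
  unfolding negligible_sums_def
proof (intro allI impI)
  fix \<epsilon> :: real assume "0 < \<epsilon>"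
  then have "0 < \<epsilon> / (2 * real (Suc k))" by simp
  then obtain m where m: "\<And>n x. m \<le> n \<Longrightarrow> \<bar>ret n x - x\<bar> \<le> \<epsilon> / (2 * real (Suc k))"
    using ret_close by meson
  have est: "\<bar>birkhoff (q n) (\<lambda>x. K ((F ^^ k) x) - K x) x - real k * of_int (convergent_num \<alpha> n) * c\<bar> \<le> \<epsilon> / 2"
    if "m \<le> n" for n x
  proof -
    have "(F ^^ k) ((F ^^ j) x) = (F ^^ j) ((F ^^ k) x)" for j by (metis iter_add add.commute)
    then have eq: "birkhoff j (\<lambda>x. K ((F ^^ k) x) - K x) x = birkhoff j K ((F ^^ k) x) - birkhoff j K x" for j
      by (simp add: birkhoff_def sum_subtractf)
    have "birkhoff (q n) (\<lambda>x. K ((F ^^ k) x) - K x) x = birkhoff k K ((F ^^ q n) x) - birkhoff k K x"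
      unfolding eq by (rule birkhoff_iter_diff)
    also have "\<dots> - real k * of_int (convergent_num \<alpha> n) * c = birkhoff k K (ret n x) - birkhoff k K x"
      unfolding iter_q by (simp add: birkhoff_def iter_plus_int deg sum.distrib)
    also have "\<dots> = (\<Sum>j<k. K (ret n ((F ^^ j) x)) - K ((F ^^ j) x))"
      by (simp add: birkhoff_def iter_ret sum_subtractf)
    also have "\<bar>\<dots>\<bar> \<le> (\<Sum>j<k. \<epsilon> / (2 * real (Suc k)))"
      by (rule order_trans[OF sum_abs sum_mono]) (rule order_trans[OF lip m[OF that]])
    also have "\<dots> \<le> \<epsilon> / 2" using \<open>0 < \<epsilon>\<close> by (simp add: field_simps)
    finally show ?thesis .
  qed
  have "\<bar>birkhoff (q n) (\<lambda>x. K ((F ^^ k) x) - K x) x - birkhoff (q n) (\<lambda>x. K ((F ^^ k) x) - K x) y\<bar> \<le> \<epsilon>"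
    if "m \<le> n" for n x y
    using est[OF that, of x] est[OF that, of y] by linarith
  then show "\<exists>n0. \<forall>n\<ge>n0. \<forall>x y. \<bar>birkhoff (q n) (\<lambda>x. K ((F ^^ k) x) - K x) x
      - birkhoff (q n) (\<lambda>x. K ((F ^^ k) x) - K x) y\<bar> \<le> \<epsilon>"
    by blast
qed

end

section \<open>Piecewise linear approximation\<close>

definition lipschitz :: "(real \<Rightarrow> real) \<Rightarrow> bool" where
  "lipschitz f \<longleftrightarrow> (\<exists>L. L-lipschitz_on UNIV f)"

lemma lipschitz_add: "lipschitz f \<Longrightarrow> lipschitz g \<Longrightarrow> lipschitz (\<lambda>x. f x + g x)"
  unfolding lipschitz_def by (blast intro: lipschitz_on_add)

lemma lipschitz_mult:
  assumes "lipschitz f"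
  shows "lipschitz (\<lambda>x. c * f x)"
proof -
  obtain L where "L-lipschitz_on UNIV f" using assms by (auto simp: lipschitz_def)
  from lipschitz_on_cmult_real[OF this, of c] show ?thesis unfolding lipschitz_def by blast
qed

lemma lipschitz_const: "lipschitz (\<lambda>x. c)"
  unfolding lipschitz_def using lipschitz_on_constant by blast

lemma lipschitz_sum: "finite A \<Longrightarrow> (\<And>i. i \<in> A \<Longrightarrow> lipschitz (f i)) \<Longrightarrow> lipschitz (\<lambda>x. \<Sum>i\<in>A. f i x)"
  by (induction A rule: finite_induct) (auto intro: lipschitz_const lipschitz_add)

lemma lipschitz_compose: "lipschitz f \<Longrightarrow> lipschitz g \<Longrightarrow> lipschitz (\<lambda>x. f (g x))"
  unfolding lipschitz_def using lipschitz_on_compose2[of _ UNIV] by (metis lipschitz_on_subset subset_UNIV)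

lemma lipschitz_continuous: "lipschitz f \<Longrightarrow> continuous_on UNIV f"
  unfolding lipschitz_def by (blast intro: lipschitz_on_continuous_on)

subsection \<open>Absolute continuity on uniform grids\<close>

text \<open>All cells have length \<open>1 / K\<close>, so a bound on the total length becomes a
  bound on the number of cells. One \<delta> serves every \<open>K\<close>, which makes the
  condition usable under refinement.\<close>

definition grid_absolutely_continuous :: "(real \<Rightarrow> real) \<Rightarrow> bool" where
  "grid_absolutely_continuous \<phi> \<longleftrightarrow>
     (\<forall>\<epsilon>>0. \<exists>\<delta>>0. \<forall>K S. 0 < K \<longrightarrow> S \<subseteq> {..<K} \<longrightarrow> real (card S) < \<delta> * real K \<longrightarrow>
        (\<Sum>j\<in>S. \<bar>grid_increment K \<phi> j\<bar>) < \<epsilon>)"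

lemma grid_absolutely_continuous_add:
  assumes "grid_absolutely_continuous f" "grid_absolutely_continuous g"
  shows "grid_absolutely_continuous (\<lambda>x. f x + g x)"
  unfolding grid_absolutely_continuous_def
proof (intro allI impI)
  fix \<epsilon> :: real assume "0 < \<epsilon>"
  then have e: "0 < \<epsilon> / 2" by simp
  obtain d1 where d1: "d1 > 0" "\<And>K S. 0 < K \<Longrightarrow> S \<subseteq> {..<K} \<Longrightarrow> real (card S) < d1 * real K \<Longrightarrow>
        (\<Sum>j\<in>S. \<bar>grid_increment K f j\<bar>) < \<epsilon> / 2"
    using assms(1) e unfolding grid_absolutely_continuous_def by metis
  obtain d2 where d2: "d2 > 0" "\<And>K S. 0 < K \<Longrightarrow> S \<subseteq> {..<K} \<Longrightarrow> real (card S) < d2 * real K \<Longrightarrow>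
        (\<Sum>j\<in>S. \<bar>grid_increment K g j\<bar>) < \<epsilon> / 2"
    using assms(2) e unfolding grid_absolutely_continuous_def by metis
  show "\<exists>\<delta>>0. \<forall>K S. 0 < K \<longrightarrow> S \<subseteq> {..<K} \<longrightarrow> real (card S) < \<delta> * real K \<longrightarrow>
        (\<Sum>j\<in>S. \<bar>grid_increment K (\<lambda>x. f x + g x) j\<bar>) < \<epsilon>"
  proof (intro exI[of _ "min d1 d2"] conjI allI impI)
    show "0 < min d1 d2" using d1 d2 by simp
    fix K S assume K: "0 < K" "S \<subseteq> {..<K}" "real (card S) < min d1 d2 * real K"
    have "min d1 d2 * real K \<le> d1 * real K" "min d1 d2 * real K \<le> d2 * real K"
      by (simp_all add: mult_right_mono)
    then have "real (card S) < d1 * real K" "real (card S) < d2 * real K" using K(3) by linarith+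
    then have "(\<Sum>j\<in>S. \<bar>grid_increment K f j\<bar>) + (\<Sum>j\<in>S. \<bar>grid_increment K g j\<bar>) < \<epsilon> / 2 + \<epsilon> / 2"
      using K d1(2) d2(2) by (intro add_strict_mono) auto
    moreover have "(\<Sum>j\<in>S. \<bar>grid_increment K (\<lambda>x. f x + g x) j\<bar>)
        \<le> (\<Sum>j\<in>S. \<bar>grid_increment K f j\<bar> + \<bar>grid_increment K g j\<bar>)"
      by (rule sum_mono) (simp add: grid_increment_def)
    ultimately show "(\<Sum>j\<in>S. \<bar>grid_increment K (\<lambda>x. f x + g x) j\<bar>) < \<epsilon>"
      by (simp add: sum.distrib)
  qed
qed

lemma grid_absolutely_continuous_lipschitz:
  assumes "lipschitz f"
  shows "grid_absolutely_continuous f"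
  unfolding grid_absolutely_continuous_def
proof (intro allI impI)
  obtain L where L: "L-lipschitz_on UNIV f" using assms by (auto simp: lipschitz_def)
  have L0: "0 \<le> L" using L by (rule lipschitz_on_nonneg)
  fix \<epsilon> :: real assume "0 < \<epsilon>"
  show "\<exists>\<delta>>0. \<forall>K S. 0 < K \<longrightarrow> S \<subseteq> {..<K} \<longrightarrow> real (card S) < \<delta> * real K \<longrightarrow>
        (\<Sum>j\<in>S. \<bar>grid_increment K f j\<bar>) < \<epsilon>"
  proof (intro exI[of _ "\<epsilon> / (L + 1)"] conjI allI impI)
    show "0 < \<epsilon> / (L + 1)" using \<open>0 < \<epsilon>\<close> L0 by simp
    fix K S assume K: "0 < K" "S \<subseteq> {..<K}" "real (card S) < \<epsilon> / (L + 1) * real K"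
    have "\<bar>grid_increment K f j\<bar> \<le> (L + 1) / real K" for j
    proof -
      have "\<bar>grid_increment K f j\<bar> \<le> L * \<bar>real (Suc j) / real K - real j / real K\<bar>"
        using lipschitz_onD[OF L] by (simp add: grid_increment_def dist_real_def)
      also have "\<dots> = L / real K" by (simp add: diff_divide_distrib[symmetric])
      finally show ?thesis using divide_right_mono[of L "L + 1" "real K"] by linarith
    qed
    then have "(\<Sum>j\<in>S. \<bar>grid_increment K f j\<bar>) \<le> real (card S) * ((L + 1) / real K)"
      by (rule sum_bounded_above)
    also have "\<dots> < \<epsilon>" using K L0 by (simp add: field_simps)
    finally show "(\<Sum>j\<in>S. \<bar>grid_increment K f j\<bar>) < \<epsilon>" .
  qed
qed

text \<open>Cell \<open>j\<close> of the grid refined by \<open>R\<close> lies in cell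
  \<open>j div R\<close> of the coarse grid.\<close>

lemma sum_blocks:
  fixes b :: "nat \<Rightarrow> real"
  assumes "0 < R"
  shows "(\<Sum>j<K * R. g (j div R) * b j) = (\<Sum>i<K. g i * (\<Sum>j=i * R..<i * R + R. b j))"
proof -
  have "(\<Sum>j=i * R..<i * R + R. g (j div R) * b j) = g i * (\<Sum>j=i * R..<i * R + R. b j)" for i
    unfolding sum_distrib_left
  proof (rule sum.cong[OF refl])
    fix j assume "j \<in> {i * R..<i * R + R}"
    then have "j div R = i" by (intro div_nat_eqI) (auto simp: mult.commute)
    then show "g (j div R) * b j = g i * b j" by simp
  qed
  then show ?thesis using sum.nat_group[of "\<lambda>j. g (j div R) * b j" R K] by simp
qed

lemma sum_block_const: "0 < R \<Longrightarrow> (\<Sum>j<K * R. g (j div R)) = real R * (\<Sum>i<K. g i)"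
  using sum_blocks[of R g "\<lambda>_. 1" K] by (simp add: sum_distrib_left mult.commute)

lemma grid_increment_block:
  assumes "0 < R"
  shows "(\<Sum>j=i * R..<i * R + R. grid_increment (K * R) \<phi> j) = grid_increment K \<phi> i"
proof -
  have "(\<Sum>j=i * R..<i * R + R. grid_increment (K * R) \<phi> j)
      = \<phi> (real (i * R + R) / real (K * R)) - \<phi> (real (i * R) / real (K * R))"
    unfolding grid_increment_def
    by (rule sum_Suc_diff'[of _ _ "\<lambda>j. \<phi> (real j / real (K * R))"]) simp
  also have "real (i * R + R) = real (Suc i) * real R" by (simp add: algebra_simps)
  also have "real (Suc i) * real R / real (K * R) = real (Suc i) / real K" using assms by simp
  also have "real (i * R) / real (K * R) = real i / real K" using assms by simp
  finally show ?thesis by (simp add: grid_increment_def)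
qed

text \<open>With \<open>m\<close> above \<open>1 / d\<close>, where \<open>d\<close> belongs to the
  tolerance 1, each of the \<open>m\<close> blocks of \<open>R\<close> consecutive cells has
  variation at most 1.\<close>

lemma grid_variation_bound:
  assumes "grid_absolutely_continuous \<phi>"
  obtains m :: nat where "0 < m" "\<And>R. 0 < R \<Longrightarrow> (\<Sum>j<m * R. \<bar>grid_increment (m * R) \<phi> j\<bar>) \<le> real m"
proof -
  obtain d where d: "d > 0" "\<And>K S. 0 < K \<Longrightarrow> S \<subseteq> {..<K} \<Longrightarrow> real (card S) < d * real K \<Longrightarrow>
        (\<Sum>j\<in>S. \<bar>grid_increment K \<phi> j\<bar>) < 1"
    using assms unfolding grid_absolutely_continuous_def by (meson zero_less_one)
  obtain m :: nat where m: "1 / d < real m" using reals_Archimedean2 by blast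
  moreover have "0 < 1 / d" using d by simp
  ultimately have m0: "0 < m" by (metis less_trans of_nat_0_less_iff)
  have "(\<Sum>j<m * R. \<bar>grid_increment (m * R) \<phi> j\<bar>) \<le> real m" if "0 < R" for R
  proof -
    have "(\<Sum>j=b * R..<b * R + R. \<bar>grid_increment (m * R) \<phi> j\<bar>) \<le> 1" if "b < m" for b
    proof (rule less_imp_le, rule d(2))
      show "0 < m * R" using m0 \<open>0 < R\<close> by simp
      have "b * R + R \<le> m * R" using mult_le_mono1[of "Suc b" m R] that by simp
      then show "{b * R..<b * R + R} \<subseteq> {..<m * R}" by auto
      have "1 < d * real m" using m d(1) by (simp add: divide_less_eq mult.commute)
      then have "1 * real R < d * real m * real R" using \<open>0 < R\<close> by (intro mult_strict_right_mono) auto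
      then show "real (card {b * R..<b * R + R}) < d * real (m * R)" by (simp add: mult_ac)
    qed
    then have "(\<Sum>b<m. \<Sum>j=b * R..<b * R + R. \<bar>grid_increment (m * R) \<phi> j\<bar>) \<le> (\<Sum>b<m. 1)"
      by (intro sum_mono) simp
    then show ?thesis using sum.nat_group[of "\<lambda>j. \<bar>grid_increment (m * R) \<phi> j\<bar>" R m] by simp
  qed
  then show thesis using that m0 by blast
qed

text \<open>Choose a grid on which the discrete energy \<open>\<Sum> \<Phi>(slope) / K\<close> is nearly maximal, where the
  convex function \<open>\<Phi> x = sup {2 c x - c\<^sup>2 | \<bar>c\<bar> \<le> M}\<close> is quadratic up to \<open>M\<close> and linear beyond. Under
  refinement the energy then hardly grows, which bounds the change of the slopes where they are at
  most \<open>M\<close>; absolute continuity takes care of the rest.\<close>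

lemma piecewise_linear_approximation:
  assumes ac: "grid_absolutely_continuous \<phi>" and e: "0 < \<epsilon>"
  obtains K :: nat where "0 < K"
    "\<And>R. 0 < R \<Longrightarrow> (\<Sum>j<K * R. \<bar>grid_increment (K * R) \<phi> j - grid_increment K \<phi> (j div R) / real R\<bar>) \<le> 6 * \<epsilon>"
proof -
  obtain m where m: "0 < m" "\<And>R. 0 < R \<Longrightarrow> (\<Sum>j<m * R. \<bar>grid_increment (m * R) \<phi> j\<bar>) \<le> real m"
    using grid_variation_bound[OF ac] by blast
  obtain d where d: "d > 0" "\<And>K S. 0 < K \<Longrightarrow> S \<subseteq> {..<K} \<Longrightarrow> real (card S) < d * real K \<Longrightarrow>
        (\<Sum>j\<in>S. \<bar>grid_increment K \<phi> j\<bar>) < \<epsilon>"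
    using ac e unfolding grid_absolutely_continuous_def by metis
  \<comment> \<open>The mean absolute slope is at most \<open>m\<close>, so by Markov's inequality
    the cells with slope above \<open>M\<close> are a proportion less than \<open>d\<close> of all
    cells.\<close>
  define M where "M = (real m + 1) / d"
  have M: "0 < M" "real m < d * M" using d(1) by (auto simp: M_def field_simps add_pos_nonneg)
  define c where "c x = max (- M) (min M x)" for x
  define \<Phi> where "\<Phi> x = 2 * c x * x - (c x)\<^sup>2" for x
  \<comment> \<open>The Bregman distance of \<Phi>: the amount by which \<Phi> at \<open>y\<close>
    exceeds its tangent at \<open>x\<close>, whose slope is \<open>2 * c x\<close>. It is never
    negative by convexity.\<close>
  define D where "D y x = \<Phi> y - 2 * c x * y + (c x)\<^sup>2" for y x
  have D_eq: "D y x = 2 * (c y - c x) * (y - c y) + (c y - c x)\<^sup>2" for y x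
    by (simp add: D_def \<Phi>_def algebra_simps power2_eq_square)
  have D0: "0 \<le> D y x" for y x
  proof -
    have "0 \<le> (c y - c x) * (y - c y)"
      using M(1) by (auto simp: c_def max_def min_def zero_le_mult_iff)
    then have "0 \<le> 2 * ((c y - c x) * (y - c y)) + (c y - c x)\<^sup>2" by simp
    then show ?thesis unfolding D_eq by (simp only: mult.assoc)
  qed
  have D2: "D y x = (y - x)\<^sup>2" if "\<bar>x\<bar> \<le> M" "\<bar>y\<bar> \<le> M" for x y
  proof -
    have "c x = x" "c y = y" using that by (auto simp: c_def)
    then show ?thesis by (simp add: D_eq)
  qed
  have \<Phi>_le: "\<Phi> x \<le> 2 * M * \<bar>x\<bar>" for x
  proof -
    have "c x * x \<le> \<bar>c x\<bar> * \<bar>x\<bar>" by (metis abs_ge_self abs_mult)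
    also have "\<dots> \<le> M * \<bar>x\<bar>" using M(1) by (intro mult_right_mono) (auto simp: c_def)
    finally show ?thesis unfolding \<Phi>_def using zero_le_power2[of "c x"] by linarith
  qed
  define s where "s K j = real K * grid_increment K \<phi> j" for K j
  define A where "A K = (\<Sum>j<K. \<Phi> (s K j)) / real K" for K
  have abs_s: "(\<Sum>j<m * N. \<bar>s (m * N) j\<bar>) \<le> real (m * N) * real m" if "0 < N" for N
    unfolding s_def abs_mult abs_of_nat sum_distrib_left[symmetric] using m(2)[OF that] by (intro mult_left_mono) auto
  have A_le: "A (m * N) \<le> 2 * M * real m" if "0 < N" for N
  proof -
    have "(\<Sum>j<m * N. \<Phi> (s (m * N) j)) \<le> 2 * M * (\<Sum>j<m * N. \<bar>s (m * N) j\<bar>)"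
      unfolding sum_distrib_left by (intro sum_mono \<Phi>_le)
    also have "\<dots> \<le> 2 * M * (real (m * N) * real m)"
      using abs_s[OF that] M(1) by (intro mult_left_mono) auto
    finally show ?thesis using m(1) that by (simp add: A_def field_simps)
  qed
  have bdd: "bdd_above ((\<lambda>N. A (m * N)) ` {0<..})"
    using A_le by (intro bdd_aboveI[where M = "2 * M * real m"]) auto
  \<comment> \<open>The margin is \<open>\<epsilon>\<^sup>2\<close> because the growth of the energy
    is divided by \<epsilon> in the end.\<close>
  have "(SUP N\<in>{0<..}. A (m * N)) - \<epsilon>\<^sup>2 < (SUP N\<in>{0<..}. A (m * N))" using e by simp
  then obtain N where N: "0 < N" "(SUP N\<in>{0<..}. A (m * N)) - \<epsilon>\<^sup>2 < A (m * N)"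
    using less_cSUP_iff[OF _ bdd] by auto
  define K where "K = m * N"
  have K0: "0 < K" using m(1) N(1) by (simp add: K_def)
  have grow: "A (K * R) - A K \<le> \<epsilon>\<^sup>2" if "0 < R" for R
  proof -
    have "A (m * (N * R)) \<le> (SUP N\<in>{0<..}. A (m * N))" using N(1) that by (intro cSUP_upper bdd) auto
    then show ?thesis using N(2) by (simp add: K_def mult.assoc)
  qed
  have few: "real (card {j. j < m * N \<and> M < \<bar>s (m * N) j\<bar>}) < d * real (m * N)" if "0 < N" for N
  proof -
    have "M * real (card {j. j < m * N \<and> M < \<bar>s (m * N) j\<bar>}) = (\<Sum>j\<in>{j. j < m * N \<and> M < \<bar>s (m * N) j\<bar>}. M)"
      by simp
    also have "\<dots> \<le> (\<Sum>j\<in>{j. j < m * N \<and> M < \<bar>s (m * N) j\<bar>}. \<bar>s (m * N) j\<bar>)" by (intro sum_mono) auto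
    also have "\<dots> \<le> (\<Sum>j<m * N. \<bar>s (m * N) j\<bar>)" by (intro sum_mono2) auto
    also have "\<dots> \<le> real (m * N) * real m" by (rule abs_s[OF that])
    also have "\<dots> < real (m * N) * (d * M)" using M(2) m(1) that by (intro mult_strict_left_mono) auto
    finally have "M * real (card {j. j < m * N \<and> M < \<bar>s (m * N) j\<bar>}) < M * (d * real (m * N))" by (simp add: mult_ac)
    then show ?thesis using M(1) by simp
  qed
  have "(\<Sum>j<K * R. \<bar>grid_increment (K * R) \<phi> j - grid_increment K \<phi> (j div R) / real R\<bar>) \<le> 6 * \<epsilon>"
    if R: "0 < R" for R
  proof -
    define a where "a = grid_increment K \<phi>"
    define b where "b = grid_increment (K * R) \<phi>"
    define B1 where "B1 = {i. i < K \<and> M < \<bar>s K i\<bar>}"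
    define B1' where "B1' = {j. j < K * R \<and> j div R \<in> B1}"
    define B2 where "B2 = {j. j < K * R \<and> M < \<bar>s (K * R) j\<bar>}"
    have KR: "K * R = m * (N * R)" by (simp add: K_def)
    have c1: "real (card B1) < d * real K" unfolding B1_def K_def by (rule few[OF N(1)])
    have c2: "real (card B2) < d * real (K * R)" unfolding B2_def KR using N(1) R by (intro few) simp
    have c1': "real (card B1') = real R * real (card B1)"
    proof -
      have "real (card B1') = (\<Sum>j<K * R. if j div R \<in> B1 then 1 else 0)"
        by (simp add: B1'_def sum.If_cases Int_def)
      also have "\<dots> = real R * (\<Sum>i<K. if i \<in> B1 then 1 else 0)"
        by (rule sum_block_const[OF R, of "\<lambda>i. if i \<in> B1 then 1 else 0"])
      also have "(\<Sum>i<K. if i \<in> B1 then 1 else (0::real)) = real (card B1)"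
      proof -
        have "{..<K} \<inter> {i. i \<in> B1} = B1" by (auto simp: B1_def)
        then show ?thesis by (simp add: sum.If_cases)
      qed
      finally show ?thesis .
    qed
    have s1: "(\<Sum>i\<in>B1. \<bar>a i\<bar>) < \<epsilon>" unfolding a_def using c1 K0 by (intro d(2)) (auto simp: B1_def)
    have s2: "(\<Sum>j\<in>B2. \<bar>b j\<bar>) < \<epsilon>" unfolding b_def using c2 K0 R by (intro d(2)) (auto simp: B2_def)
    have "real R * real (card B1) < real R * (d * real K)" using c1 R by simp
    then have s3: "(\<Sum>j\<in>B1'. \<bar>b j\<bar>) < \<epsilon>"
      unfolding b_def using K0 R by (intro d(2)) (auto simp: B1'_def[symmetric] c1' mult_ac, auto simp: B1'_def)
    have s4: "(\<Sum>j<K * R. (if j div R \<in> B1 then \<bar>a (j div R)\<bar> / real R else 0)) = (\<Sum>i\<in>B1. \<bar>a i\<bar>)"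
    proof -
      have "(\<Sum>j<K * R. (if j div R \<in> B1 then \<bar>a (j div R)\<bar> / real R else 0))
          = real R * (\<Sum>i<K. (if i \<in> B1 then \<bar>a i\<bar> / real R else 0))"
        by (rule sum_block_const[OF R])
      also have "{..<K} \<inter> {i. i \<in> B1} = B1" by (auto simp: B1_def)
      then have "(\<Sum>i<K. (if i \<in> B1 then \<bar>a i\<bar> / real R else 0)) = (\<Sum>i\<in>B1. \<bar>a i\<bar> / real R)"
        by (simp add: sum.If_cases)
      finally show ?thesis using R by (simp add: sum_divide_distrib[symmetric])
    qed
    \<comment> \<open>The tangent is the same for all fine cells of a coarse cell, and their mean
      slope is the coarse slope. So the linear terms cancel, and the growth of the energy is the
      mean Bregman distance.\<close>
    have energy: "(\<Sum>j<K * R. D (s (K * R) j) (s K (j div R))) / real (K * R) = A (K * R) - A K"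
    proof -
      have "(\<Sum>j<K * R. 2 * c (s K (j div R)) * s (K * R) j) = real (K * R) * (\<Sum>j<K * R. 2 * c (s K (j div R)) * b j)"
        by (simp add: s_def b_def sum_distrib_left mult_ac)
      also have "(\<Sum>j<K * R. 2 * c (s K (j div R)) * b j) = (\<Sum>i<K. 2 * c (s K i) * a i)"
        unfolding sum_blocks[OF R, of "\<lambda>i. 2 * c (s K i)"] a_def b_def by (simp add: grid_increment_block[OF R])
      also have "real (K * R) * \<dots> = real R * (\<Sum>i<K. 2 * c (s K i) * s K i)"
        by (simp add: s_def a_def sum_distrib_left mult_ac)
      finally have 1: "(\<Sum>j<K * R. 2 * c (s K (j div R)) * s (K * R) j) = real R * (\<Sum>i<K. 2 * c (s K i) * s K i)" .
      have 2: "(\<Sum>j<K * R. (c (s K (j div R)))\<^sup>2) = real R * (\<Sum>i<K. (c (s K i))\<^sup>2)"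
        by (rule sum_block_const[OF R])
      have "(\<Sum>j<K * R. D (s (K * R) j) (s K (j div R))) = (\<Sum>j<K * R. \<Phi> (s (K * R) j)) - real R * (\<Sum>i<K. \<Phi> (s K i))"
        unfolding D_def sum.distrib sum_subtractf 1 2 by (simp add: \<Phi>_def sum_subtractf right_diff_distrib)
      then show ?thesis using R K0 by (simp add: A_def diff_divide_distrib)
    qed
    \<comment> \<open>The terms treat in turn cells that are steep on the coarse grid (two terms),
      cells that are steep only on the fine grid, where the coarse slope is the smaller one (hence
      the factor 2), and the remaining cells (two terms). After summation they contribute \<epsilon>
      each, the third twice.\<close>
    have pt: "\<bar>b j - a (j div R) / real R\<bar> \<le>
        (if j \<in> B1' then \<bar>b j\<bar> else 0) + (if j div R \<in> B1 then \<bar>a (j div R)\<bar> / real R else 0)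
        + 2 * (if j \<in> B2 then \<bar>b j\<bar> else 0) + \<epsilon> / real (K * R)
        + D (s (K * R) j) (s K (j div R)) / real (K * R) / \<epsilon>" (is "_ \<le> ?r") if j: "j < K * R" for j
    proof -
      define x y where "x = s K (j div R)" and "y = s (K * R) j"
      have jK: "j div R < K" using j by (simp add: less_mult_imp_div_less)
      have KR0: "0 < real (K * R)" using K0 R by simp
      have xy: "b j = y / real (K * R)" "a (j div R) / real R = x / real (K * R)"
        using K0 R by (simp_all add: x_def y_def s_def a_def b_def)
      have nn: "0 \<le> \<epsilon> / real (K * R)" "0 \<le> D y x / real (K * R) / \<epsilon>" using e D0 by simp_all
      show ?thesis
      proof (cases "j div R \<in> B1")
        case True
        then have "j \<in> B1'" using j by (simp add: B1'_def)
        moreover have "\<bar>b j - a (j div R) / real R\<bar> \<le> \<bar>b j\<bar> + \<bar>a (j div R)\<bar> / real R"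
          using abs_triangle_ineq4[of "b j" "a (j div R) / real R"] by simp
        ultimately show ?thesis using True nn abs_ge_zero[of "b j"] by (auto simp flip: x_def y_def)
      next
        case False
        then have nB: "j \<notin> B1'" and x: "\<bar>x\<bar> \<le> M" using jK by (auto simp: B1'_def B1_def x_def)
        show ?thesis
        proof (cases "j \<in> B2")
          case True
          then have "\<bar>x\<bar> \<le> \<bar>y\<bar>" using x by (simp add: B2_def y_def)
          then have "\<bar>a (j div R) / real R\<bar> \<le> \<bar>b j\<bar>"
            unfolding xy abs_divide by (intro divide_right_mono) auto
          then have "\<bar>b j - a (j div R) / real R\<bar> \<le> 2 * \<bar>b j\<bar>" by linarith
          then show ?thesis using True False nB nn by (simp flip: x_def y_def)
        next
          case nB2: False
          then have "\<bar>y\<bar> \<le> M" using j by (simp add: B2_def y_def)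
          then have D: "D y x = (y - x)\<^sup>2" by (rule D2[OF x])
          \<comment> \<open>The quadratic control of the slopes becomes linear through
            \<open>\<bar>y - x\<bar> \<le> \<epsilon> + (y - x)\<^sup>2 /
            \<epsilon>\<close>.\<close>
          have "0 \<le> (\<bar>y - x\<bar> - \<epsilon>)\<^sup>2" by simp
          then have "2 * (\<bar>y - x\<bar> * \<epsilon>) \<le> \<epsilon>\<^sup>2 + (y - x)\<^sup>2"
            unfolding power2_diff[of "\<bar>y - x\<bar>"] power2_abs mult.assoc by linarith
          moreover have "0 \<le> \<bar>y - x\<bar> * \<epsilon>" using e by simp
          ultimately have "\<bar>y - x\<bar> * \<epsilon> \<le> \<epsilon>\<^sup>2 + (y - x)\<^sup>2" by linarith
          then have "\<bar>y - x\<bar> \<le> \<epsilon> + D y x / \<epsilon>" using e by (simp add: D field_simps power2_eq_square)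
          then have "\<bar>y - x\<bar> / real (K * R) \<le> (\<epsilon> + D y x / \<epsilon>) / real (K * R)"
            by (rule divide_right_mono) simp
          moreover have "\<bar>b j - a (j div R) / real R\<bar> = \<bar>y - x\<bar> / real (K * R)"
            unfolding xy using KR0 by (simp add: abs_divide flip: diff_divide_distrib)
          ultimately show ?thesis using nB nB2 False
            by (simp add: add_divide_distrib mult_ac flip: x_def y_def)
        qed
      qed
    qed
    have "(\<Sum>j<K * R. \<bar>b j - a (j div R) / real R\<bar>) \<le>
        (\<Sum>j<K * R. (if j \<in> B1' then \<bar>b j\<bar> else 0) + (if j div R \<in> B1 then \<bar>a (j div R)\<bar> / real R else 0)
        + 2 * (if j \<in> B2 then \<bar>b j\<bar> else 0) + \<epsilon> / real (K * R)
        + D (s (K * R) j) (s K (j div R)) / real (K * R) / \<epsilon>)"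
      by (intro sum_mono pt) simp
    also have "\<dots> = (\<Sum>j<K * R. if j \<in> B1' then \<bar>b j\<bar> else 0) + (\<Sum>i\<in>B1. \<bar>a i\<bar>)
        + 2 * (\<Sum>j<K * R. if j \<in> B2 then \<bar>b j\<bar> else 0) + (\<Sum>j<K * R. \<epsilon> / real (K * R)) + (A (K * R) - A K) / \<epsilon>"
      unfolding energy[symmetric] s4[symmetric] by (simp add: sum.distrib sum_distrib_left sum_divide_distrib)
    also have "(\<Sum>j<K * R. if j \<in> B1' then \<bar>b j\<bar> else 0) = (\<Sum>j\<in>B1'. \<bar>b j\<bar>)"
      by (simp add: B1'_def sum.If_cases Int_def)
    also have "(\<Sum>j<K * R. if j \<in> B2 then \<bar>b j\<bar> else 0) = (\<Sum>j\<in>B2. \<bar>b j\<bar>)"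
      by (simp add: B2_def sum.If_cases Int_def)
    also have "(\<Sum>j<K * R. \<epsilon> / real (K * R)) = \<epsilon>" using K0 R by simp
    also have "(A (K * R) - A K) / \<epsilon> \<le> \<epsilon>" using grow[OF R] e by (simp add: divide_le_eq power2_eq_square)
    finally show ?thesis using s1 s2 s3 by (simp add: a_def b_def)
  qed
  then show thesis using that K0 by blast
qed

subsection \<open>Arcs\<close>

text \<open>\<open>arc_primitive u v\<close> is a primitive of the indicator function of \<open>[u,v] + \<int>\<close>.\<close>

definition ramp :: "real \<Rightarrow> real \<Rightarrow> real" where
  "ramp u x = of_int \<lfloor>x\<rfloor> * u + min (frac x) u"

definition arc_primitive :: "real \<Rightarrow> real \<Rightarrow> real \<Rightarrow> real" where
  "arc_primitive u v x = ramp v x - ramp u x"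

lemma arc_plus_int: "arc_primitive u v (x + of_int p) = arc_primitive u v x + of_int p * (v - u)"
  by (simp add: arc_primitive_def ramp_def frac_def algebra_simps)

lemma arc_unit_interval:
  assumes "0 \<le> u" "u \<le> v" "v \<le> 1" "0 \<le> x" "x \<le> 1"
  shows "arc_primitive u v x = min x v - min x u"
proof (cases "x = 1")
  case False
  then have "\<lfloor>x\<rfloor> = 0" using assms by (simp add: floor_eq_iff)
  then show ?thesis by (simp add: arc_primitive_def ramp_def frac_def)
qed (use assms in \<open>simp add: arc_primitive_def ramp_def\<close>)

lemma arc_mono:
  assumes "0 \<le> u" "u \<le> v" "v \<le> 1" "x \<le> y"
  shows "arc_primitive u v x \<le> arc_primitive u v y"
proof -
  have eq: "arc_primitive u v z = of_int \<lfloor>z\<rfloor> * (v - u) + (min (frac z) v - min (frac z) u)" for z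
    by (simp add: arc_primitive_def ramp_def algebra_simps)
  show ?thesis
  proof (cases "\<lfloor>x\<rfloor> = \<lfloor>y\<rfloor>")
    case True
    then have "frac x \<le> frac y" using assms(4) by (simp add: frac_def)
    then have "min (frac x) v - min (frac x) u \<le> min (frac y) v - min (frac y) u"
      using assms by (auto simp: min_def)
    then show ?thesis by (simp add: eq True)
  next
    case False
    then have "\<lfloor>x\<rfloor> + 1 \<le> \<lfloor>y\<rfloor>" using floor_mono[OF assms(4)] by linarith
    then have "(of_int \<lfloor>x\<rfloor> + 1) * (v - u) \<le> of_int \<lfloor>y\<rfloor> * (v - u)"
      using assms by (intro mult_right_mono) linarith+
    moreover have "min (frac x) v - min (frac x) u \<le> v - u" "0 \<le> min (frac y) v - min (frac y) u"
      using assms by (auto simp: min_def)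
    ultimately show ?thesis unfolding eq by (simp add: algebra_simps)
  qed
qed

text \<open>The primitives for \<open>[0,u]\<close>, \<open>[u,v]\<close> and \<open>[v,1]\<close>
  are increasing and add up to the identity, so none of them grows faster than the identity.\<close>

lemma arc_lipschitz:
  assumes "0 \<le> u" "u \<le> v" "v \<le> 1"
  shows "\<bar>arc_primitive u v y - arc_primitive u v x\<bar> \<le> \<bar>y - x\<bar>"
proof -
  have *: "\<bar>arc_primitive u v y - arc_primitive u v x\<bar> \<le> y - x" if "x \<le> y" for x y
  proof -
    have "ramp 0 z = 0" "ramp 1 z = z" for z
      using frac_ge_0[of z] frac_lt_1[of z] by (simp_all add: ramp_def frac_def)
    then have "arc_primitive 0 u z + arc_primitive u v z + arc_primitive v 1 z = z" for z by (simp add: arc_primitive_def)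
    from this[of x] this[of y] show ?thesis
      using arc_mono[of 0 u x y] arc_mono[of u v x y] arc_mono[of v 1 x y] assms that by simp
  qed
  show ?thesis
    using *[of x y] *[of y x] by (cases "x \<le> y") (auto simp: abs_minus_commute)
qed

lemma lipschitz_arc:
  assumes "0 \<le> u" "u \<le> v" "v \<le> 1"
  shows "lipschitz (arc_primitive u v)"
  unfolding lipschitz_def
  by (rule exI[of _ 1]) (rule lipschitz_onI, auto simp: dist_real_def arc_lipschitz[OF assms])

lemma arc_on_arc:
  assumes "0 \<le> u" "u \<le> v" "v \<le> 1" and x: "u + of_int p \<le> x" "x \<le> v + of_int p"
    and y: "u + of_int p \<le> y" "y \<le> v + of_int p"
  shows "arc_primitive u v y - arc_primitive u v x = y - x"
proof -
  have "arc_primitive u v z = of_int p * (v - u) + z - of_int p - u" if "u + of_int p \<le> z" "z \<le> v + of_int p" for z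
    using arc_plus_int[of u v "z - of_int p" p] arc_unit_interval[of u v "z - of_int p"] assms(1-3) that
    by simp
  then show ?thesis using x y by simp
qed

lemma arc_telescope: "(\<Sum>i<m. arc_primitive (t i) (t (Suc i)) x) = arc_primitive (t 0) (t m) x"
  by (induction m) (auto simp: arc_primitive_def)

section \<open>Spreading an arc over the circle\<close>

context circle_diffeo_lift
begin

lemma log_deriv_le: "log_deriv x \<le> log_deriv 0 + V"
proof -
  obtain W where W: "\<And>x. W (x + 1) = W x + V" "\<And>x y. x \<le> y \<Longrightarrow> \<bar>log_deriv y - log_deriv x\<bar> \<le> W y - W x"
    using log_deriv_variation unfolding variation_le_def by blast
  have "F' (frac x + of_int \<lfloor>x\<rfloor>) = F' (frac x)"
    using birkhoff_plus_int[of F' 1 "frac x" "\<lfloor>x\<rfloor>"] deriv_plus_1 by (simp add: birkhoff_def)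
  then have "F' x = F' (frac x)" by (simp add: frac_def)
  moreover have "W (frac x) \<le> W 1" using W(2)[of "frac x" 1] frac_lt_1[of x] by simp
  ultimately show ?thesis using W(1)[of 0] W(2)[of 0 "frac x"] frac_ge_0[of x] by simp
qed

lemma lipschitz_iter: "lipschitz (F ^^ k)"
proof -
  define L where "L = exp (real k * (log_deriv 0 + V))"
  have *: "\<bar>(F ^^ k) y - (F ^^ k) x\<bar> \<le> L * \<bar>y - x\<bar>" if xy: "x < y" for x y
  proof -
    obtain z where z: "(F ^^ k) y - (F ^^ k) x = (y - x) * exp (birkhoff k log_deriv z)"
      using iter_mvt[OF xy] by blast
    have "birkhoff k log_deriv z \<le> real k * (log_deriv 0 + V)"
      unfolding birkhoff_def using sum_bounded_above[of "{..<k}" _ "log_deriv 0 + V"] log_deriv_le by auto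
    then show ?thesis unfolding z using xy by (simp add: L_def abs_mult mult.commute mult_left_mono)
  qed
  have "\<bar>(F ^^ k) y - (F ^^ k) x\<bar> \<le> L * \<bar>y - x\<bar>" for x y
    using *[of x y] *[of y x] by (cases x y rule: linorder_cases) (auto simp: abs_minus_commute)
  then show ?thesis unfolding lipschitz_def
    by (intro exI[of _ L] lipschitz_onI) (auto simp: dist_real_def abs_minus_commute L_def)
qed

text \<open>Along \<open>2 * q (Suc n)\<close> iterates of a return interval the variation of
  \<open>log_deriv\<close> is spent at most twice. Hence the derivatives of an iterate at two points
  of the interval have ratio at most \<open>exp (2 * V)\<close>.\<close>

lemma distortion:
  assumes "even n" "k \<le> 2 * q (Suc n)" "u \<le> a" "a \<le> ret n u" "u \<le> b" "b \<le> ret n u"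
  shows "birkhoff k log_deriv b - 2 * V \<le> birkhoff k log_deriv a"
proof -
  have "\<bar>birkhoff k log_deriv y - birkhoff k log_deriv x\<bar> \<le> 2 * V" if "x \<le> y" "u \<le> x" "y \<le> ret n u" for x y
  proof (rule birkhoff_diff_le(2)[OF log_deriv_variation assms(1) _ _ assms(2)])
    show "y \<le> ret n x" using that ret_le[of u x n] by simp
  qed (use that in simp)
  from this[of a b] this[of b a] show ?thesis using assms by (cases "a \<le> b") auto
qed

text \<open>\<open>H\<close> replaces \<open>arc_primitive u v\<close> up to negligible functions, but has slope at least
  \<open>c (v - u)\<close> everywhere.\<close>

definition is_spread :: "real \<Rightarrow> real \<Rightarrow> real \<Rightarrow> (real \<Rightarrow> real) \<Rightarrow> bool" where
  "is_spread c u v H \<longleftrightarrow> (\<forall>x y. x \<le> y \<longrightarrow> c * (v - u) * (y - x) \<le> H y - H x) \<and>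
     (\<forall>x. H (x + 1) = H x + (v - u)) \<and> lipschitz H \<and> negligible_sums (\<lambda>x. H x - arc_primitive u v x)"

text \<open>\<open>H\<close> averages the functions \<open>arc_primitive w (ret n w) \<circ> F\<^sup>k\<close> with weights proportional to the
  lengths of the preimages of the arc, so that each preimage receives the same density.\<close>

lemma spread_return_arc:
  assumes n: "even n" and w: "0 \<le> w" "ret n w \<le> 1"
  shows "\<exists>H. is_spread (exp (- 2 * V) / 2) w (ret n w) H"
proof -
  define v where "v = ret n w"
  define K where "K = arc_primitive w v"
  define N where "N = q (Suc n)"
  define M where "M = q n + N"
  have wv: "w < v" unfolding v_def by (rule ret_even[OF n])
  have v1: "v \<le> 1" using w by (simp add: v_def)
  have M: "0 < M" "M \<le> 2 * N"
    using convergent_denom_pos[OF irrational, of n] convergent_denom_le_Suc[OF irrational, of n]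
    by (simp_all add: M_def N_def)
  \<comment> \<open>The tower starts \<open>M - 1\<close> steps before \<open>w\<close>, so that the
    given arc is its last level and level \<open>j\<close> reaches it after \<open>k j\<close>
    steps.\<close>
  obtain x0 where x0: "(F ^^ (M - 1)) x0 = w" using iter_surj by blast
  define U where "U j = (F ^^ j) x0" for j
  define k where "k j = M - 1 - j" for j
  define L where "L j = ret n (U j) - U j" for j
  have L0: "0 < L j" for j unfolding L_def using ret_even[OF n, of "U j"] by simp
  have kU: "(F ^^ k j) (U j) = w" "(F ^^ k j) (ret n (U j)) = v" if "j < M" for j
  proof -
    have "(F ^^ (k j + j)) x0 = w" using that x0 by (simp add: k_def)
    then show "(F ^^ k j) (U j) = w" by (simp add: U_def iter_add)
    then show "(F ^^ k j) (ret n (U j)) = v" by (simp add: iter_ret v_def)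
  qed
  define T where "T = (\<Sum>j<M. L j)"
  have T0: "0 < T" unfolding T_def using M(1) L0 by (intro sum_pos) auto
  have "T \<le> 2"
  proof -
    have "T = (\<Sum>j<M. (F ^^ j) (ret n x0) - (F ^^ j) x0)" by (simp add: T_def L_def U_def iter_ret)
    also have "\<dots> \<le> (\<Sum>j<2 * N. (F ^^ j) (ret n x0) - (F ^^ j) x0)"
      using M(2) ret_even[OF n, of x0] by (intro sum_mono2) (auto intro: iter_le)
    also have "\<dots> \<le> 2"
      unfolding N_def using sum_iterates_le_twice[OF n, of x0 "ret n x0" "\<lambda>x. x" 1] ret_even[OF n, of x0] by simp
    finally show ?thesis .
  qed
  have weights: "(\<Sum>j<M. L j / T) = 1" using T0 by (simp add: T_def flip: sum_divide_distrib)
  define H where "H x = (\<Sum>j<M. L j / T * K ((F ^^ k j) x))" for x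
  have K_mono: "K x \<le> K y" if "x \<le> y" for x y
    unfolding K_def using w wv v1 that by (intro arc_mono) auto
  have lipK: "lipschitz K" unfolding K_def using w wv v1 by (intro lipschitz_arc) auto
  have lip: "lipschitz H" unfolding H_def
    by (intro lipschitz_sum lipschitz_mult lipschitz_compose[OF lipK] lipschitz_iter) simp
  have K_deg: "K (x + of_int p) = K x + of_int p * (v - w)" for x p
    unfolding K_def by (rule arc_plus_int)
  have deg: "H (x + 1) = H x + (v - w)" for x
  proof -
    have "H (x + 1) = (\<Sum>j<M. L j / T * (K ((F ^^ k j) x) + (v - w)))"
      unfolding H_def using iter_plus_int[of _ x 1] K_deg[of _ 1] by simp
    also have "\<dots> = H x + (\<Sum>j<M. L j / T) * (v - w)"
      by (simp add: H_def distrib_left sum.distrib sum_distrib_right)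
    finally show ?thesis by (simp add: weights)
  qed
  have neg: "negligible_sums (\<lambda>x. H x - K x)"
  proof -
    \<comment> \<open>As the weights add up to 1, the difference is a weighted mean of
      coboundaries.\<close>
    have "negligible_sums (\<lambda>x. \<Sum>j<M. L j / T * (K ((F ^^ k j) x) - K x))"
    proof (intro negligible_sums_sum negligible_sums_mult negligible_sums_coboundary)
      show "\<bar>K y - K x\<bar> \<le> \<bar>y - x\<bar>" for x y
        unfolding K_def using w wv v1 by (intro arc_lipschitz) auto
    qed (auto simp: K_deg)
    also have "(\<lambda>x. \<Sum>j<M. L j / T * (K ((F ^^ k j) x) - K x)) = (\<lambda>x. H x - K x)"
      unfolding right_diff_distrib sum_subtractf H_def sum_distrib_right[symmetric] weights by simp
    finally show ?thesis .
  qed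
  define c where "c = exp (- 2 * V) / 2 * (v - w)"
  define g where "g x = H x - c * x" for x
  have "g x \<le> g y" if "x \<le> y" for x y
  \<comment> \<open>To the right of \<open>t\<close> a single summand of \<open>H\<close> already
    has the required slope, the one for the level of the tower containing \<open>t\<close>; the
    others are increasing.\<close>
  proof (rule locally_increasing_imp_increasing[OF _ _ that])
    show "continuous_on UNIV g" unfolding g_def
      by (intro continuous_intros lipschitz_continuous lip)
    fix t
    obtain j p where jp: "j < M" "U j + of_int p \<le> t" "t < ret n (U j) + of_int p"
      using iterates_cover[OF n, of x0 t] unfolding U_def M_def N_def by blast
    show "\<exists>s>t. \<forall>r\<in>{t..<s}. g t \<le> g r"
    proof (intro exI[of _ "ret n (U j) + of_int p"] conjI ballI)
      fix r assume r: "r \<in> {t..<ret n (U j) + of_int p}"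
      show "g t \<le> g r"
      proof (cases "r = t")
        case False
        then have tr: "t < r" using r by simp
        define k' where "k' = k j"
        have k': "k' \<le> 2 * q (Suc n)" using M(2) by (simp add: k'_def k_def N_def)
        obtain z where z: "t < z" "z < r" "(F ^^ k') r - (F ^^ k') t = (r - t) * exp (birkhoff k' log_deriv z)"
          using iter_mvt[OF tr] by blast
        \<comment> \<open>On the whole level the mean derivative times the length \<open>L j\<close>
          is the length of the arc. The weight \<open>L j\<close> therefore makes the resulting
          density independent of \<open>j\<close>, up to the distortion between \<open>z\<close> and
          \<open>z'\<close>.\<close>
        obtain z' where z': "U j < z'" "z' < ret n (U j)" "v - w = L j * exp (birkhoff k' log_deriv z')"
          using iter_mvt[of "U j" "ret n (U j)" k'] ret_even[OF n, of "U j"] kU[OF jp(1)]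
          unfolding L_def k'_def by metis
        have "birkhoff k' log_deriv (z - of_int p) = birkhoff k' log_deriv z"
          using birkhoff_plus_int[of log_deriv k' z "- p"] deriv_plus_1 by simp
        then have "birkhoff k' log_deriv z' - 2 * V \<le> birkhoff k' log_deriv z"
          using distortion[OF n k', of "U j" "z - of_int p" z'] z z' jp r by simp
        then have dist: "exp (birkhoff k' log_deriv z') * exp (- 2 * V) \<le> exp (birkhoff k' log_deriv z)"
          by (simp flip: exp_add)
        have range: "w + of_int p \<le> (F ^^ k') s" "(F ^^ k') s \<le> v + of_int p"
          if "U j + of_int p \<le> s" "s \<le> ret n (U j) + of_int p" for s
          using iter_le[OF that(1), of k'] iter_le[OF that(2), of k'] kU[OF jp(1)]
          by (simp_all add: iter_plus_int k'_def)
        have "K ((F ^^ k') r) - K ((F ^^ k') t) = (F ^^ k') r - (F ^^ k') t"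
          unfolding K_def using w wv v1 r jp by (intro arc_on_arc[where p = p] range) auto
        then have Kd: "K ((F ^^ k') r) - K ((F ^^ k') t) = (r - t) * exp (birkhoff k' log_deriv z)"
          using z by simp
        have "c * (r - t) = (r - t) * (L j / 2) * (exp (birkhoff k' log_deriv z') * exp (- 2 * V))"
          by (simp add: c_def z'(3) mult_ac)
        also have "\<dots> \<le> (r - t) * (L j / 2) * exp (birkhoff k' log_deriv z)"
          using dist tr L0[of j] by (intro mult_left_mono) auto
        also have "\<dots> \<le> (r - t) * (L j / T) * exp (birkhoff k' log_deriv z)"
          using \<open>T \<le> 2\<close> T0 L0[of j] tr by (intro mult_right_mono mult_left_mono divide_left_mono) auto
        also have "\<dots> = L j / T * (K ((F ^^ k j) r) - K ((F ^^ k j) t))" using Kd by (simp add: k'_def)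
        also have "\<dots> \<le> (\<Sum>j<M. L j / T * (K ((F ^^ k j) r) - K ((F ^^ k j) t)))"
        proof (rule member_le_sum)
          fix i
          have "K ((F ^^ k i) t) \<le> K ((F ^^ k i) r)" using tr by (intro K_mono iter_le) simp
          then show "0 \<le> L i / T * (K ((F ^^ k i) r) - K ((F ^^ k i) t))"
            using L0[of i] T0 by simp
        qed (use jp in auto)
        also have "\<dots> = H r - H t" by (simp add: H_def right_diff_distrib sum_subtractf)
        finally show ?thesis by (simp add: g_def algebra_simps)
      qed simp
    qed (use jp in simp)
  qed
  then have "c * (y - x) \<le> H y - H x" if "x \<le> y" for x y
    using that by (fastforce simp: g_def algebra_simps)
  then show ?thesis using deg lip neg unfolding is_spread_def c_def K_def v_def by (intro exI[of _ H]) blast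
qed

lemma ret_power: "(ret n ^^ i) u = (F ^^ (q n * i)) u - of_int (int i * convergent_num \<alpha> n)"
proof (induction i)
  case (Suc i)
  have "(ret n ^^ Suc i) u = ret n ((F ^^ (q n * i)) u + of_int (- (int i * convergent_num \<alpha> n)))"
    by (simp add: Suc)
  also have "\<dots> = (F ^^ (q n + q n * i)) u - of_int (convergent_num \<alpha> n) + of_int (- (int i * convergent_num \<alpha> n))"
    by (simp only: ret_plus_int) (simp add: ret_def iter_add)
  finally show ?case by (simp add: algebra_simps)
qed simp

lemma ret_power_unbounded:
  assumes "even n"
  shows "\<exists>i. v < (ret n ^^ i) v'"
proof -
  have e: "0 < convergent_error \<alpha> n" using convergent_error_sign[OF irrational, of n] assms by simp
  define C where "C = \<lceil>v - v'\<rceil>"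
  obtain i :: nat where i: "of_int C / convergent_error \<alpha> n < real i" using reals_Archimedean2 by blast
  then have "of_int C < real i * convergent_error \<alpha> n" using e by (simp add: divide_less_eq)
  then have "(F ^^ 0) v' + of_int (C + int i * convergent_num \<alpha> n) < (F ^^ (q n * i)) v' + of_int 0"
    by (intro orbit_less) (simp add: convergent_error_def algebra_simps)
  then have "v' + of_int C < (ret n ^^ i) v'" by (simp add: ret_power)
  moreover have "v - v' \<le> of_int C" unfolding C_def by (rule le_of_int_ceiling)
  ultimately show ?thesis by (intro exI[of _ i]) linarith
qed

text \<open>Successive return intervals from \<open>u\<close> upwards, each at most half as long as
  the arc, fill at least half of it. These are spread; the rest of the arc is kept unchanged and
  contributes only monotonicity, at the cost of a factor 1/2.\<close>

lemma spread_arc: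
  assumes u: "0 \<le> u" "u < v" "v \<le> 1"
  shows "\<exists>H. is_spread (exp (- 2 * V) / 4) u v H"
proof -
  have "0 < (v - u) / 2" using u by simp
  then obtain n0 where "\<And>n x. n0 \<le> n \<Longrightarrow> \<bar>ret n x - x\<bar> \<le> (v - u) / 2"
    using ret_close by meson
  from this[of "2 * n0"] obtain n where n: "even n" and close: "\<And>x. \<bar>ret n x - x\<bar> \<le> (v - u) / 2"
    by (metis dvd_triv_left le_add2 mult_2)
  define t where "t i = (ret n ^^ i) u" for i
  have t_Suc: "t (Suc i) = ret n (t i)" for i by (simp add: t_def)
  have t_less: "t i < t (Suc i)" for i unfolding t_Suc by (rule ret_even[OF n])
  have ex: "\<exists>i. v < t i" unfolding t_def by (rule ret_power_unbounded[OF n])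
  define m where "m = (LEAST i. v < t i) - 1"
  have "(LEAST i. v < t i) \<noteq> 0"
  proof
    assume "(LEAST i. v < t i) = 0"
    then have "v < t 0" using LeastI_ex[OF ex] by simp
    then show False using u by (simp add: t_def)
  qed
  then have Sm: "(LEAST i. v < t i) = Suc m" by (simp add: m_def)
  then have tm1: "v < t (Suc m)" using LeastI_ex[OF ex] by simp
  have tm: "t i \<le> v" if "i \<le> m" for i
    using not_less_Least[of i "\<lambda>i. v < t i"] that Sm by simp
  have t_u: "u \<le> t i" for i by (induction i) (use t_less in \<open>auto simp: t_def[of 0] intro: order_trans less_imp_le\<close>)
  have half: "(v - u) / 2 \<le> t m - u" using abs_le_D1[OF close[of "t m"]] tm1 unfolding t_Suc by (simp add: field_simps)
  define c where "c = exp (- 2 * V) / 2"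
  have "\<forall>i<m. \<exists>H. is_spread c (t i) (t (Suc i)) H"
  proof (intro allI impI)
    fix i assume "i < m"
    then have "0 \<le> t i" "ret n (t i) \<le> 1" using t_u[of i] tm[of "Suc i"] u by (simp_all add: t_Suc)
    then show "\<exists>H. is_spread c (t i) (t (Suc i)) H"
      unfolding c_def t_Suc by (rule spread_return_arc[OF n])
  qed
  then obtain G where G: "\<And>i. i < m \<Longrightarrow> is_spread c (t i) (t (Suc i)) (G i)" by metis
  note G = G[unfolded is_spread_def, THEN conjunct1, rule_format]
    G[unfolded is_spread_def, THEN conjunct2, THEN conjunct1, rule_format]
    G[unfolded is_spread_def, THEN conjunct2, THEN conjunct2, THEN conjunct1]
    G[unfolded is_spread_def, THEN conjunct2, THEN conjunct2, THEN conjunct2]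
  define H where "H x = (\<Sum>i<m. G i x) + arc_primitive (t m) v x" for x
  have t0: "t 0 = u" by (simp add: t_def)
  have tele: "(\<Sum>i<m. t (Suc i) - t i) = t m - u" using sum_lessThan_telescope[of t m] t0 by simp
  have arcm: "0 \<le> t m" "t m \<le> v" "v \<le> 1" using t_u[of m] tm[of m] u by simp_all
  have "is_spread (exp (- 2 * V) / 4) u v H"
    unfolding is_spread_def
  proof (intro conjI allI impI)
    fix x y :: real assume "x \<le> y"
    have "exp (- 2 * V) / 4 * (v - u) * (y - x) = c * ((v - u) / 2) * (y - x)" by (simp add: c_def)
    also have "\<dots> \<le> c * (t m - u) * (y - x)"
      using half \<open>x \<le> y\<close> by (intro mult_right_mono mult_left_mono) (auto simp: c_def)
    also have "\<dots> = (\<Sum>i<m. c * (t (Suc i) - t i) * (y - x))"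
      unfolding tele[symmetric] sum_distrib_left sum_distrib_right ..
    also have "\<dots> \<le> (\<Sum>i<m. G i y - G i x)" using G(1)[OF _ \<open>x \<le> y\<close>] by (intro sum_mono) simp
    also have "\<dots> \<le> H y - H x" using arc_mono[OF arcm \<open>x \<le> y\<close>] by (simp add: H_def sum_subtractf)
    finally show "exp (- 2 * V) / 4 * (v - u) * (y - x) \<le> H y - H x" .
  next
    fix x
    have "H (x + 1) = (\<Sum>i<m. G i x + (t (Suc i) - t i)) + (arc_primitive (t m) v x + (v - t m))"
      using arc_plus_int[of "t m" v x 1] by (simp add: H_def G(2))
    then show "H (x + 1) = H x + (v - u)" by (simp add: H_def sum.distrib tele)
  next
    show "lipschitz H" unfolding H_def
      by (intro lipschitz_add lipschitz_sum G(3) lipschitz_arc arcm) auto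
  next
    have "negligible_sums (\<lambda>x. \<Sum>i<m. G i x - arc_primitive (t i) (t (Suc i)) x)"
      by (intro negligible_sums_sum G(4)) auto
    also have "(\<lambda>x. \<Sum>i<m. G i x - arc_primitive (t i) (t (Suc i)) x) = (\<lambda>x. H x - arc_primitive u v x)"
      unfolding sum_subtractf arc_telescope t0 by (simp add: H_def arc_primitive_def fun_eq_iff)
    finally show "negligible_sums (\<lambda>x. H x - arc_primitive u v x)" .
  qed
  then show ?thesis by blast
qed

subsection \<open>Reducing the variation\<close>

definition test_function :: "(real \<Rightarrow> real) \<Rightarrow> bool" where
  "test_function \<phi> \<longleftrightarrow>
     (\<forall>x. \<phi> (x + 1) = \<phi> x) \<and> continuous_on UNIV \<phi> \<and> grid_absolutely_continuous \<phi>"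

definition spread :: real where "spread = exp (- 2 * V) / 4"

lemma spread_bounds: "0 < spread" "spread < 1"
proof -
  show "0 < spread" by (simp add: spread_def)
  have "exp (- 2 * V) \<le> 1" using variation_le_nonneg[OF log_deriv_variation] by simp
  then show "spread < 1" unfolding spread_def by linarith
qed

text \<open>Up to a constant, \<open>g\<close> is the piecewise linear interpolant of \<phi> on the
  grid, and \<open>h\<close> arises from it by spreading the arcs of all cells. The new function
  \<open>\<phi> - g + h\<close> thus differs from \<phi> by a negligible one; the variation of
  \<open>\<phi> - g\<close> is at most \<eta>, and that of \<open>h\<close> is smaller than the
  bound for \<phi> by the factor \<open>1 - spread\<close>.\<close>

lemma reduce_variation:
  assumes \<phi>: "test_function \<phi>" and B: "variation_le \<phi> B" and \<eta>: "0 < \<eta>"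
  obtains \<phi>' where "test_function \<phi>'" "variation_le \<phi>' ((1 - spread) * B + \<eta>)"
    "negligible_sums (\<lambda>x. \<phi> x - \<phi>' x)"
proof -
  have per: "\<phi> (x + 1) = \<phi> x" for x using \<phi> by (simp add: test_function_def)
  have cont: "continuous_on UNIV \<phi>" and ac: "grid_absolutely_continuous \<phi>"
    using \<phi> by (simp_all add: test_function_def)
  have "0 < \<eta> / 6" using \<eta> by simp
  from piecewise_linear_approximation[OF ac this] obtain K where K: "0 < K"
    and approx: "\<And>R. 0 < R \<Longrightarrow> (\<Sum>j<K * R. \<bar>grid_increment (K * R) \<phi> j - grid_increment K \<phi> (j div R) / real R\<bar>) \<le> \<eta>"
    by auto
  define t where "t i = real i / real K" for i
  define a where "a = grid_increment K \<phi>"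
  define s where "s i = real K * a i" for i
  have t: "0 \<le> t i" "t i < t (Suc i)" "t (Suc i) \<le> 1" if "i < K" for i
    using that K by (simp_all add: t_def divide_strict_right_mono)
  have len: "t (Suc i) - t i = 1 / real K" for i by (simp add: t_def diff_divide_distrib[symmetric])
  have "\<forall>i<K. \<exists>H. is_spread spread (t i) (t (Suc i)) H"
    unfolding spread_def by (intro allI impI spread_arc t)
  then obtain H where H: "\<And>i. i < K \<Longrightarrow> is_spread spread (t i) (t (Suc i)) (H i)" by metis
  note H = H[unfolded is_spread_def len, THEN conjunct1, rule_format]
    H[unfolded is_spread_def len, THEN conjunct2, THEN conjunct1, rule_format]
    H[unfolded is_spread_def, THEN conjunct2, THEN conjunct2, THEN conjunct1]
    H[unfolded is_spread_def, THEN conjunct2, THEN conjunct2, THEN conjunct2]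
  define g where "g x = (\<Sum>i<K. s i * arc_primitive (t i) (t (Suc i)) x)" for x
  define h where "h x = (\<Sum>i<K. s i * H i x)" for x
  have sum_a: "(\<Sum>i<K. a i) = 0"
  proof -
    have "(\<Sum>i<K. a i) = \<phi> (t K) - \<phi> (t 0)"
      unfolding a_def grid_increment_def t_def by (rule sum_lessThan_telescope)
    then show ?thesis using K per[of 0] by (simp add: t_def)
  qed
  have sum_s: "(\<Sum>i<K. s i * (1 / real K)) = 0" using sum_a K by (simp add: s_def)
  have g_per: "g (x + 1) = g x" for x
  proof -
    have "g (x + 1) = (\<Sum>i<K. s i * (arc_primitive (t i) (t (Suc i)) x + 1 / real K))"
      unfolding g_def using arc_plus_int[of _ _ x 1] len by simp
    then show ?thesis unfolding distrib_left sum.distrib sum_s by (simp add: g_def)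
  qed
  have h_per: "h (x + 1) = h x" for x
  proof -
    have "h (x + 1) = (\<Sum>i<K. s i * (H i x + 1 / real K))" unfolding h_def by (simp add: H(2))
    then show ?thesis unfolding distrib_left sum.distrib sum_s by (simp add: h_def)
  qed
  have g_lip: "lipschitz g" unfolding g_def
    by (intro lipschitz_sum lipschitz_mult lipschitz_arc) (use t in \<open>auto intro: less_imp_le\<close>)
  have h_lip: "lipschitz h" unfolding h_def by (intro lipschitz_sum lipschitz_mult H) auto
  have gh: "negligible_sums (\<lambda>x. g x - h x)"
  proof -
    have "negligible_sums (\<lambda>x. \<Sum>i<K. - s i * (H i x - arc_primitive (t i) (t (Suc i)) x))"
      by (intro negligible_sums_sum negligible_sums_mult H) auto
    also have "(\<lambda>x. \<Sum>i<K. - s i * (H i x - arc_primitive (t i) (t (Suc i)) x)) = (\<lambda>x. g x - h x)"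
      by (simp add: g_def h_def algebra_simps sum_subtractf)
    finally show ?thesis .
  qed
  have "variation_le (\<lambda>x. \<phi> x + - 1 * g x) \<eta>"
  proof (rule variation_leI_grid[OF _ _ K])
    show "continuous_on UNIV (\<lambda>x. \<phi> x + - 1 * g x)"
      by (intro continuous_intros cont lipschitz_continuous g_lip)
    fix R :: nat assume R: "0 < R"
    have "grid_increment (K * R) (\<lambda>x. \<phi> x + - 1 * g x) j = grid_increment (K * R) \<phi> j - a (j div R) / real R"
      if j: "j < K * R" for j
    proof -
      define x y where "x = real j / real (K * R)" and "y = real (Suc j) / real (K * R)"
      have jK: "j div R < K" using j by (simp add: less_mult_imp_div_less)
      have KR: "0 < real (K * R)" using K R by simp
      have "real (Suc j) \<le> real (K * R)" using j by (simp only: of_nat_le_iff Suc_le_eq)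
      then have xy: "0 \<le> x" "x \<le> y" "y \<le> 1"
        using KR by (simp_all add: x_def y_def divide_right_mono del: of_nat_Suc of_nat_mult)
      have yx: "y - x = 1 / real (K * R)" by (simp add: x_def y_def diff_divide_distrib[symmetric])
      have tt: "t i = real (i * R) / real (K * R)" for i using R by (simp add: t_def)
      have ge: "t (Suc i) \<le> x" if "i < j div R" for i
      proof -
        have "Suc i * R \<le> j" using that R by (metis Suc_leI less_eq_div_iff_mult_less_eq)
        then show ?thesis unfolding tt x_def by (intro divide_right_mono) (simp_all only: of_nat_le_iff of_nat_0_le_iff)
      qed
      have le: "y \<le> t i" if "j div R < i" for i
      proof -
        have "Suc j \<le> i * R" using that R by (metis Suc_leI div_less_iff_less_mult)
        then show ?thesis unfolding tt y_def by (intro divide_right_mono) (simp_all only: of_nat_le_iff of_nat_0_le_iff)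
      qed
      have inc: "arc_primitive (t i) (t (Suc i)) y - arc_primitive (t i) (t (Suc i)) x = (if i = j div R then 1 / real (K * R) else 0)"
        if "i < K" for i
      proof -
        have i: "0 \<le> t i" "t i \<le> t (Suc i)" "t (Suc i) \<le> 1" using t[OF that] by auto
        have eq: "arc_primitive (t i) (t (Suc i)) z = min z (t (Suc i)) - min z (t i)" if "0 \<le> z" "z \<le> 1" for z
          using arc_unit_interval[OF i that] .
        have "arc_primitive (t i) (t (Suc i)) y - arc_primitive (t i) (t (Suc i)) x
            = min y (t (Suc i)) - min y (t i) - (min x (t (Suc i)) - min x (t i))"
          using eq[of x] eq[of y] xy by simp
        also have "\<dots> = (if i = j div R then y - x else 0)"
        proof (cases i "j div R" rule: linorder_cases)
          case less
          then show ?thesis using ge[of i] xy i by auto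
        next
          case equal
          have "t i \<le> x"
            unfolding tt x_def equal by (intro divide_right_mono) (simp_all only: of_nat_le_iff of_nat_0_le_iff div_times_less_eq_dividend)
          then show ?thesis using le[of "Suc i"] equal xy by auto
        next
          case greater
          then show ?thesis using le[of i] xy i by auto
        qed
        finally show ?thesis by (simp only: yx)
      qed
      have "g y - g x = (\<Sum>i<K. s i * (arc_primitive (t i) (t (Suc i)) y - arc_primitive (t i) (t (Suc i)) x))"
        by (simp add: g_def right_diff_distrib sum_subtractf)
      also have "\<dots> = (\<Sum>i<K. if i = j div R then s i * (1 / real (K * R)) else 0)"
        by (intro sum.cong refl) (simp add: inc)
      also have "\<dots> = a (j div R) / real R" using jK K by (simp add: s_def)
      finally show ?thesis by (simp add: grid_increment_def x_def y_def)
    qed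
    then have "(\<Sum>j<K * R. \<bar>grid_increment (K * R) (\<lambda>x. \<phi> x + - 1 * g x) j\<bar>)
        = (\<Sum>j<K * R. \<bar>grid_increment (K * R) \<phi> j - a (j div R) / real R\<bar>)"
      by (intro sum.cong refl) simp
    then show "(\<Sum>j<K * R. \<bar>grid_increment (K * R) (\<lambda>x. \<phi> x + - 1 * g x) j\<bar>) \<le> \<eta>"
      using approx[OF R] by (simp add: a_def)
  qed (simp add: per g_per)
  moreover have "variation_le h ((1 - spread) * (\<Sum>i<K. \<bar>a i\<bar>))"
  \<comment> \<open>Each \<open>H i\<close> splits into a linear function of slope
    \<open>spread / K\<close> and an increasing rest that grows by \<open>(1 - spread) / K\<close>
    over a period. Weighted with \<open>s i\<close> the linear parts cancel, because the slopes add
    up to 0; only the rests enter with absolute values.\<close>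
  proof (rule variation_leI[where W = "\<lambda>x. \<Sum>i<K. \<bar>s i\<bar> * (H i x - spread * (1 / real K) * x)"])
    fix x
    have "(\<Sum>i<K. \<bar>s i\<bar> * (H i (x + 1) - spread * (1 / real K) * (x + 1)))
        = (\<Sum>i<K. \<bar>s i\<bar> * (H i x - spread * (1 / real K) * x) + (1 - spread) * \<bar>a i\<bar>)"
    proof (intro sum.cong refl)
      fix i assume "i \<in> {..<K}"
      then have "H i (x + 1) = H i x + 1 / real K" by (simp add: H(2))
      then have "H i (x + 1) - spread * (1 / real K) * (x + 1)
          = (H i x - spread * (1 / real K) * x) + (1 - spread) * (1 / real K)"
        by (simp only: left_diff_distrib distrib_left)
      moreover have "\<bar>s i\<bar> * ((1 - spread) * (1 / real K)) = (1 - spread) * \<bar>a i\<bar>"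
        using K by (simp add: s_def abs_mult)
      ultimately show "\<bar>s i\<bar> * (H i (x + 1) - spread * (1 / real K) * (x + 1))
          = \<bar>s i\<bar> * (H i x - spread * (1 / real K) * x) + (1 - spread) * \<bar>a i\<bar>"
        by (simp only: distrib_left)
    qed
    then show "(\<Sum>i<K. \<bar>s i\<bar> * (H i (x + 1) - spread * (1 / real K) * (x + 1)))
        = (\<Sum>i<K. \<bar>s i\<bar> * (H i x - spread * (1 / real K) * x)) + (1 - spread) * (\<Sum>i<K. \<bar>a i\<bar>)"
      by (simp only: sum.distrib sum_distrib_left)
    fix y :: real assume "x \<le> y"
    define G where "G i z = H i z - spread * (1 / real K) * z" for i z
    have "h z = (\<Sum>i<K. s i * G i z)" for z
    proof -
      have "(\<Sum>i<K. s i * G i z) = h z - (\<Sum>i<K. s i * (1 / real K)) * (spread * z)"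
        unfolding G_def h_def right_diff_distrib sum_subtractf sum_distrib_right by (simp add: mult_ac)
      then show ?thesis by (simp add: sum_s del: times_divide_eq_right)
    qed
    then have "h y - h x = (\<Sum>i<K. s i * (G i y - G i x))"
      by (simp add: right_diff_distrib sum_subtractf)
    also have "\<bar>\<dots>\<bar> \<le> (\<Sum>i<K. \<bar>s i * (G i y - G i x)\<bar>)" by (rule sum_abs)
    also have "\<dots> = (\<Sum>i<K. \<bar>s i\<bar> * (G i y - G i x))"
    proof (intro sum.cong refl)
      fix i assume "i \<in> {..<K}"
      then have "0 \<le> G i y - G i x" using H(1)[of i x y] \<open>x \<le> y\<close> unfolding G_def right_diff_distrib by simp
      then show "\<bar>s i * (G i y - G i x)\<bar> = \<bar>s i\<bar> * (G i y - G i x)" by (simp add: abs_mult)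
    qed
    also have "\<dots> = (\<Sum>i<K. \<bar>s i\<bar> * G i y) - (\<Sum>i<K. \<bar>s i\<bar> * G i x)"
      by (simp add: right_diff_distrib sum_subtractf)
    finally show "\<bar>h y - h x\<bar> \<le> (\<Sum>i<K. \<bar>s i\<bar> * (H i y - spread * (1 / real K) * y))
        - (\<Sum>i<K. \<bar>s i\<bar> * (H i x - spread * (1 / real K) * x))"
      by (simp only: G_def)
  qed
  ultimately have "variation_le (\<lambda>x. (\<phi> x + - 1 * g x) + h x) (\<eta> + (1 - spread) * (\<Sum>i<K. \<bar>a i\<bar>))"
    by (rule variation_le_add)
  moreover have "(\<Sum>i<K. \<bar>a i\<bar>) \<le> B"
  proof -
    obtain W where W: "\<And>x. W (x + 1) = W x + B" "\<And>x y. x \<le> y \<Longrightarrow> \<bar>\<phi> y - \<phi> x\<bar> \<le> W y - W x"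
      using B unfolding variation_le_def by blast
    have "(\<Sum>i<K. \<bar>a i\<bar>) \<le> (\<Sum>i<K. W (t (Suc i)) - W (t i))"
      unfolding a_def grid_increment_def t_def by (intro sum_mono W(2)) (simp add: divide_right_mono)
    also have "\<dots> = W (t K) - W (t 0)" by (rule sum_lessThan_telescope)
    finally show ?thesis using W(1)[of 0] K by (simp add: t_def)
  qed
  then have "\<eta> + (1 - spread) * (\<Sum>i<K. \<bar>a i\<bar>) \<le> (1 - spread) * B + \<eta>"
    using spread_bounds by (simp add: mult_left_mono)
  ultimately have "variation_le (\<lambda>x. (\<phi> x + - 1 * g x) + h x) ((1 - spread) * B + \<eta>)"
    by (rule variation_le_mono)
  moreover have "test_function (\<lambda>x. (\<phi> x + - 1 * g x) + h x)"
    unfolding test_function_def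
    by (intro conjI allI continuous_intros cont lipschitz_continuous g_lip h_lip
        grid_absolutely_continuous_add ac grid_absolutely_continuous_lipschitz lipschitz_mult)
      (simp add: per g_per h_per)
  moreover have "negligible_sums (\<lambda>x. \<phi> x - ((\<phi> x + - 1 * g x) + h x))" using gh by simp
  ultimately show thesis using that by blast
qed

text \<open>Allowing an error of \<open>spread / 2\<close> times the current bound, each reduction
  multiplies this bound by \<open>1 - spread / 2\<close>. After enough of them Denjoy--Koksma keeps
  the remainder below \<open>\<epsilon> / 2\<close>, and the part removed is negligible.\<close>

lemma test_function_negligible_sums:
  assumes "test_function \<phi>"
  shows "negligible_sums \<phi>"
proof -
  have per: "\<phi> (x + 1) = \<phi> x" for x using assms by (simp add: test_function_def)
  obtain m where m: "0 < m" "\<And>R. 0 < R \<Longrightarrow> (\<Sum>j<m * R. \<bar>grid_increment (m * R) \<phi> j\<bar>) \<le> real m"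
    using grid_variation_bound assms unfolding test_function_def by blast
  have var: "variation_le \<phi> (real m)"
    by (rule variation_leI_grid[OF _ _ m]) (use assms in \<open>simp_all add: test_function_def\<close>)
  define \<theta> where "\<theta> = 1 - spread / 2"
  have \<theta>: "0 < \<theta>" "\<theta> < 1" using spread_bounds by (simp_all add: \<theta>_def)
  have iterate: "\<exists>\<psi>. test_function \<psi> \<and> variation_le \<psi> (\<theta> ^ r * real m) \<and> negligible_sums (\<lambda>x. \<phi> x - \<psi> x)" for r
  proof (induction r)
    case 0
    then show ?case using assms var negligible_sums_zero by (intro exI[of _ \<phi>]) simp
  next
    case (Suc r)
    then obtain \<psi> where \<psi>: "test_function \<psi>" "variation_le \<psi> (\<theta> ^ r * real m)"
      "negligible_sums (\<lambda>x. \<phi> x - \<psi> x)" by blast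
    have "0 < spread / 2 * (\<theta> ^ r * real m)" using \<theta> m spread_bounds by simp
    from reduce_variation[OF \<psi>(1,2) this] obtain \<psi>' where \<psi>': "test_function \<psi>'"
      "variation_le \<psi>' ((1 - spread) * (\<theta> ^ r * real m) + spread / 2 * (\<theta> ^ r * real m))"
      "negligible_sums (\<lambda>x. \<psi> x - \<psi>' x)" by blast
    have "(1 - spread) * (\<theta> ^ r * real m) + spread / 2 * (\<theta> ^ r * real m) = \<theta> ^ Suc r * real m"
      by (simp add: \<theta>_def algebra_simps)
    moreover have "negligible_sums (\<lambda>x. \<phi> x - \<psi>' x)"
      using negligible_sums_add[OF \<psi>(3) \<psi>'(3)] by simp
    ultimately show ?case using \<psi>' by (intro exI[of _ \<psi>']) simp
  qed
  show ?thesis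
    unfolding negligible_sums_def
  proof (intro allI impI)
    fix \<epsilon> :: real assume e: "0 < \<epsilon>"
    then have "0 < \<epsilon> / 2 / (3 * real m)" using m by simp
    then obtain r where "\<theta> ^ r < \<epsilon> / 2 / (3 * real m)" using real_arch_pow_inv[OF _ \<theta>(2)] by blast
    then have small: "3 * (\<theta> ^ r * real m) \<le> \<epsilon> / 2" using m by (simp add: field_simps)
    obtain \<psi> where \<psi>: "test_function \<psi>" "variation_le \<psi> (\<theta> ^ r * real m)"
      "negligible_sums (\<lambda>x. \<phi> x - \<psi> x)" using iterate by blast
    have "0 < \<epsilon> / 2" using e by simp
    then obtain n0 where n0: "\<And>n x y. n0 \<le> n \<Longrightarrow>
        \<bar>birkhoff (q n) (\<lambda>x. \<phi> x - \<psi> x) x - birkhoff (q n) (\<lambda>x. \<phi> x - \<psi> x) y\<bar> \<le> \<epsilon> / 2"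
      using \<psi>(3) unfolding negligible_sums_def by meson
    have "\<bar>birkhoff (q n) \<phi> x - birkhoff (q n) \<phi> y\<bar> \<le> \<epsilon>" if "n0 \<le> n" for n x y
    proof -
      have eq: "birkhoff (q n) (\<lambda>x. \<phi> x - \<psi> x) z = birkhoff (q n) \<phi> z - birkhoff (q n) \<psi> z" for z
        by (simp add: birkhoff_def sum_subtractf)
      have "\<bar>birkhoff (q n) \<psi> x - birkhoff (q n) \<psi> y\<bar> \<le> 3 * (\<theta> ^ r * real m)"
        using \<psi>(1) by (intro denjoy_koksma \<psi>(2)) (simp add: test_function_def)
      then show ?thesis using n0[OF that, of x y] small unfolding eq by linarith
    qed
    then show "\<exists>n0. \<forall>n\<ge>n0. \<forall>x y. \<bar>birkhoff (q n) \<phi> x - birkhoff (q n) \<phi> y\<bar> \<le> \<epsilon>" by blast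
  qed
qed

end

section \<open>Circle maps and their lifts\<close>

lemma to_circle_surj:
  obtains x where "p = to_circle x" "0 \<le> x" "x < 1"
proof -
  have "to_circle (frac (rep_circle p)) = to_circle (rep_circle p)"
    by (subst to_circle_eq_iff) (simp add: frac_def)
  then show thesis
    using that[of "frac (rep_circle p)"] by (simp add: frac_lt_1)
qed

lemma absolutely_continuous_on_pair:
  assumes g: "absolutely_continuous_on g {a..b}" and "0 < \<epsilon>"
  obtains \<delta> where "0 < \<delta>" "\<And>x y. a \<le> x \<Longrightarrow> x \<le> y \<Longrightarrow> y \<le> b \<Longrightarrow> y - x < \<delta> \<Longrightarrow> \<bar>g y - g x\<bar> < \<epsilon>"
proof -
  obtain \<delta> where \<delta>: "0 < \<delta>" "\<forall>d. d division_of \<Union>d \<and> \<Union>d \<subseteq> {a..b} \<and> (\<Sum>I\<in>d. Sup I - Inf I) < \<delta> \<longrightarrow>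
      (\<Sum>I\<in>d. \<bar>g (Sup I) - g (Inf I)\<bar>) < \<epsilon>"
    using assms unfolding absolutely_continuous_on_def by blast
  have "\<bar>g y - g x\<bar> < \<epsilon>" if xy: "a \<le> x" "x \<le> y" "y \<le> b" "y - x < \<delta>" for x y
  proof -
    have "{{x..y}} division_of \<Union>{{x..y}}"
      using division_of_self[of x y] xy by (simp add: cbox_interval)
    then show ?thesis using \<delta>(2)[rule_format, of "{{x..y}}"] xy by simp
  qed
  then show thesis using that \<delta>(1) by blast
qed

text \<open>The hypothesis controls a single period. An interval shorter than 1 meets at most one
  integer in its interior and is split there, each part using half of \<epsilon>.\<close>

lemma continuous_of_absolutely_continuous:
  assumes g: "absolutely_continuous_on g {0..1}" and per: "\<And>x. g (x + 1) = g x"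
  shows "continuous_on UNIV g"
proof -
  have int: "g (x + of_int k) = g x" for x k
    using shift_int[of g 0] per by simp
  have ordered: "\<exists>\<delta>>0. \<forall>x y. x \<le> y \<and> y - x < \<delta> \<longrightarrow> \<bar>g y - g x\<bar> < \<epsilon>" if "0 < \<epsilon>" for \<epsilon>
  proof -
    have "0 < \<epsilon> / 2" using that by simp
    then obtain \<delta> where \<delta>: "0 < \<delta>" "\<And>x y. 0 \<le> x \<Longrightarrow> x \<le> y \<Longrightarrow> y \<le> 1 \<Longrightarrow> y - x < \<delta> \<Longrightarrow> \<bar>g y - g x\<bar> < \<epsilon> / 2"
      using absolutely_continuous_on_pair[OF g] by blast
    have "\<bar>g y - g x\<bar> < \<epsilon>" if xy: "x \<le> y" "y - x < min \<delta> 1" for x y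
    proof -
      define p where "p = \<lfloor>x\<rfloor>"
      have p: "of_int p \<le> x" "x < of_int p + 1" unfolding p_def by linarith+
      have shift: "\<bar>g b - g a\<bar> < \<epsilon> / 2" if "of_int k \<le> a" "a \<le> b" "b \<le> of_int k + 1" "b - a < \<delta>" for a b k
        using \<delta>(2)[of "a - of_int k" "b - of_int k"] int[of "a - of_int k" k] int[of "b - of_int k" k] that by simp
      show ?thesis
      proof (cases "y \<le> of_int p + 1")
        case True
        then show ?thesis using shift[of p x y] p xy \<open>0 < \<epsilon>\<close> by simp
      next
        case False
        have "\<bar>g (of_int p + 1) - g x\<bar> < \<epsilon> / 2" using shift[of p x "of_int p + 1"] p xy False by simp
        moreover have "\<bar>g y - g (of_int p + 1)\<bar> < \<epsilon> / 2"
          using shift[of "p + 1" "of_int p + 1" y] p xy False by simp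
        ultimately show ?thesis by linarith
      qed
    qed
    then show ?thesis using \<delta>(1) by (intro exI[of _ "min \<delta> 1"]) simp
  qed
  show ?thesis
    unfolding continuous_on_iff dist_real_def
  proof (intro ballI allI impI)
    fix x \<epsilon> :: real assume "0 < \<epsilon>"
    from ordered[OF this] obtain \<delta> where \<delta>: "0 < \<delta>" "\<And>x y. x \<le> y \<Longrightarrow> y - x < \<delta> \<Longrightarrow> \<bar>g y - g x\<bar> < \<epsilon>" by blast
    have "\<bar>g y - g x\<bar> < \<epsilon>" if "\<bar>y - x\<bar> < \<delta>" for y
      using \<delta>(2)[of x y] \<delta>(2)[of y x] that by (cases "x \<le> y") (auto simp: abs_minus_commute)
    then show "\<exists>d>0. \<forall>x'\<in>UNIV. \<bar>x' - x\<bar> < d \<longrightarrow> \<bar>g x' - g x\<bar> < \<epsilon>" using \<delta>(1) by blast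
  qed
qed

lemma grid_absolutely_continuous_of_absolutely_continuous:
  assumes "absolutely_continuous_on g {0..1}"
  shows "grid_absolutely_continuous g"
  unfolding grid_absolutely_continuous_def
proof (intro allI impI)
  fix \<epsilon> :: real assume "0 < \<epsilon>"
  then obtain \<delta> where \<delta>: "0 < \<delta>" "\<forall>d. d division_of \<Union>d \<and> \<Union>d \<subseteq> {0..1} \<and> (\<Sum>I\<in>d. Sup I - Inf I) < \<delta> \<longrightarrow>
      (\<Sum>I\<in>d. \<bar>g (Sup I) - g (Inf I)\<bar>) < \<epsilon>"
    using assms unfolding absolutely_continuous_on_def by blast
  show "\<exists>\<delta>>0. \<forall>K S. 0 < K \<longrightarrow> S \<subseteq> {..<K} \<longrightarrow> real (card S) < \<delta> * real K \<longrightarrow>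
        (\<Sum>j\<in>S. \<bar>grid_increment K g j\<bar>) < \<epsilon>"
  proof (intro exI[of _ \<delta>] conjI allI impI)
    fix K :: nat and S assume K: "0 < K" and S: "S \<subseteq> {..<K}" and card: "real (card S) < \<delta> * real K"
    define J where "J j = {real j / real K..real (Suc j) / real K}" for j
    have lt: "real j / real K < real (Suc j) / real K" for j using K by (simp add: divide_strict_right_mono)
    have Inf: "Inf (J j) = real j / real K" and Sup: "Sup (J j) = real (Suc j) / real K" for j
      using lt[of j] by (simp_all add: J_def)
    have inj: "inj_on J S"
    proof (rule inj_onI)
      fix i j assume "J i = J j"
      then have "Inf (J i) = Inf (J j)" by simp
      then show "i = j" using K by (simp add: Inf)
    qed
    have int: "interior (J i) \<inter> interior (J j) = {}" if "i < j" for i j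
    proof -
      have "real (Suc i) / real K \<le> real j / real K" using that by (intro divide_right_mono) auto
      then show ?thesis by (auto simp: J_def)
    qed
    have "J ` S division_of \<Union>(J ` S)"
    proof (rule division_ofI)
      show "finite (J ` S)" using S finite_subset by blast
      fix I assume "I \<in> J ` S"
      then obtain i where i: "I = J i" "i \<in> S" by blast
      then show "I \<subseteq> \<Union>(J ` S)" by auto
      show "I \<noteq> {}" using lt[of i] by (simp add: i J_def)
      show "\<exists>a b. I = cbox a b" unfolding i J_def cbox_interval[symmetric] by blast
      fix I' assume "I' \<in> J ` S" "I \<noteq> I'"
      then obtain j where j: "I' = J j" "i \<noteq> j" using i by blast
      then show "interior I \<inter> interior I' = {}"
        using int[of i j] int[of j i] by (cases i j rule: linorder_cases) (auto simp: i)
    qed simp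
    moreover have "\<Union>(J ` S) \<subseteq> {0..1}"
    proof -
      have "J j \<subseteq> {0..1}" if "j \<in> S" for j
      proof -
        have "real (Suc j) / real K \<le> 1" using S that K by (auto simp: divide_le_eq)
        then show ?thesis by (auto simp: J_def intro: order_trans)
      qed
      then show ?thesis by blast
    qed
    moreover have "(\<Sum>I\<in>J ` S. Sup I - Inf I) < \<delta>"
    proof -
      have "(\<Sum>I\<in>J ` S. Sup I - Inf I) = (\<Sum>j\<in>S. 1 / real K)"
        by (simp add: sum.reindex[OF inj] Inf Sup diff_divide_distrib[symmetric])
      then show ?thesis using card K by (simp add: divide_less_eq)
    qed
    ultimately have "(\<Sum>I\<in>J ` S. \<bar>g (Sup I) - g (Inf I)\<bar>) < \<epsilon>"
      using \<delta>(2) by blast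
    then show "(\<Sum>j\<in>S. \<bar>grid_increment K g j\<bar>) < \<epsilon>"
      by (simp add: sum.reindex[OF inj] Inf Sup grid_increment_def)
  qed (rule \<delta>(1))
qed

text \<open>Monotonicity makes the degree positive. With a degree above 1 the value
  \<open>E 0 + 1\<close> would be attained strictly between 0 and 1, against injectivity of
  \<open>f\<close>.\<close>

lemma circle_lift_plus_1:
  assumes lift: "circle_lift E f" and mono: "\<And>x y. x < y \<Longrightarrow> E x < E y" and "inj f"
  shows "E (x + 1) = E x + 1"
proof -
  have c: "continuous_on A E" for A using lift continuous_on_subset unfolding circle_lift_def by blast
  have "to_circle (t + 1) = to_circle t" for t by (simp add: to_circle_eq_iff)
  then have "circle_lift (\<lambda>t. E (t + 1)) f"
    using lift unfolding circle_lift_def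
    by (auto intro!: continuous_intros elim: continuous_on_compose2)
  then obtain m :: int where m: "\<And>t. E (t + 1) = E t + of_int m"
    using circle_lift_unique[OF lift] by blast
  have "0 < m" using mono[of 0 1] m[of 0] by simp
  moreover have "\<not> 1 < m"
  proof
    assume "1 < m"
    then have le: "E 0 + 1 < E 1" using m[of 0] by simp
    then obtain y where y: "0 \<le> y" "y \<le> 1" "E y = E 0 + 1"
      using IVT'[of E 0 "E 0 + 1" 1] c by auto
    then have "to_circle (E y) = to_circle (E 0)" by (simp add: to_circle_eq_iff)
    then have "f (to_circle y) = f (to_circle 0)" using lift by (simp add: circle_lift_def)
    then have "to_circle y = to_circle 0" using \<open>inj f\<close> by (simp add: inj_eq)
    then have "y \<in> \<int>" by (simp add: to_circle_eq_iff)
    moreover have "y \<noteq> 0" "y \<noteq> 1" using y le by auto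
    ultimately show False using y by (auto elim!: Ints_cases)
  qed
  ultimately have "m = 1" by simp
  then show ?thesis using m by simp
qed

text \<open>\<open>G\<close> composed with \<open>E\<close> lifts the identity and so is a
  translation; the chain rule then excludes a vanishing derivative, and monotonicity a negative
  one.\<close>

lemma circle_lift_deriv_pos:
  assumes f: "bij f" and E: "circle_lift E f" "\<And>x. (E has_real_derivative E' x) (at x)"
    and mono: "\<And>x y. x < y \<Longrightarrow> E x < E y"
    and G: "circle_lift G (inv f)" "G differentiable_on UNIV"
  shows "0 < E' x"
proof -
  have "to_circle (G (E t)) = to_circle t" for t
    using E(1) G(1) f by (simp add: circle_lift_def bij_is_inj)
  moreover have "continuous_on UNIV (\<lambda>t. G (E t))"
    using E(1) G(1) unfolding circle_lift_def by (auto elim: continuous_on_compose2)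
  ultimately have "circle_lift (\<lambda>t. G (E t)) (\<lambda>p. p)" by (simp add: circle_lift_def)
  moreover have "circle_lift (\<lambda>t. t) (\<lambda>p. p)" by (simp add: circle_lift_def)
  ultimately obtain m :: int where m: "\<And>t. G (E t) = t + of_int m"
    using circle_lift_unique by blast
  obtain d where d: "(G has_real_derivative d) (at (E x))"
    using G(2) by (metis differentiable_on_eq_differentiable_at iso_tuple_UNIV_I open_UNIV real_differentiable_def)
  have "((\<lambda>t. G (E t)) has_real_derivative d * E' x) (at x)" by (rule DERIV_chain2[OF d E(2)])
  moreover have "((\<lambda>t. G (E t)) has_real_derivative 1) (at x)"
    unfolding m by (auto intro!: derivative_eq_intros)
  ultimately have "d * E' x = 1" by (rule DERIV_unique)
  then have "E' x \<noteq> 0" by auto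
  moreover have "0 \<le> E' x"
  proof (rule ccontr)
    assume "\<not> 0 \<le> E' x"
    then obtain e where "0 < e" "\<And>h. 0 < h \<Longrightarrow> h < e \<Longrightarrow> E (x + h) < E x"
      using DERIV_neg_dec_right[OF E(2)[of x]] by auto
    from this(2)[of "e / 2"] show False using \<open>0 < e\<close> mono[of x "x + e / 2"] by simp
  qed
  ultimately show ?thesis by simp
qed

text \<open>A differentiable lift \<open>E\<close> has some translation number \<tau>, of which
  \<open>rotation_number f\<close> is only the fractional part. Subtracting the integer part of
  \<tau> from \<open>E\<close> normalises the lift and keeps its derivative.\<close>

lemma C1bv_circle_diffeo_lift:
  assumes f: "C1bv_circle_diffeo f" and ori: "orientation_preserving f" and irr: "rotation_number f \<notin> \<rat>"
  obtains F F' V where "circle_lift F f" "circle_diffeo_lift F F' (rotation_number f) V"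
proof -
  have bij: "bij f" and C1: "C1_circle_map f" "C1_circle_map (inv f)"
    and bv: "circle_bounded_variation (\<lambda>p. ln (circle_deriv f p))"
    using f by (simp_all add: C1bv_circle_diffeo_def C1_circle_diffeo_def)
  obtain E where E: "circle_lift E f" "E C1_differentiable_on UNIV" using C1(1) by (auto simp: C1_circle_map_def)
  obtain G where G: "circle_lift G (inv f)" "G C1_differentiable_on UNIV" using C1(2) by (auto simp: C1_circle_map_def)
  have Ed: "E differentiable_on UNIV" and Gd: "G differentiable_on UNIV"
    using E(2) G(2) C1_diff_imp_diff by blast+
  \<comment> \<open>The increasing lift and the differentiable one are given separately, but they
    differ by an integer.\<close>
  have mono: "E x < E y" if "x < y" for x y
  proof -
    obtain M where M: "circle_lift M f" "strict_mono M" using ori by (auto simp: orientation_preserving_def)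
    obtain m :: int where "\<And>x. E x = M x + of_int m" using circle_lift_unique[OF M(1) E(1)] by blast
    then show ?thesis using strict_monoD[OF M(2) that] by simp
  qed
  have plus1: "E (x + 1) = E x + 1" for x
    using circle_lift_plus_1[OF E(1) mono] bij by (simp add: bij_is_inj)
  have deriv: "(E has_real_derivative deriv E x) (at x)" for x
    using Ed by (metis DERIV_imp_deriv differentiable_on_eq_differentiable_at iso_tuple_UNIV_I
        open_UNIV real_differentiable_def)
  have pos: "0 < deriv E x" for x by (rule circle_lift_deriv_pos[OF bij E(1) deriv mono G(1) Gd])
  have cd: "circle_deriv f (to_circle x) = deriv E x" for x by (rule circle_deriv_eq[OF E(1) Ed])
  obtain V where V: "\<And>d. d division_of \<Union>d \<Longrightarrow> \<Union>d \<subseteq> {0..1} \<Longrightarrow>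
      (\<Sum>I\<in>d. \<bar>ln (deriv E (Sup I)) - ln (deriv E (Inf I))\<bar>) \<le> V"
    using bv unfolding circle_bounded_variation_def bounded_variation_on_def cd by metis
  have var: "variation_le (\<lambda>x. ln (deriv E x)) V"
  proof (rule variation_leI_division[OF _ V])
    fix x :: real
    have "to_circle (x + 1) = to_circle x" by (simp add: to_circle_eq_iff)
    then show "ln (deriv E (x + 1)) = ln (deriv E x)" using cd by metis
  qed
  interpret E: degree_one_lift E by standard (use plus1 mono in auto)
  obtain \<tau> where \<tau>: "(\<lambda>n. (E ^^ n) 0 / real n) \<longlonglongrightarrow> \<tau>"
    using E.rotation_convergent by (auto simp: convergent_def)
  have rot: "rotation_number f = frac \<tau>" by (rule rotation_number_eq[OF E(1) plus1 \<tau>])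
  define F where "F x = E x - of_int \<lfloor>\<tau>\<rfloor>" for x
  have F_pow: "(F ^^ n) 0 = (E ^^ n) 0 - real n * of_int \<lfloor>\<tau>\<rfloor>" for n
  proof (induction n)
    case (Suc n)
    have "(F ^^ Suc n) 0 = F ((E ^^ n) 0 + of_int (- (int n * \<lfloor>\<tau>\<rfloor>)))" by (simp add: Suc)
    also have "\<dots> = E ((E ^^ n) 0) + of_int (- (int n * \<lfloor>\<tau>\<rfloor>)) - of_int \<lfloor>\<tau>\<rfloor>"
      unfolding F_def E.lift_plus_int ..
    finally show ?case by (simp add: algebra_simps)
  qed simp
  have "(\<lambda>n. (E ^^ n) 0 / real n - of_int \<lfloor>\<tau>\<rfloor>) \<longlonglongrightarrow> \<tau> - of_int \<lfloor>\<tau>\<rfloor>"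
    using \<tau> by (intro tendsto_intros)
  moreover have "\<forall>\<^sub>F n in sequentially. (E ^^ n) 0 / real n - of_int \<lfloor>\<tau>\<rfloor> = (F ^^ n) 0 / real n"
    using eventually_gt_at_top[of 0] by eventually_elim (simp add: F_pow field_simps)
  ultimately have "(\<lambda>n. (F ^^ n) 0 / real n) \<longlonglongrightarrow> rotation_number f"
    unfolding rot frac_def by (rule Lim_transform_eventually)
  then have "circle_diffeo_lift F (deriv E) (rotation_number f) V"
    using plus1 mono deriv pos var irr
    by unfold_locales (auto simp: F_def[abs_def] intro!: derivative_eq_intros)
  moreover have "circle_lift F f"
  proof -
    have "to_circle (F x) = to_circle (E x)" for x by (subst to_circle_eq_iff) (simp add: F_def)
    then show ?thesis
      using E(1) unfolding circle_lift_def F_def[abs_def] by (auto intro!: continuous_intros)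
  qed
  ultimately show thesis using that by blast
qed

lemma circle_lift_iter: "circle_lift F f \<Longrightarrow> (f ^^ k) (to_circle x) = to_circle ((F ^^ k) x)"
  by (induction k) (simp_all add: circle_lift_def)

section \<open>Continuity and integration on the circle\<close>

lemma continuous_on_circle:
  assumes "continuous_on UNIV (\<lambda>x. h (to_circle x))"
  shows "continuous_on UNIV (h :: circle \<Rightarrow> 'a :: topological_space)"
  unfolding continuous_on_open_vimage[OF open_UNIV]
proof (intro allI impI)
  fix B :: "'a set" assume "open B"
  then have "open ((\<lambda>x. h (to_circle x)) -` B \<inter> UNIV)"
    using assms continuous_on_open_vimage[OF open_UNIV] by blast
  then show "open (h -` B \<inter> UNIV)" by (simp add: open_circle_def vimage_def)
qed

lemma integral_iterates:
  fixes \<phi> :: "circle \<Rightarrow> real"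
  assumes "invariant_prob_measure f \<mu>" "f \<in> borel_measurable borel" "\<phi> \<in> borel_measurable borel"
  shows "(\<integral>y. \<phi> ((f ^^ k) y) \<partial>\<mu>) = (\<integral>y. \<phi> y \<partial>\<mu>)"
proof (induction k)
  case (Suc k)
  have \<mu>: "sets \<mu> = sets borel" "distr \<mu> borel f = \<mu>" using assms(1) by (simp_all add: invariant_prob_measure_def)
  have f: "f \<in> measurable \<mu> borel" using assms(2) measurable_cong_sets[OF \<mu>(1) refl] by blast
  have fk: "(f ^^ k) \<in> borel_measurable borel" using assms(2) by (induction k) (auto simp: comp_def)
  have "(\<integral>y. \<phi> ((f ^^ Suc k) y) \<partial>\<mu>) = (\<integral>y. \<phi> ((f ^^ k) (f y)) \<partial>\<mu>)" by (simp add: funpow_swap1)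
  also have "\<dots> = (\<integral>y. \<phi> ((f ^^ k) y) \<partial>distr \<mu> borel f)"
    by (rule integral_distr[symmetric, OF f]) (rule measurable_compose[OF fk assms(3)])
  finally show ?case by (simp add: \<mu>(2) Suc)
qed simp

theorem theorem1:
  fixes f :: "circle \<Rightarrow> circle" and \<phi> :: "circle \<Rightarrow> real" and \<mu> :: "circle measure"
    and q :: "nat \<Rightarrow> nat"
  assumes "C1bv_circle_diffeo f" and "orientation_preserving f"
    and "rotation_number f \<notin> \<rat>"
    and "circle_absolutely_continuous \<phi>"
    and "invariant_prob_measure f \<mu>"
    and "q = convergent_denom (rotation_number f)"
  shows "uniform_limit UNIV
           (\<lambda>n x. (\<Sum>k<q n. \<phi> ((f ^^ k) x)) - real (q n) * (\<integral>y. \<phi> y \<partial>\<mu>))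
           (\<lambda>x. 0) sequentially"
proof -
  obtain F F' V where lift: "circle_lift F f" and "circle_diffeo_lift F F' (rotation_number f) V"
    using C1bv_circle_diffeo_lift[OF assms(1-3)] by blast
  then interpret circle_diffeo_lift F F' "rotation_number f" V by simp
  define g where "g x = \<phi> (to_circle x)" for x
  have ac: "absolutely_continuous_on g {0..1}"
    using assms(4) by (simp add: circle_absolutely_continuous_def g_def[abs_def])
  have per: "g (x + 1) = g x" for x
  proof -
    have "to_circle (x + 1) = to_circle x" by (simp add: to_circle_eq_iff)
    then show ?thesis by (simp add: g_def)
  qed
  have cont: "continuous_on UNIV g" by (rule continuous_of_absolutely_continuous[OF ac per])
  have "test_function g"
    unfolding test_function_def
    by (intro conjI allI per cont grid_absolutely_continuous_of_absolutely_continuous ac)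
  then have neg: "negligible_sums g" by (rule test_function_negligible_sums)
  have \<phi>_meas: "\<phi> \<in> borel_measurable borel"
    using cont unfolding g_def by (intro borel_measurable_continuous_onI continuous_on_circle)
  have "continuous_on UNIV (\<lambda>x. to_circle (F x))"
    using lift unfolding circle_lift_def
    by (intro continuous_on_compose2[OF continuous_on_to_circle[of UNIV]]) auto
  then have "continuous_on UNIV (\<lambda>x. f (to_circle x))" using lift by (simp add: circle_lift_def)
  then have f_meas: "f \<in> borel_measurable borel"
    by (intro borel_measurable_continuous_onI continuous_on_circle)
  interpret \<mu>: prob_space \<mu> using assms(5) by (simp add: invariant_prob_measure_def)
  have sets: "sets \<mu> = sets borel" using assms(5) by (simp add: invariant_prob_measure_def)
  have "compact (g ` {0..1})" using cont by (intro compact_continuous_image) (auto intro: continuous_on_subset)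
  then obtain C where C: "\<And>x. x \<in> {0..1} \<Longrightarrow> norm (g x) \<le> C"
    by (metis compact_imp_bounded bounded_iff image_eqI)
  have \<phi>_le: "norm (\<phi> p) \<le> C" for p
    by (rule to_circle_surj[of p]) (use C in \<open>auto simp: g_def\<close>)
  have fk_meas: "(f ^^ k) \<in> borel_measurable borel" for k using f_meas by (induction k) (auto simp: comp_def)
  have int: "integrable \<mu> (\<lambda>y. \<phi> ((f ^^ k) y))" for k
  proof (rule \<mu>.integrable_const_bound[where B = C])
    show "(\<lambda>y. \<phi> ((f ^^ k) y)) \<in> borel_measurable \<mu>"
      using measurable_compose[OF fk_meas \<phi>_meas] measurable_cong_sets[OF sets refl] by blast
  qed (use \<phi>_le in auto)
  define S where "S n p = (\<Sum>k<q n. \<phi> ((f ^^ k) p))" for n p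
  have S_int: "integrable \<mu> (S n)" for n unfolding S_def by (intro Bochner_Integration.integrable_sum int)
  have S_mean: "(\<integral>y. S n y \<partial>\<mu>) = real (q n) * (\<integral>y. \<phi> y \<partial>\<mu>)" for n
    unfolding S_def using int integral_iterates[OF assms(5) f_meas \<phi>_meas]
    by (simp add: Bochner_Integration.integral_sum)
  have S_lift: "S n (to_circle x) = birkhoff (q n) g x" for n x
    by (simp add: S_def birkhoff_def g_def circle_lift_iter[OF lift])
  show ?thesis
  proof (rule uniform_limitI)
    fix e :: real assume "0 < e"
    \<comment> \<open>Half of \<open>e\<close> leaves room for strictness, since integration
      preserves only the weak inequality.\<close>
    then have "0 < e / 2" by simp
    then obtain n0 where n0: "\<And>n x y. n0 \<le> n \<Longrightarrow> \<bar>birkhoff (q n) g x - birkhoff (q n) g y\<bar> \<le> e / 2"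
      using neg unfolding negligible_sums_def assms(6) by meson
    have "dist ((\<Sum>k<q n. \<phi> ((f ^^ k) p)) - real (q n) * (\<integral>y. \<phi> y \<partial>\<mu>)) 0 < e" if n: "n0 \<le> n" for n p
    proof -
      have close: "\<bar>S n p - S n y\<bar> \<le> e / 2" for y
        by (rule to_circle_surj[of p], rule to_circle_surj[of y]) (simp only: S_lift n0[OF n])
      have "S n y \<le> S n p + e / 2" "S n p - e / 2 \<le> S n y" for y using close[of y] by linarith+
      then have "(\<integral>y. S n y \<partial>\<mu>) \<le> S n p + e / 2" "S n p - e / 2 \<le> (\<integral>y. S n y \<partial>\<mu>)"
        by (auto intro!: \<mu>.integral_le_const \<mu>.integral_ge_const S_int)
      then have "\<bar>S n p - real (q n) * (\<integral>y. \<phi> y \<partial>\<mu>)\<bar> < e"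
        using \<open>0 < e\<close> unfolding S_mean by linarith
      then show ?thesis by (simp add: S_def)
    qed
    then show "\<forall>\<^sub>F n in sequentially. \<forall>x\<in>UNIV.
        dist ((\<Sum>k<q n. \<phi> ((f ^^ k) x)) - real (q n) * (\<integral>y. \<phi> y \<partial>\<mu>)) 0 < e"
      by (auto simp: eventually_sequentially)
  qed
qed

end
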